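(* Let $Z$ be a finite-dimensional real neutral strongly facially symmetric space with property JP, and let $k=\mathrm{rank}\,Z$. Then there exist real Hilbert spaces $H_1,\dots,H_k$ such that $Z$ is linearly isometric to the direct sum $$Z\cong\bigoplus_{i=1}^{k}H_i,$$ where the direct sum is equipped with the $\ell_1$-norm $\|(h_1,\dots,h_k)\|=\sum_{i=1}^k\|h_i\|_{H_i}$.
   Context: Let $Z$ be a real or complex normed space with unit ball $Z_1=\{f\in Z:\|f\|\le 1\}$ and dual $U=Z^*$. Elements $f,g\in Z$ are orthogonal, written $f\diamond g$, if $\|f+g\|=\|f-g\|=\|f\|+\|g\|$; for subsets, $S\diamond T$ means $f\diamond g$ for all $f\in S,\ g\in T$. For a subset $S$, $S^\diamond$ is the set of all elements of $Z$ orthogonal to every element of $S$. A norm exposed face of $Z_1$ is a non-empty set of the form $F_u=\{f\in Z_1:u(f)=1\}$ with $u\in Z^*$, $\|u\|=1$. An element $u\in Z^*$ is a projective unit if $\|u\|=1$ and $\langle u,f\rangle=0$ for all $f\in F_u^\diamond$. A norm exposed face $F_u$ is a symmetric face if there is a linear isometry $S_u$ of $Z$ onto $Z$ with $S_u^2=I$ (the symmetry associated with $F_u$) whose fixed point set is $(\overline{\mathrm{sp}}\,F_u)\oplus F_u^\diamond$. $Z$ is weakly facially symmetric (WFS) if every norm exposed face of $Z_1$ is symmetric. For a symmetric face $F_u$, the geometric Peirce projections are the contractive projections $P_1(F_u)=(I-S_u)/2$ (onto the $-1$ eigenspace of $S_u$), and $P_2(F_u)$, $P_0(F_u)$ the projections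 of $Z$ onto $\overline{\mathrm{sp}}\,F_u$ and $F_u^\diamond$ respectively (with $P_2(F_u)+P_1(F_u)+P_0(F_u)=I$). A geometric tripotent is a projective unit $u\in Z^*$ such that $F_u$ is a symmetric face and $S_u^*u=u$ for a symmetry $S_u$ corresponding to $F_u$. For a geometric tripotent $u$, write $P_k(u)=P_k(F_u)$, $Z_k(u)=P_k(u)Z$, $U_k(u)=P_k(u)^*Z^*$ for $k=0,1,2$. Geometric tripotents $u,v$ are orthogonal, $u\diamond v$, if $u\in U_0(v)$ (equivalently $v\in U_0(u)$; equivalently $u\pm v$ are geometric tripotents). A contractive projection $Q$ on $Z$ is neutral if, for each $f\in Z$, $\|Qf\|=\|f\|$ implies $Qf=f$. $Z$ is neutral if $P_2(F_u)$ is neutral for every symmetric face $F_u$. A WFS space $Z$ is strongly facially symmetric (SFS) if for every norm exposed face $F_u$ of $Z_1$ and every $y\in Z^*$ with $\|y\|=1$ and $F_u\subset F_y$, one has $S_u^*y=y$, where $S_u$ is a symmetry associated with $F_u$. A WFS space $Z$ has property JP (joint Peirce decomposition) if $S_uS_v=S_{u+v}$ for any pair of orthogonal geometric tripotents $u,v$, where $S_w$ is the symmetry associated with the symmetric face $F_w$ for a geometric tripotent $w$. A facially symmetric space $Z$ has rank $n$, $\mathrm{rank}\,Z=n$, if every orthogonal family of geometric tripotents has cardinality at most $n$ and some orthogonal family of geometric tripotents has exactly $n$ elements. *)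

theory Defs
  imports "HOL-Analysis.Analysis"
begin

definition orth :: "'a::real_normed_vector \<Rightarrow> 'a \<Rightarrow> bool"
  where "orth f g \<longleftrightarrow> norm (f + g) = norm f + norm g \<and> norm (f - g) = norm f + norm g"

definition orth_compl :: "'a::real_normed_vector set \<Rightarrow> 'a set"
  where "orth_compl A = {f. \<forall>g\<in>A. orth f g}"

definition face :: "('a::real_normed_vector \<Rightarrow>\<^sub>L real) \<Rightarrow> 'a set"
  where "face u = {f. norm f \<le> 1 \<and> u f = 1}"

definition norm_exposed_face :: "'a::real_normed_vector set \<Rightarrow> bool"
  where "norm_exposed_face F \<longleftrightarrow> F \<noteq> {} \<and> (\<exists>u. norm u = 1 \<and> F = face u)"

definition projective_unit :: "('a::real_normed_vector \<Rightarrow>\<^sub>L real) \<Rightarrow> bool"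
  where "projective_unit u \<longleftrightarrow> norm u = 1 \<and> (\<forall>f\<in>orth_compl (face u). u f = 0)"

text \<open>The second and third conjuncts say that the sum of the closed span of \<open>F\<close> and the
  orthogonal complement of \<open>F\<close> is a direct sum of linear subspaces. For a general set \<open>F\<close> the
  orthogonal complement need not be closed under addition.\<close>

definition is_face_symmetry :: "'a::real_normed_vector set \<Rightarrow> ('a \<Rightarrow> 'a) \<Rightarrow> bool"
  where "is_face_symmetry F S \<longleftrightarrow>
    (linear S \<and> (\<forall>f. norm (S f) = norm f) \<and> surj S \<and> S \<circ> S = id) \<and>
    subspace (orth_compl F) \<and>
    closure (span F) \<inter> orth_compl F = {0} \<and>
    {f. S f = f} = {a + b | a b. a \<in> closure (span F) \<and> b \<in> orth_compl F}"

definition symmetric_face :: "'a::real_normed_vector set \<Rightarrow> bool"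
  where "symmetric_face F \<longleftrightarrow> norm_exposed_face F \<and> (\<exists>S. is_face_symmetry F S)"

text \<open>The symmetry of a symmetric face is unique: if \<open>S\<close> and \<open>T\<close> are two of them and \<open>S z = - z\<close>,
  then \<open>m = z + T z\<close> is fixed by both, so the \<open>n\<close>-th power of the isometry \<open>S \<circ> T\<close> maps \<open>z\<close> to
  \<open>z + n m\<close>, which is bounded in \<open>n\<close> only if \<open>m = 0\<close>. Hence ``a symmetry'' and ``the symmetry''
  of a face mean the same.\<close>

lemma is_face_symmetry_unique:
  fixes F :: "'a::real_normed_vector set"
  assumes S: "is_face_symmetry F S" and T: "is_face_symmetry F T"
  shows "S = T"
proof -
  have lS: "linear S" and lT: "linear T"
    and nS: "\<And>f. norm (S f) = norm f" and nT: "\<And>f. norm (T f) = norm f"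
    and SS: "\<And>f. S (S f) = f" and TT: "\<And>f. T (T f) = f"
    using S T by (simp_all add: is_face_symmetry_def pointfree_idE)
  have "{f. S f = f} = {f. T f = f}"
    using S T by (simp only: is_face_symmetry_def)
  then have fix_eq: "S f = f \<longleftrightarrow> T f = f" for f
    by (simp add: set_eq_iff)
  have anti: "T z = - z" if z: "S z = - z" for z
  proof -
    define m where "m = z + T z"
    have Tm: "T m = m"
      by (simp add: m_def linear_add[OF lT] TT add.commute)
    then have Sm: "S m = m" by (simp add: fix_eq)
    have STz: "S (T z) = z + m"
    proof -
      have "T z = m - z" by (simp add: m_def)
      then have "S (T z) = S m - S z" by (simp add: linear_diff[OF lS])
      then show ?thesis by (simp add: Sm z add.commute)
    qed
    have step: "((S \<circ> T) ^^ n) z = z + real n *\<^sub>R m" for n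
    proof (induction n)
      case (Suc n)
      have "((S \<circ> T) ^^ Suc n) z = S (T (z + real n *\<^sub>R m))" by (simp add: Suc)
      also have "\<dots> = S (T z) + real n *\<^sub>R S (T m)"
        by (simp add: linear_add[OF lS] linear_add[OF lT] linear_scale[OF lS] linear_scale[OF lT])
      also have "\<dots> = z + real (Suc n) *\<^sub>R m"
        by (simp add: STz Tm Sm scaleR_left_distrib)
      finally show ?case .
    qed simp
    have iso: "norm (((S \<circ> T) ^^ n) z) = norm z" for n
      by (induction n) (simp_all add: nS nT)
    have bound: "real n * norm m \<le> 2 * norm z" for n
    proof -
      have "real n * norm m = norm ((z + real n *\<^sub>R m) - z)" by simp
      also have "\<dots> \<le> norm (z + real n *\<^sub>R m) + norm z" by (rule norm_triangle_ineq4)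
      also have "\<dots> = 2 * norm z" using iso[of n] by (simp add: step)
      finally show ?thesis .
    qed
    have "m = 0"
    proof (rule ccontr)
      assume "m \<noteq> 0"
      then obtain n where "2 * norm z < real n * norm m"
        using reals_Archimedean3[of "norm m"] by auto
      with bound[of n] show False by simp
    qed
    then show ?thesis by (simp add: m_def eq_neg_iff_add_eq_0 add.commute)
  qed
  show ?thesis
  proof
    fix x
    have p: "S (x + S x) = x + S x" by (simp add: linear_add[OF lS] SS add.commute)
    have q: "S (x - S x) = - (x - S x)" by (simp add: linear_diff[OF lS] SS)
    have p': "T x + T (S x) = x + S x"
      using p by (simp add: fix_eq linear_add[OF lT])
    have q': "T x - T (S x) = S x - x"
      using anti[OF q] by (simp add: linear_diff[OF lT])
    have "2 *\<^sub>R T x = (T x + T (S x)) + (T x - T (S x))" by (simp add: scaleR_2)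
    also have "\<dots> = 2 *\<^sub>R S x" by (simp only: p' q') (simp add: scaleR_2)
    finally show "S x = T x" by simp
  qed
qed

definition face_symmetry :: "'a::real_normed_vector set \<Rightarrow> 'a \<Rightarrow> 'a"
  where "face_symmetry F = (THE S. is_face_symmetry F S)"

lemma face_symmetry_eq: "is_face_symmetry F S \<Longrightarrow> face_symmetry F = S"
  unfolding face_symmetry_def by (blast intro: is_face_symmetry_unique)

text \<open>Since \<open>(I + S) / 2\<close> is the projection onto the fixed point set of the symmetry \<open>S\<close> of \<open>F\<close>,
  the Peirce projections \<open>P\<^sub>2(F)\<close> and \<open>P\<^sub>0(F)\<close> return the two components of \<open>(f + S f) / 2\<close>
  in the direct sum of the closed span and the orthogonal complement of \<open>F\<close>.\<close>

definition peirce_proj2 :: "'a::real_normed_vector set \<Rightarrow> 'a \<Rightarrow> 'a"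
  where "peirce_proj2 F f =
    (THE a. a \<in> closure (span F) \<and> (1 / 2) *\<^sub>R (f + face_symmetry F f) - a \<in> orth_compl F)"

definition peirce_proj0 :: "'a::real_normed_vector set \<Rightarrow> 'a \<Rightarrow> 'a"
  where "peirce_proj0 F f =
    (THE b. b \<in> orth_compl F \<and> (1 / 2) *\<^sub>R (f + face_symmetry F f) - b \<in> closure (span F))"

definition geometric_tripotent :: "('a::real_normed_vector \<Rightarrow>\<^sub>L real) \<Rightarrow> bool"
  where "geometric_tripotent u \<longleftrightarrow>
    projective_unit u \<and> symmetric_face (face u) \<and> (\<forall>f. u (face_symmetry (face u) f) = u f)"

text \<open>\<open>U\<^sub>0(v)\<close> is the range of the adjoint of \<open>P\<^sub>0(v)\<close>.\<close>

definition dual_peirce0 ::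
  "('a::real_normed_vector \<Rightarrow>\<^sub>L real) \<Rightarrow> ('a \<Rightarrow>\<^sub>L real) set"
  where "dual_peirce0 v = {y :: 'a \<Rightarrow>\<^sub>L real. \<exists>x :: 'a \<Rightarrow>\<^sub>L real. \<forall>f. y f = x (peirce_proj0 (face v) f)}"

definition tripotent_orth ::
  "('a::real_normed_vector \<Rightarrow>\<^sub>L real) \<Rightarrow> ('a \<Rightarrow>\<^sub>L real) \<Rightarrow> bool"
  where "tripotent_orth u v \<longleftrightarrow> u \<in> dual_peirce0 v"

definition contractive_projection :: "('a::real_normed_vector \<Rightarrow> 'a) \<Rightarrow> bool"
  where "contractive_projection Q \<longleftrightarrow> linear Q \<and> Q \<circ> Q = Q \<and> (\<forall>f. norm (Q f) \<le> norm f)"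

definition neutral_projection :: "('a::real_normed_vector \<Rightarrow> 'a) \<Rightarrow> bool"
  where "neutral_projection Q \<longleftrightarrow>
    contractive_projection Q \<and> (\<forall>f. norm (Q f) = norm f \<longrightarrow> Q f = f)"

text \<open>The following are properties of the normed space carried by the type \<open>'a\<close>.\<close>

definition weakly_facially_symmetric :: "'a::real_normed_vector itself \<Rightarrow> bool"
  where "weakly_facially_symmetric _ \<longleftrightarrow>
    (\<forall>F :: 'a set. norm_exposed_face F \<longrightarrow> symmetric_face F)"

definition strongly_facially_symmetric :: "'a::real_normed_vector itself \<Rightarrow> bool"
  where "strongly_facially_symmetric _ \<longleftrightarrow>
    weakly_facially_symmetric TYPE('a) \<and>
    (\<forall>(F :: 'a set) (y :: 'a \<Rightarrow>\<^sub>L real).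
      norm_exposed_face F \<longrightarrow> norm y = 1 \<longrightarrow> F \<subseteq> face y \<longrightarrow> (\<forall>f. y (face_symmetry F f) = y f))"

definition neutral_space :: "'a::real_normed_vector itself \<Rightarrow> bool"
  where "neutral_space _ \<longleftrightarrow>
    (\<forall>F :: 'a set. symmetric_face F \<longrightarrow> neutral_projection (peirce_proj2 F))"

definition property_JP :: "'a::real_normed_vector itself \<Rightarrow> bool"
  where "property_JP _ \<longleftrightarrow>
    (\<forall>(u :: 'a \<Rightarrow>\<^sub>L real) v.
      geometric_tripotent u \<longrightarrow> geometric_tripotent v \<longrightarrow> tripotent_orth u v \<longrightarrow>
      face_symmetry (face u) \<circ> face_symmetry (face v) = face_symmetry (face (u + v)))"

definition orthogonal_tripotents :: "('a::real_normed_vector \<Rightarrow>\<^sub>L real) set \<Rightarrow> bool"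
  where "orthogonal_tripotents A \<longleftrightarrow>
    (\<forall>u\<in>A. geometric_tripotent u) \<and> pairwise tripotent_orth A"

definition has_rank :: "'a::real_normed_vector itself \<Rightarrow> nat \<Rightarrow> bool"
  where "has_rank _ n \<longleftrightarrow>
    (\<forall>A :: ('a \<Rightarrow>\<^sub>L real) set. orthogonal_tripotents A \<longrightarrow> finite A \<and> card A \<le> n) \<and>
    (\<exists>A :: ('a \<Rightarrow>\<^sub>L real) set. orthogonal_tripotents A \<and> finite A \<and> card A = n)"

definition facial_rank :: "'a::real_normed_vector itself \<Rightarrow> nat"
  where "facial_rank _ = (THE n. has_rank TYPE('a) n)"

text \<open>A real Hilbert space given by a linear subspace \<open>V\<close> of a real vector space together with an
  inner product on \<open>V\<close>; a norm on the ambient type plays no role. The last conjunct is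
  completeness with respect to the norm of the inner product.\<close>

definition ip_norm :: "('v::real_vector \<Rightarrow> 'v \<Rightarrow> real) \<Rightarrow> 'v \<Rightarrow> real"
  where "ip_norm ip x = sqrt (ip x x)"

definition real_hilbert_space_on ::
  "'v::real_vector set \<Rightarrow> ('v \<Rightarrow> 'v \<Rightarrow> real) \<Rightarrow> bool"
  where "real_hilbert_space_on V ip \<longleftrightarrow>
    subspace V \<and>
    (\<forall>x\<in>V. \<forall>y\<in>V. ip x y = ip y x) \<and>
    (\<forall>x\<in>V. \<forall>y\<in>V. \<forall>z\<in>V. ip (x + y) z = ip x z + ip y z) \<and>
    (\<forall>c. \<forall>x\<in>V. \<forall>y\<in>V. ip (c *\<^sub>R x) y = c * ip x y) \<and>
    (\<forall>x\<in>V. x \<noteq> 0 \<longrightarrow> 0 < ip x x) \<and>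
    (\<forall>X :: nat \<Rightarrow> 'v. (\<forall>n. X n \<in> V) \<longrightarrow>
      (\<forall>e>0. \<exists>N. \<forall>m\<ge>N. \<forall>n\<ge>N. ip_norm ip (X m - X n) < e) \<longrightarrow>
      (\<exists>l\<in>V. (\<lambda>n. ip_norm ip (X n - l)) \<longlonglongrightarrow> 0))"

text \<open>\<open>T\<close> is a linear isometry of the whole space onto the external direct sum, with the
  \<open>\<ell>\<^sub>1\<close>-norm, of the inner product spaces \<open>(H i, ip i)\<close> for \<open>i\<close> in \<open>I\<close>. Elements of the sum are
  extensional functions on \<open>I\<close>, with the vector space operations taken componentwise.\<close>

definition isometry_onto_l1_sum ::
  "'i set \<Rightarrow> ('i \<Rightarrow> 'v::real_vector set) \<Rightarrow> ('i \<Rightarrow> 'v \<Rightarrow> 'v \<Rightarrow> real) \<Rightarrow>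
   ('a::real_normed_vector \<Rightarrow> 'i \<Rightarrow> 'v) \<Rightarrow> bool"
  where "isometry_onto_l1_sum I H ip T \<longleftrightarrow>
    bij_betw T UNIV (\<Pi>\<^sub>E i\<in>I. H i) \<and>
    (\<forall>i\<in>I. linear (\<lambda>f. T f i)) \<and>
    (\<forall>f. norm f = (\<Sum>i\<in>I. ip_norm (ip i) (T f i)))"

end

theory Submission
  imports Defs
begin

text \<open>
  Exposed points of the unit ball carry the proof. At an exposed point \<open>e\<close> the projection
  \<open>P\<^sub>2\<close> has the form \<open>x \<mapsto> \<phi>\<^sub>e(x) e\<close>, neutrality says that \<open>\<phi>\<^sub>e\<close> exposes \<open>e\<close>, and strong
  facial symmetry says that every functional of norm one with value \<open>1\<close> at \<open>e\<close> is invariant under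
  the symmetry at \<open>e\<close>. There are enough exposed points: in the range of every neutral
  projection they determine the norm of functionals (\<open>exposed_norming\<close>). A frame is a set of
  mutually orthogonal exposed points; a frame \<open>M\<close> of largest size has complement \<open>{0}\<close>.

  The main step is that for distinct \<open>e\<close>, \<open>g\<close> in \<open>M\<close> the two symmetries have no common
  \<open>-1\<close>-eigenvector (\<open>joint_peirce1_trivial\<close>). Here joint Peirce decomposition shows that the faces
  of \<open>\<phi>\<^sub>e + \<phi>\<^sub>g\<close> and \<open>\<phi>\<^sub>e - \<phi>\<^sub>g\<close> span the same space \<open>V\<close>, so both are facets of its
  ball, and they meet at \<open>e\<close>. If there were an eigenvector, strong facial symmetry would make \<open>e\<close> a
  limit of other exposed points \<open>f\<close> of \<open>V\<close>. The images of a facet under a sequence of isometries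
  coincide along a subsequence (\<open>facet_images_subsequence\<close>); for the symmetries at such points \<open>f\<close>
  this implies that one of them fixes \<open>e\<close>, which is impossible when \<open>f\<close> is close to \<open>e\<close>
  (\<open>fixed_exposed_isolated\<close>).

  Consequently the sum \<open>H\<^sub>e\<close> of \<open>\<real>e\<close> and the \<open>-1\<close>-eigenspace at \<open>e\<close> is orthogonal to the other
  elements of \<open>M\<close>, and the space is the direct sum of the \<open>H\<^sub>e\<close>. In \<open>H\<^sub>e\<close> the symmetry at
  an exposed point \<open>f\<close> is \<open>x \<mapsto> 2 \<phi>\<^sub>f(x) f - x\<close>. The facet argument, applied to a supporting
  face of an arbitrary unit vector, shows that every unit vector of \<open>H\<^sub>e\<close> is exposed
  (\<open>unit_vector_exposed\<close>). Replacing the elements of \<open>M\<close> by arbitrary unit vectors of their summands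
  therefore gives another frame, and the norm is the \<open>\<ell>\<^sub>1\<close>-sum of the norms of the components.
  Within \<open>H\<^sub>e\<close> any two independent unit vectors are exchanged by one of the symmetries, hence
  \<open>\<phi>\<^sub>x(y) = \<phi>\<^sub>y(x)\<close> (\<open>phi_symmetric\<close>), and \<open>\<parallel>x\<parallel> \<phi>\<^bsub>x/\<parallel>x\<parallel>\<^esub>(y)\<close> is an inner product.
  Finally, orthogonal tripotents have orthogonal faces, and orthogonal vectors have no
  common nonzero component, so that the rank is the number of elements of \<open>M\<close>.
\<close>

section \<open>Finite-dimensional normed spaces\<close>

lemma compact_coefficient_cube:
  fixes A :: "'a::real_normed_vector set"
  assumes "finite A"
  shows "compact {\<Sum>b\<in>A. c b *\<^sub>R b | c. \<forall>b\<in>A. \<bar>c b\<bar> \<le> 1}"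
  using assms
proof (induction A rule: finite_induct)
  case (insert a A)
  let ?K = "{\<Sum>b\<in>A. c b *\<^sub>R b | c. \<forall>b\<in>A. \<bar>c b\<bar> \<le> (1::real)}"
  have "compact ((\<lambda>(t, x). t *\<^sub>R a + x) ` ({-1..1::real} \<times> ?K))"
    by (intro compact_continuous_image compact_Times insert.IH)
      (auto simp: case_prod_unfold intro!: continuous_intros)
  also have "(\<lambda>(t, x). t *\<^sub>R a + x) ` ({-1..1::real} \<times> ?K)
    = {\<Sum>b\<in>insert a A. c b *\<^sub>R b | c. \<forall>b\<in>insert a A. \<bar>c b\<bar> \<le> 1}" (is "?L = ?R")
  proof
    show "?L \<subseteq> ?R"
    proof clarify
      fix t :: real and c :: "'a \<Rightarrow> real"
      assume t: "t \<in> {-1..1}" and c: "\<forall>b\<in>A. \<bar>c b\<bar> \<le> 1"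
      have "t *\<^sub>R a + (\<Sum>b\<in>A. c b *\<^sub>R b) = (\<Sum>b\<in>insert a A. (c(a := t)) b *\<^sub>R b)"
        using insert.hyps by (simp, intro sum.cong) auto
      moreover have "\<forall>b\<in>insert a A. \<bar>(c(a := t)) b\<bar> \<le> 1" using t c by auto
      ultimately show "\<exists>d. t *\<^sub>R a + (\<Sum>b\<in>A. c b *\<^sub>R b) = (\<Sum>b\<in>insert a A. d b *\<^sub>R b) \<and>
          (\<forall>b\<in>insert a A. \<bar>d b\<bar> \<le> 1)" by (intro exI conjI)
    qed
    show "?R \<subseteq> ?L"
    proof clarify
      fix c :: "'a \<Rightarrow> real"
      assume c: "\<forall>b\<in>insert a A. \<bar>c b\<bar> \<le> 1"
      then have "(c a, \<Sum>b\<in>A. c b *\<^sub>R b) \<in> {-1..1::real} \<times> ?K" by (auto simp: abs_le_iff)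
      then show "(\<Sum>b\<in>insert a A. c b *\<^sub>R b) \<in> ?L"
        using insert.hyps by (auto intro!: image_eqI)
    qed
  qed
  finally show ?case .
qed simp

text \<open>By homogeneity it is enough to bound the norm from below on combinations one of whose
  coefficients is \<open>1\<close> while the others lie in \<open>[-1, 1]\<close>. These form a compact set, which
  avoids \<open>0\<close> by independence.\<close>

lemma independent_coefficients_bounded:
  fixes B :: "'a::real_normed_vector set"
  assumes fin: "finite B" and ind: "independent B"
  obtains C where "C > 0" "\<And>c b. b \<in> B \<Longrightarrow> \<bar>c b\<bar> \<le> C * norm (\<Sum>b\<in>B. c b *\<^sub>R b)"
proof -
  have "\<exists>d>0. \<forall>c. (\<forall>a\<in>B - {b}. \<bar>c a\<bar> \<le> 1) \<longrightarrow> d \<le> norm (b + (\<Sum>a\<in>B - {b}. c a *\<^sub>R a))"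
    if b: "b \<in> B" for b
  proof -
    define K where "K = (+) b ` {\<Sum>a\<in>B - {b}. c a *\<^sub>R a | c. \<forall>a\<in>B - {b}. \<bar>c a\<bar> \<le> 1}"
    have "compact K"
      unfolding K_def using compact_coefficient_cube[of "B - {b}"] fin
      by (intro compact_continuous_image continuous_intros) auto
    moreover have "0 \<notin> K"
    proof
      assume "0 \<in> K"
      then obtain c where c: "b + (\<Sum>a\<in>B - {b}. c a *\<^sub>R a) = 0" by (auto simp: K_def)
      then have "b = - (\<Sum>a\<in>B - {b}. c a *\<^sub>R a)" by (simp add: eq_neg_iff_add_eq_0)
      also have "\<dots> \<in> span (B - {b})"
        by (intro span_neg span_sum span_scale span_base)
      finally show False using ind b by (auto simp: dependent_def)
    qed
    ultimately have "open (- K)" "0 \<in> - K" by (auto intro: compact_imp_closed)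
    then obtain d where d: "d > 0" "ball 0 d \<subseteq> - K" by (meson openE)
    have "d \<le> norm x" if "x \<in> K" for x using that d(2) by force
    then have "d \<le> norm (b + (\<Sum>a\<in>B - {b}. c a *\<^sub>R a))" if "\<forall>a\<in>B - {b}. \<bar>c a\<bar> \<le> 1" for c
      using that by (force simp: K_def)
    then show ?thesis using d(1) by blast
  qed
  then obtain d where d: "\<And>b. b \<in> B \<Longrightarrow> d b > 0"
    "\<And>b c. b \<in> B \<Longrightarrow> (\<forall>a\<in>B - {b}. \<bar>c a\<bar> \<le> 1) \<Longrightarrow> d b \<le> norm (b + (\<Sum>a\<in>B - {b}. c a *\<^sub>R a))"
    by metis
  define C where "C = 1 + (\<Sum>b\<in>B. 1 / d b)"
  have C: "1 / d b \<le> C" if "b \<in> B" for b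
    unfolding C_def using that fin d(1)
    by (intro order_trans[OF member_le_sum[of b B "\<lambda>b. 1 / d b"]]) (auto intro: less_imp_le)
  have "C > 0" unfolding C_def using d(1) by (intro add_pos_nonneg sum_nonneg) (auto intro: less_imp_le)
  moreover have "\<bar>c b\<bar> \<le> C * norm (\<Sum>b\<in>B. c b *\<^sub>R b)" if b: "b \<in> B" for c b
  proof -
    let ?n = "norm (\<Sum>b\<in>B. c b *\<^sub>R b)"
    obtain m where m: "m \<in> B" "\<And>a. a \<in> B \<Longrightarrow> \<bar>c a\<bar> \<le> \<bar>c m\<bar>"
    proof -
      have "Max ((\<lambda>a. \<bar>c a\<bar>) ` B) \<in> (\<lambda>a. \<bar>c a\<bar>) ` B" using fin b by (intro Max_in) auto
      then obtain m where "m \<in> B" "Max ((\<lambda>a. \<bar>c a\<bar>) ` B) = \<bar>c m\<bar>" by auto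
      moreover have "\<bar>c a\<bar> \<le> Max ((\<lambda>a. \<bar>c a\<bar>) ` B)" if "a \<in> B" for a using fin that by auto
      ultimately show thesis using that by metis
    qed
    show ?thesis
    proof (cases "c m = 0")
      case True
      then show ?thesis using m(2)[OF b] \<open>C > 0\<close> by simp
    next
      case False
      have "(\<Sum>b\<in>B. c b *\<^sub>R b) = c m *\<^sub>R (m + (\<Sum>a\<in>B - {m}. (c a / c m) *\<^sub>R a))"
        using fin m(1) False
        by (simp add: sum.remove[of B m] scaleR_add_right scaleR_sum_right)
      then have "?n = \<bar>c m\<bar> * norm (m + (\<Sum>a\<in>B - {m}. (c a / c m) *\<^sub>R a))" by simp
      also have "\<dots> \<ge> \<bar>c m\<bar> * d m"
        using m False by (intro mult_left_mono d(2)) auto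
      finally have "\<bar>c m\<bar> \<le> (1 / d m) * ?n" using d(1)[OF m(1)] by (simp add: field_simps)
      also have "\<dots> \<le> C * ?n" using C[OF m(1)] by (intro mult_right_mono) auto
      finally show ?thesis using m(2)[OF b] by linarith
    qed
  qed
  ultimately show thesis by (rule that)
qed

locale finite_dimensional_normed =
  fixes B :: "'a::real_normed_vector set"
  assumes finite_basis: "finite B"
    and independent_basis: "independent B"
    and span_basis: "span B = UNIV"
begin

definition coord :: "'a \<Rightarrow> 'a \<Rightarrow> real"
  where "coord b x = representation B x b"

lemma linear_coord: "linear (coord b)"
  by (rule linearI)
    (simp_all add: coord_def representation_add representation_scale independent_basis span_basis)

lemma sum_coord: "(\<Sum>b\<in>B. coord b x *\<^sub>R b) = x"
  unfolding coord_def
  by (rule sum_representation_eq) (simp_all add: independent_basis span_basis finite_basis)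

lemma coord_bounded: obtains C where "C > 0" "\<And>b x. b \<in> B \<Longrightarrow> \<bar>coord b x\<bar> \<le> C * norm x"
proof -
  obtain C where "C > 0" "\<And>c b. b \<in> B \<Longrightarrow> \<bar>c b\<bar> \<le> C * norm (\<Sum>b\<in>B. c b *\<^sub>R b)"
    by (rule independent_coefficients_bounded[OF finite_basis independent_basis]) blast
  from this(1) this(2)[of _ "\<lambda>b. coord b x" for x] show thesis
    by (intro that[of C]) (auto simp: sum_coord)
qed

lemma compact_cball: "compact (cball (0::'a) R)"
proof -
  obtain C where C: "C > 0" "\<And>b x. b \<in> B \<Longrightarrow> \<bar>coord b x\<bar> \<le> C * norm x"
    using coord_bounded by blast
  define r where "r = max R 1"
  let ?K = "(\<lambda>x. (C * r) *\<^sub>R x) ` {\<Sum>b\<in>B. c b *\<^sub>R b | c. \<forall>b\<in>B. \<bar>c b\<bar> \<le> 1}"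
  have "compact ?K"
    using compact_coefficient_cube[OF finite_basis] by (rule compact_scaling)
  then have "compact (?K \<inter> cball 0 R)" by (rule compact_Int_closed) simp
  moreover have "cball 0 R \<subseteq> ?K"
  proof
    fix x :: 'a assume "x \<in> cball 0 R"
    then have nx: "norm x \<le> r" by (simp add: r_def)
    have r: "C * r > 0" using C(1) by (simp add: r_def)
    have "\<bar>coord b x / (C * r)\<bar> \<le> 1" if "b \<in> B" for b
    proof -
      have "\<bar>coord b x\<bar> \<le> C * r"
        using C(2)[OF that, of x] mult_left_mono[OF nx, of C] C(1) by linarith
      then show ?thesis using r by (simp add: divide_simps)
    qed
    moreover have "x = (C * r) *\<^sub>R (\<Sum>b\<in>B. (coord b x / (C * r)) *\<^sub>R b)"
    proof -
      have "(C * r) * (coord b x / (C * r)) = coord b x" for b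
        using r by (metis less_irrefl nonzero_mult_div_cancel_left times_divide_eq_right)
      then show ?thesis by (simp only: scaleR_sum_right scaleR_scaleR sum_coord)
    qed
    ultimately show "x \<in> ?K"
      by (intro image_eqI[where x = "\<Sum>b\<in>B. (coord b x / (C * r)) *\<^sub>R b"] CollectI exI conjI)
        auto
  qed
  ultimately show ?thesis by (simp add: Int_absorb1)
qed

lemma bounded_sequence_converges:
  fixes X :: "nat \<Rightarrow> 'a"
  assumes "\<And>n. norm (X n) \<le> R"
  obtains l r where "strict_mono r" "(X \<circ> r) \<longlonglongrightarrow> l" "norm l \<le> R"
proof -
  have "\<forall>n. X n \<in> cball 0 R" using assms by simp
  then obtain l r where "l \<in> cball 0 R" "strict_mono (r :: nat \<Rightarrow> nat)" "(X \<circ> r) \<longlonglongrightarrow> l"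
    using compact_cball[of R] unfolding compact_def by metis
  then show thesis using that by auto
qed

lemma linear_imp_bounded:
  fixes f :: "'a \<Rightarrow> 'b::real_normed_vector"
  assumes "linear f"
  shows "bounded_linear f"
proof -
  obtain C where C: "C > 0" "\<And>b x. b \<in> B \<Longrightarrow> \<bar>coord b x\<bar> \<le> C * norm x"
    using coord_bounded by blast
  have "norm (f x) \<le> norm x * (\<Sum>b\<in>B. C * norm (f b))" for x
  proof -
    have "f x = (\<Sum>b\<in>B. coord b x *\<^sub>R f b)"
      by (subst sum_coord[of x, symmetric]) (simp add: linear_sum[OF assms] linear_scale[OF assms])
    also have "norm \<dots> \<le> (\<Sum>b\<in>B. (C * norm x) * norm (f b))"
      using C(2) by (intro sum_norm_le) (auto intro!: mult_right_mono)
    finally show ?thesis by (simp add: sum_distrib_left mult_ac)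
  qed
  then show ?thesis
    using assms by (intro bounded_linear_intro[where K = "\<Sum>b\<in>B. C * norm (f b)"])
      (simp_all add: linear_add linear_scale)
qed

lemma linear_tendsto:
  fixes f :: "'a \<Rightarrow> 'b::real_normed_vector"
  assumes "linear f" "X \<longlonglongrightarrow> l"
  shows "(\<lambda>n. f (X n)) \<longlonglongrightarrow> f l"
  using bounded_linear.tendsto[OF linear_imp_bounded[OF assms(1)] assms(2)] .

lemma functional_blinfun:
  assumes "linear u" "\<And>x. u x \<le> norm x" "norm z \<le> 1" "u z = 1"
  obtains U :: "'a \<Rightarrow>\<^sub>L real" where "norm U = 1" "\<And>x. U x = u x"
proof -
  define U where "U = Blinfun u"
  have U: "blinfun_apply U x = u x" for x
    unfolding U_def using linear_imp_bounded[OF assms(1)] by (simp add: bounded_linear_Blinfun_apply)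
  have "\<bar>u x\<bar> \<le> norm x" for x
    using assms(2)[of x] assms(2)[of "- x"] by (simp add: linear_neg[OF assms(1)])
  then have "norm U \<le> 1" by (intro norm_blinfun_bound) (simp_all add: U)
  moreover have "1 \<le> norm U"
  proof -
    have "1 = norm (U z)" by (simp add: U assms)
    also have "\<dots> \<le> norm U * norm z" by (rule norm_blinfun)
    also have "\<dots> \<le> norm U" using assms(3) by (simp add: mult_left_le)
    finally show ?thesis .
  qed
  ultimately show thesis using that U by force
qed

lemma subspace_finite_basis:
  fixes V :: "'a set"
  obtains A where "A \<subseteq> V" "finite A" "independent A" "span A = span V"
proof -
  obtain A where A: "A \<subseteq> V" "independent A" "V \<subseteq> span A"
    by (rule maximal_independent_subset) blast
  have "finite A"
    using independent_span_bound[OF finite_basis A(2)] span_basis by simp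
  moreover have "span A = span V"
    using A by (metis span_mono span_span subset_antisym)
  ultimately show thesis using that A by blast
qed

lemma independent_card_bound:
  fixes A :: "'a set"
  assumes "independent A"
  shows "finite A" "card A \<le> card B"
  using independent_span_bound[OF finite_basis assms] span_basis by simp_all

text \<open>A basis of the subspace extends to a basis of the whole space, and the subspace is the common
  kernel of the coordinates at the added vectors, which are continuous.\<close>

lemma subspace_closed:
  fixes V :: "'a set"
  assumes "subspace V"
  shows "closed V"
proof -
  obtain A where A: "A \<subseteq> V" "finite A" "independent A" "span A = V"
    using subspace_finite_basis[of V] assms by (metis span_eq_iff)
  define E where "E = extend_basis A"
  have E: "A \<subseteq> E" "independent E" "span E = UNIV"
    using A(3) by (simp_all add: E_def extend_basis_superset independent_extend_basis span_extend_basis)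
  interpret V: finite_dimensional_normed E
    by unfold_locales (use E independent_card_bound(1) in auto)
  have "V = (\<Inter>b\<in>E - A. {x. V.coord b x = 0})"
  proof
    have "V.coord b x = 0" if b: "b \<in> E - A" and x: "x \<in> span A" for b x
      using representation_extend[OF E(2) x E(1)] representation_ne_zero[of A x b] b
      unfolding V.coord_def by auto
    then show "V \<subseteq> (\<Inter>b\<in>E - A. {x. V.coord b x = 0})" using A(4) by blast
    show "(\<Inter>b\<in>E - A. {x. V.coord b x = 0}) \<subseteq> V"
    proof
      fix x assume x: "x \<in> (\<Inter>b\<in>E - A. {x. V.coord b x = 0})"
      have "x = (\<Sum>b\<in>E. V.coord b x *\<^sub>R b)" by (simp add: V.sum_coord)
      also have "\<dots> = (\<Sum>b\<in>A. V.coord b x *\<^sub>R b)"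
        using x E(1) V.finite_basis by (intro sum.mono_neutral_right) auto
      also have "\<dots> \<in> span A" by (intro span_sum span_scale span_base)
      finally show "x \<in> V" using A(4) by simp
    qed
  qed
  moreover have "closed {x. V.coord b x = 0}" for b
    using linear_continuous_on[OF V.linear_imp_bounded[OF V.linear_coord]]
    by (intro closed_Collect_eq) auto
  ultimately show ?thesis by (metis (no_types, lifting) closed_INT)
qed

lemma closure_span: "closure (span A) = span (A :: 'a set)"
  by (intro closure_closed subspace_closed subspace_span)

subsection \<open>A Euclidean structure\<close>

definition eucl :: "'a \<Rightarrow> 'a \<Rightarrow> real"
  where "eucl x y = (\<Sum>b\<in>B. coord b x * coord b y)"

lemma eucl_commute: "eucl x y = eucl y x"
  by (simp add: eucl_def mult.commute)

lemma linear_eucl: "linear (eucl x)"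
  by (rule linearI) (simp_all add: eucl_def linear_add[OF linear_coord] linear_scale[OF linear_coord]
      algebra_simps sum.distrib sum_distrib_left)

lemma eucl_pos: "x \<noteq> 0 \<Longrightarrow> 0 < eucl x x"
proof -
  assume "x \<noteq> 0"
  then obtain b where "b \<in> B" "coord b x \<noteq> 0"
    by (metis (no_types, lifting) scale_zero_left sum.neutral sum_coord)
  then show ?thesis unfolding eucl_def
    using finite_basis by (intro sum_pos2[of _ b]) (auto simp: zero_less_mult_iff)
qed

lemma eucl_diff_self: "eucl (x - y) (x - y) = eucl x x - 2 * eucl x y + eucl y y"
  using eucl_commute
  by (simp add: eucl_def linear_diff[OF linear_coord] algebra_simps sum.distrib sum_subtractf
      sum_distrib_left)

lemma continuous_on_eucl: "continuous_on A (\<lambda>x. eucl x x)"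
  unfolding eucl_def
  by (intro continuous_intros linear_continuous_on linear_imp_bounded linear_coord)

text \<open>A maximiser \<open>f\<close> of the strictly convex function \<open>2 R y + |x|\<^sup>2\<close> over the unit ball
  of \<open>V\<close> is exposed by the linear part \<open>2 R y + 2 \<langle>f, x\<rangle>\<close> of its expansion at \<open>f\<close>, and
  for large \<open>R\<close> the value \<open>y f\<close> is close to the maximum of \<open>y\<close>.\<close>

lemma strictly_exposed_point:
  fixes V :: "'a set" and y :: "'a \<Rightarrow> real"
  assumes V: "subspace V" and y: "linear y" and x0: "x0 \<in> V" "norm x0 \<le> 1" "c < y x0"
  obtains f and l :: "'a \<Rightarrow> real" where "f \<in> V" "norm f \<le> 1" "c < y f" "linear l"
    "\<And>x. x \<in> V \<Longrightarrow> norm x \<le> 1 \<Longrightarrow> x \<noteq> f \<Longrightarrow> l x < l f"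
proof -
  let ?K = "V \<inter> cball 0 1"
  have cK: "compact ?K"
    by (rule closed_Int_compact[OF subspace_closed[OF V] compact_cball])
  have x0K: "x0 \<in> ?K" using x0 by simp
  then have ne: "?K \<noteq> {}" by blast
  obtain m where m: "m \<in> ?K" "\<And>x. x \<in> ?K \<Longrightarrow> eucl x x \<le> eucl m m"
    using continuous_attains_sup[OF cK ne continuous_on_eucl] by blast
  define R where "R = (eucl m m + 1) / (2 * (y x0 - c))"
  have "eucl m m \<ge> 0" using eucl_pos[of m] linear_0[OF linear_eucl] by (cases "m = 0") auto
  then have R: "R > 0" using x0(3) by (auto simp: R_def)
  have "continuous_on ?K (\<lambda>x. 2 * R * y x + eucl x x)"
    by (intro continuous_intros continuous_on_eucl linear_continuous_on linear_imp_bounded y)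
  from continuous_attains_sup[OF cK ne this]
  obtain f where f: "f \<in> ?K" "\<And>x. x \<in> ?K \<Longrightarrow> 2 * R * y x + eucl x x \<le> 2 * R * y f + eucl f f"
    by blast
  define l where "l x = 2 * R * y x + 2 * eucl f x" for x
  have "linear l"
    by (rule linearI) (simp_all add: l_def linear_add[OF y] linear_scale[OF y]
        linear_add[OF linear_eucl] linear_scale[OF linear_eucl] algebra_simps)
  moreover have "l x < l f" if "x \<in> V" "norm x \<le> 1" "x \<noteq> f" for x
  proof -
    have "2 * R * y x + eucl x x \<le> 2 * R * y f + eucl f f" using that by (intro f(2)) auto
    moreover have "0 < eucl (x - f) (x - f)" using that by (intro eucl_pos) auto
    ultimately show ?thesis by (simp add: l_def eucl_diff_self eucl_commute[of x f])
  qed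
  moreover have "c < y f"
  proof -
    have "0 \<le> eucl x0 x0" using eucl_pos[of x0] linear_0[OF linear_eucl] by (cases "x0 = 0") auto
    then have "2 * R * y x0 \<le> 2 * R * y f + eucl m m" using f(2)[OF x0K] m(2)[OF f(1)] by linarith
    moreover have "2 * R * (y x0 - c) = eucl m m + 1"
    proof -
      have "2 * (y x0 - c) \<noteq> 0" using x0(3) by simp
      from iffD1[OF nonzero_eq_divide_eq[OF this] R_def] show ?thesis by (simp add: algebra_simps)
    qed
    ultimately have "2 * R * c < 2 * R * y f" by (simp add: algebra_simps)
    then show ?thesis using R by simp
  qed
  ultimately show thesis using f(1) by (intro that[of f l]) auto
qed

subsection \<open>Dominated functionals\<close>

definition sublinear :: "('a \<Rightarrow> real) \<Rightarrow> bool"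
  where "sublinear q \<longleftrightarrow> (\<forall>x y. q (x + y) \<le> q x + q y) \<and> (\<forall>c x. c \<ge> 0 \<longrightarrow> q (c *\<^sub>R x) = c * q x)"

lemma sublinear_norm: "sublinear norm"
  by (simp add: sublinear_def norm_triangle_ineq)

lemma sublinear_zero: "sublinear q \<Longrightarrow> q 0 = 0"
  unfolding sublinear_def by (metis mult_zero_left order_refl scale_zero_left)

lemma sublinear_neg: "sublinear q \<Longrightarrow> 0 \<le> q x + q (- x)"
  using sublinear_zero unfolding sublinear_def by (metis add.right_inverse)

text \<open>The functional \<open>x \<mapsto> inf\<^sub>t (q (x + t z) - t c)\<close> is the largest sublinear minorant of \<open>q\<close>
  that is linear along \<open>z\<close> with slope \<open>c\<close>.\<close>

lemma sublinear_minorant: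
  assumes q: "sublinear q" and c: "\<And>t. t * c \<le> q (t *\<^sub>R z)"
  obtains p where "sublinear p" "\<And>x. p x \<le> q x" "p z \<le> c" "p (- z) \<le> - c"
    "\<And>x l. (\<And>t. l \<le> q (x + t *\<^sub>R z) - t * c) \<Longrightarrow> l \<le> p x"
proof -
  define p where "p x = (INF t. q (x + t *\<^sub>R z) - t * c)" for x
  have sub: "q (x + y) \<le> q x + q y" for x y using q by (simp add: sublinear_def)
  have hom: "q (s *\<^sub>R x) = s * q x" if "s \<ge> 0" for s x using q that by (simp add: sublinear_def)
  have "- q (- x) \<le> q (x + t *\<^sub>R z) - t * c" for x t
    using sub[of "x + t *\<^sub>R z" "- x"] c[of t] by simp
  then have bdd: "bdd_below (range (\<lambda>t. q (x + t *\<^sub>R z) - t * c))" for x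
    by (intro bdd_belowI[of _ "- q (- x)"]) auto
  have upper: "p x \<le> q (x + t *\<^sub>R z) - t * c" for x t
    unfolding p_def by (rule cINF_lower[OF bdd]) simp
  have lower: "l \<le> p x" if "\<And>t. l \<le> q (x + t *\<^sub>R z) - t * c" for l x
    unfolding p_def by (rule cINF_greatest) (use that in auto)
  have add: "p (x + y) \<le> p x + p y" for x y
  proof -
    have 1: "p (x + y) - (q (y + t *\<^sub>R z) - t * c) \<le> p x" for t
    proof (rule lower)
      fix s
      have "p (x + y) \<le> q ((x + y) + (s + t) *\<^sub>R z) - (s + t) * c" by (rule upper)
      also have "(x + y) + (s + t) *\<^sub>R z = (x + s *\<^sub>R z) + (y + t *\<^sub>R z)" by (simp add: scaleR_add_left)
      also have "q \<dots> \<le> q (x + s *\<^sub>R z) + q (y + t *\<^sub>R z)" by (rule sub)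
      finally show "p (x + y) - (q (y + t *\<^sub>R z) - t * c) \<le> q (x + s *\<^sub>R z) - s * c"
        by (simp add: algebra_simps)
    qed
    have "p (x + y) - p x \<le> p y" by (rule lower) (use 1 in \<open>simp add: algebra_simps\<close>)
    then show ?thesis by simp
  qed
  have scale_le: "s * p x \<le> p (s *\<^sub>R x)" if s: "s > 0" for s x
  proof (rule lower)
    fix t
    have "p x \<le> q (x + (t / s) *\<^sub>R z) - (t / s) * c" by (rule upper)
    then have "s * p x \<le> s * (q (x + (t / s) *\<^sub>R z) - (t / s) * c)" using s by simp
    also have "\<dots> = q (s *\<^sub>R (x + (t / s) *\<^sub>R z)) - t * c"
      using s hom[of s "x + (t / s) *\<^sub>R z"] by (simp add: right_diff_distrib)
    also have "s *\<^sub>R (x + (t / s) *\<^sub>R z) = s *\<^sub>R x + t *\<^sub>R z" using s by (simp add: scaleR_add_right)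
    finally show "s * p x \<le> q (s *\<^sub>R x + t *\<^sub>R z) - t * c" .
  qed
  have "p 0 = 0"
    using upper[of 0 0] sublinear_zero[OF q] lower[of 0 0] c by force
  have "p (s *\<^sub>R x) = s * p x" if "s \<ge> 0" for s x
  proof (cases "s = 0")
    case False
    then have s: "s > 0" using that by simp
    have "(1 / s) * p (s *\<^sub>R x) \<le> p ((1 / s) *\<^sub>R (s *\<^sub>R x))" using s by (intro scale_le) simp
    then have "p (s *\<^sub>R x) \<le> s * p x" using s by (simp add: field_simps)
    then show ?thesis using scale_le[OF s, of x] by simp
  qed (simp add: \<open>p 0 = 0\<close>)
  then have "sublinear p" using add by (simp add: sublinear_def)
  then show thesis
  proof (rule that)
    show "p x \<le> q x" for x using upper[of x 0] by simp
    show "p z \<le> c" using upper[of z "- 1"] sublinear_zero[OF q] by simp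
    show "p (- z) \<le> - c" using upper[of "- z" 1] sublinear_zero[OF q] by simp
  qed (rule lower)
qed

text \<open>Making \<open>q\<close> linear along \<open>z\<close>, then along one basis vector after the other, ends with a
  linear functional: the directions along which a sublinear functional is odd form a subspace on
  which it is linear.\<close>

lemma dominated_functional:
  assumes q: "sublinear q"
  obtains u where "linear u" "\<And>x. u x \<le> q x" "u z = q z"
proof -
  have step: "\<exists>p. sublinear p \<and> (\<forall>x. p x \<le> q x) \<and> p z = q z \<and> p (- z) = - q z"
    if q: "sublinear q" for q and z :: 'a
  proof -
    have hom: "q (s *\<^sub>R x) = s * q x" if "s \<ge> 0" for s x using q that by (simp add: sublinear_def)
    have "t * q z \<le> q (t *\<^sub>R z)" for t
    proof (cases "t \<ge> 0")
      case False
      then have "q (t *\<^sub>R z) = - t * q (- z)" using hom[of "- t" "- z"] by simp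
      moreover have "0 \<le> - t * (q z + q (- z))"
        using False sublinear_neg[OF q, of z] by (intro mult_nonneg_nonneg) auto
      ultimately show ?thesis by (simp add: algebra_simps)
    qed (simp add: hom)
    then obtain p where p: "sublinear p" "\<And>x. p x \<le> q x" "p z \<le> q z" "p (- z) \<le> - q z"
      using sublinear_minorant[OF q, of "q z" z] by metis
    have "p z = q z" "p (- z) = - q z"
      using p(3,4) sublinear_neg[OF p(1), of z] by linarith+
    then show ?thesis using p(1,2) by blast
  qed
  have "\<exists>p. sublinear p \<and> (\<forall>x. p x \<le> q x) \<and> p z = q z \<and> (\<forall>b\<in>A. p (- b) = - p b)"
    if "finite A" for A
    using that
  proof (induction A rule: finite_induct)
    case empty
    then show ?case using q by blast
  next
    case (insert a A)
    then obtain p0 where p0: "sublinear p0" "\<forall>x. p0 x \<le> q x" "p0 z = q z" "\<forall>b\<in>A. p0 (- b) = - p0 b"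
      by blast
    obtain p1 where p1: "sublinear p1" "\<forall>x. p1 x \<le> p0 x" "p1 z = p0 z" "p1 (- z) = - p0 z"
      using step[OF p0(1), of z] by blast
    obtain p where p: "sublinear p" "\<forall>x. p x \<le> p1 x" "p a = p1 a" "p (- a) = - p1 a"
      using step[OF p1(1), of a] by blast
    have "p x \<le> q x" for x using p(2) p1(2) p0(2) by (meson order_trans)
    moreover have "p z = q z"
    proof (rule antisym)
      have "p (- z) \<le> - p0 z" using p(2) p1(4) by metis
      then show "q z \<le> p z" using sublinear_neg[OF p(1), of z] p0(3) by linarith
    qed fact
    moreover have "p (- b) = - p b" if "b \<in> A" for b
    proof (rule antisym)
      have "p b \<le> p0 b" "p (- b) \<le> p0 (- b)" using p(2) p1(2) by (meson order_trans)+
      then show "p (- b) \<le> - p b" using p0(4) that by force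
      show "- p b \<le> p (- b)" using sublinear_neg[OF p(1), of b] by linarith
    qed
    ultimately show ?case using p by (intro exI[of _ p]) auto
  qed
  from this[OF finite_basis] obtain p where p: "sublinear p" "\<And>x. p x \<le> q x" "p z = q z"
    "\<And>b. b \<in> B \<Longrightarrow> p (- b) = - p b" by blast
  have sub: "p (x + y) \<le> p x + p y" for x y using p(1) by (simp add: sublinear_def)
  have hom: "p (s *\<^sub>R x) = s * p x" if "s \<ge> 0" for s x using p(1) that by (simp add: sublinear_def)
  define D where "D = {x. p (- x) = - p x}"
  have D_add: "p (x + y) = p x + p y" if "x \<in> D" for x y
    using sub[of x y] sub[of "- x" "x + y"] that by (simp add: D_def)
  have "subspace D"
  proof (rule subspaceI)
    show "0 \<in> D" using sublinear_zero[OF p(1)] by (simp add: D_def)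
    fix x y assume x: "x \<in> D" and y: "y \<in> D"
    have "- x \<in> D" using x by (simp add: D_def)
    have "p (- (x + y)) = p (- x + - y)" by simp
    also have "\<dots> = - p x + - p y" using D_add[OF \<open>- x \<in> D\<close>, of "- y"] x y by (simp add: D_def)
    also have "\<dots> = - p (x + y)" using D_add[OF x, of y] by simp
    finally show "x + y \<in> D" by (simp add: D_def)
  next
    fix c x assume x: "x \<in> D"
    show "c *\<^sub>R x \<in> D"
    proof (cases "c \<ge> 0")
      case True
      then show ?thesis using x hom[of c x] hom[of c "- x"] by (simp add: D_def)
    next
      case False
      then show ?thesis using x hom[of "- c" x] hom[of "- c" "- x"] by (simp add: D_def)
    qed
  qed
  moreover have "B \<subseteq> D" using p(4) by (auto simp: D_def)
  ultimately have "D = UNIV" using span_basis span_minimal by blast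
  then have odd: "p (- x) = - p x" for x by (auto simp: D_def)
  have "linear p"
  proof (rule linearI)
    show "p (x + y) = p x + p y" for x y using D_add \<open>D = UNIV\<close> by blast
    show "p (c *\<^sub>R x) = c *\<^sub>R p x" for c x
    proof (cases "c \<ge> 0")
      case False
      then have "p (- (c *\<^sub>R x)) = - c * p x" using hom[of "- c" x] by simp
      then show ?thesis using odd[of "c *\<^sub>R x"] by simp
    qed (simp add: hom)
  qed
  then show thesis using that p by blast
qed

lemma norming_functional:
  obtains u where "linear u" "\<And>x. u x \<le> norm x" "u z = norm (z::'a)"
  using dominated_functional[OF sublinear_norm] by blast

lemma norming_functional_annihilating:
  assumes "\<And>t. norm z \<le> norm (z + t *\<^sub>R h)"
  obtains u where "linear u" "\<And>x. u x \<le> norm x" "u z = norm (z::'a)" "u h = 0"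
proof -
  obtain p where p: "sublinear p" "\<And>x. p x \<le> norm x" "p h \<le> 0" "p (- h) \<le> - 0"
    "\<And>x l. (\<And>t. l \<le> norm (x + t *\<^sub>R h) - t * 0) \<Longrightarrow> l \<le> p x"
    by (rule sublinear_minorant[OF sublinear_norm, of 0 h]) auto
  obtain u where u: "linear u" "\<And>x. u x \<le> p x" "u z = p z"
    using dominated_functional[OF p(1)] by blast
  have "p z = norm z" using p(2)[of z] p(5)[of "norm z" z] assms by (auto intro: antisym)
  moreover have "u h = 0"
    using u(2)[of h] u(2)[of "- h"] p(3,4) by (simp add: linear_neg[OF u(1)])
  moreover have "u x \<le> norm x" for x using u(2) p(2) by (meson order_trans)
  ultimately show thesis using that u by auto
qed

subsection \<open>Relatively interior points of faces\<close>

text \<open>The barycentre of a basis chosen inside the face: nearby vectors of the span of the face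
  are positive combinations of elements of the face, and there the norm is \<open>u\<close>.\<close>

lemma face_relative_interior:
  fixes u :: "'a \<Rightarrow>\<^sub>L real"
  assumes "norm u = 1" "face u \<noteq> {}"
  obtains p r where "p \<in> face u" "r > 0"
    "\<forall>x\<in>span (face u). norm (x - p) < r \<longrightarrow> norm x = u x"
proof -
  have u_le: "u x \<le> norm x" for x
    using norm_blinfun[of u x] assms(1) by simp
  have u0: "u 0 = 0" by (simp add: blinfun.zero_right)
  obtain A where A: "A \<subseteq> face u" "finite A" "independent A" "span A = span (face u)"
    using subspace_finite_basis[of "face u"] by blast
  have "A \<noteq> {}"
  proof
    assume "A = {}"
    then have "face u \<subseteq> {0}" using A(4) span_superset[of "face u"] by simp
    then show False using assms(2) by (auto simp: face_def u0)
  qed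
  define N where "N = real (card A)"
  have N: "N > 0" using \<open>A \<noteq> {}\<close> A(2) by (simp add: N_def card_gt_0_iff)
  obtain C where C: "C > 0" "\<And>c b. b \<in> A \<Longrightarrow> \<bar>c b\<bar> \<le> C * norm (\<Sum>b\<in>A. c b *\<^sub>R b)"
    by (rule independent_coefficients_bounded[OF A(2,3)]) blast
  define p where "p = (\<Sum>b\<in>A. (1 / N) *\<^sub>R b)"
  have positive: "norm (\<Sum>b\<in>A. c b *\<^sub>R b) = u (\<Sum>b\<in>A. c b *\<^sub>R b)"
    "u (\<Sum>b\<in>A. c b *\<^sub>R b) = sum c A" if "\<And>b. b \<in> A \<Longrightarrow> c b \<ge> 0" for c
  proof -
    show 1: "u (\<Sum>b\<in>A. c b *\<^sub>R b) = sum c A"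
      using A(1) by (auto simp: blinfun.sum_right blinfun.scaleR_right face_def intro!: sum.cong)
    have "norm (\<Sum>b\<in>A. c b *\<^sub>R b) \<le> sum c A"
      using that A(1) by (intro sum_norm_le) (auto simp: face_def mult_left_le)
    then show "norm (\<Sum>b\<in>A. c b *\<^sub>R b) = u (\<Sum>b\<in>A. c b *\<^sub>R b)"
      using u_le[of "\<Sum>b\<in>A. c b *\<^sub>R b"] 1 by linarith
  qed
  have "sum (\<lambda>b. 1 / N) A = 1" using N by (simp add: N_def)
  then have "p \<in> face u"
    using positive[of "\<lambda>b. 1 / N"] N by (simp add: p_def face_def)
  moreover have "1 / (N * C) > 0" using N C(1) by simp
  moreover have "norm x = u x" if x: "x \<in> span (face u)" "norm (x - p) < 1 / (N * C)" for x
  proof -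
    obtain c where c: "x = (\<Sum>b\<in>A. c b *\<^sub>R b)"
      using x(1) A(2) by (auto simp: A(4)[symmetric] span_finite)
    have "c b \<ge> 0" if b: "b \<in> A" for b
    proof -
      have "\<bar>c b - 1 / N\<bar> \<le> C * norm (\<Sum>b\<in>A. (c b - 1 / N) *\<^sub>R b)" by (rule C(2)[OF b])
      also have "(\<Sum>b\<in>A. (c b - 1 / N) *\<^sub>R b) = x - p"
        by (simp only: c p_def scaleR_diff_left sum_subtractf)
      also have "C * norm (x - p) \<le> C * (1 / (N * C))"
        using x(2) C(1) by (intro mult_left_mono) auto
      also have "\<dots> = 1 / N" using C(1) by simp
      finally show ?thesis by linarith
    qed
    then show ?thesis using positive(1)[of c] by (simp add: c)
  qed
  ultimately show thesis using that by blast
qed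

subsection \<open>Images of a facet under isometries\<close>

lemma facets_overlap:
  fixes u1 u2 :: "'a \<Rightarrow> real" and V :: "'a set"
  assumes V: "subspace V" and u: "linear u1" "linear u2" and p: "p1 \<in> V"
    and u1: "\<And>x. x \<in> V \<Longrightarrow> norm (x - p1) < r \<Longrightarrow> norm x = u1 x"
    and u2: "\<And>x. x \<in> V \<Longrightarrow> norm (x - p2) < r \<Longrightarrow> norm x = u2 x"
    and near: "norm (p1 - p2) < r" and x: "x \<in> V"
  shows "u1 x = u2 x"
proof -
  have r: "r > 0" using near norm_ge_zero[of "p1 - p2"] by linarith
  define d where "d = r - norm (p1 - p2)"
  define t where "t = (d / 2) / (norm x + 1)"
  have d: "d > 0" "d \<le> r" using near by (simp_all add: d_def)
  have nx: "norm x + 1 > 0" using norm_ge_zero[of x] by linarith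
  have t: "t > 0" using d nx by (simp add: t_def)
  have "t * norm x \<le> t * (norm x + 1)" using t by simp
  also have "\<dots> = d / 2" using nx iffD1[OF nonzero_eq_divide_eq t_def] by simp
  finally have tx: "t * norm x < d" using d by linarith
  have y: "p1 + t *\<^sub>R x \<in> V" using p x V by (intro subspace_add subspace_scale)
  have "norm ((p1 + t *\<^sub>R x) - p2) \<le> norm (p1 - p2) + norm (t *\<^sub>R x)"
    using norm_triangle_ineq[of "p1 - p2" "t *\<^sub>R x"] by (simp add: algebra_simps)
  then have "norm ((p1 + t *\<^sub>R x) - p2) < r" using tx t by (simp add: d_def)
  moreover have "norm ((p1 + t *\<^sub>R x) - p1) < r" using tx t d(2) by simp
  ultimately have "u1 (p1 + t *\<^sub>R x) = u2 (p1 + t *\<^sub>R x)" using u1[OF y] u2[OF y] by simp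
  moreover have "u1 p1 = u2 p1" using u1[OF p] u2[OF p] near r by simp
  ultimately show ?thesis
    using t by (simp add: linear_add[OF u(1)] linear_add[OF u(2)] linear_scale[OF u(1)] linear_scale[OF u(2)])
qed

text \<open>The norm agrees with the functional \<open>u\<close> of a facet on a ball of \<open>V\<close> around an interior point
  of the facet, and images of the facet under isometries have such balls of the same radius. By
  compactness their centres accumulate, and facets with overlapping balls coincide. Hence a sequence of isometries takes a facet to one and the same facet along a subsequence.\<close>

lemma facet_images_subsequence:
  fixes T :: "nat \<Rightarrow> 'a \<Rightarrow> 'a" and u :: "'a \<Rightarrow> real"
  assumes V: "subspace V" and u: "linear u" and p: "p \<in> V" and r: "r > 0"
    and facet: "\<And>x. x \<in> V \<Longrightarrow> norm (x - p) < r \<Longrightarrow> norm x = u x"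
    and T: "\<And>n. linear (T n)" "\<And>n x. norm (T n x) = norm x" "\<And>n x. T n (T n x) = x"
      "\<And>n x. x \<in> V \<Longrightarrow> T n x \<in> V"
  obtains s where "strict_mono (s :: nat \<Rightarrow> nat)"
    "\<And>m n x. x \<in> V \<Longrightarrow> u (T (s m) x) = u (T (s n) x)"
proof -
  have "norm (T n p) \<le> norm p" for n by (simp add: T(2))
  then obtain l s where s: "strict_mono s" "((\<lambda>n. T n p) \<circ> s) \<longlonglongrightarrow> l"
    using bounded_sequence_converges[of "\<lambda>n. T n p" "norm p"] by blast
  have "Cauchy ((\<lambda>n. T n p) \<circ> s)" using s(2) by (rule LIMSEQ_imp_Cauchy)
  then obtain N where N: "\<And>m n. m \<ge> N \<Longrightarrow> n \<ge> N \<Longrightarrow> norm (T (s m) p - T (s n) p) < r"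
    using r unfolding Cauchy_iff comp_def by meson
  have near: "norm x = u (T n x)" if "x \<in> V" "norm (x - T n p) < r" for x n
  proof -
    have "T n x - p = T n (x - T n p)" by (simp add: linear_diff[OF T(1)] T(3))
    then have "norm (T n x - p) < r" using that(2) by (simp add: T(2))
    then show ?thesis using facet[OF T(4)[OF that(1)]] by (simp add: T(2))
  qed
  have lin: "linear (\<lambda>x. u (T n x))" for n
    using linear_compose[OF T(1) u] by (simp add: comp_def)
  show thesis
  proof (rule that[of "\<lambda>n. s (n + N)"])
    show "strict_mono (\<lambda>n. s (n + N))" using s(1) by (auto simp: strict_mono_def)
    show "u (T (s (m + N)) x) = u (T (s (n + N)) x)" if "x \<in> V" for m n x
      by (rule facets_overlap[OF V lin lin T(4)[OF p] near near N that]) auto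
  qed
qed

end

section \<open>Orthogonality\<close>

lemma orth_commute: "orth f g \<longleftrightarrow> orth g f"
  by (auto simp: orth_def add.commute norm_minus_commute)

lemma orth_neg_right: "orth f (- g) \<longleftrightarrow> orth f g"
  by (auto simp: orth_def)

lemma orth_zero_left: "orth 0 g" and orth_zero_right: "orth g 0"
  by (simp_all add: orth_def)

lemma orth_self: "orth f f \<Longrightarrow> f = 0"
  by (simp add: orth_def)

text \<open>If the triangle inequality is an equality for \<open>f\<close> and \<open>g\<close>, it is one for all
  nonnegative multiples: write \<open>s f + t g = s (f + g) - (s - t) g\<close> when \<open>s \<ge> t\<close>.\<close>

lemma norm_add_scaled:
  fixes f g :: "'a::real_normed_vector"
  assumes "norm (f + g) = norm f + norm g" "s \<ge> 0" "t \<ge> 0"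
  shows "norm (s *\<^sub>R f + t *\<^sub>R g) = s * norm f + t * norm g"
proof -
  have *: "s * norm f + t * norm g \<le> norm (s *\<^sub>R f + t *\<^sub>R g)"
    if "norm (f + g) = norm f + norm g" "t \<ge> 0" "t \<le> s" for f g :: 'a and s t :: real
  proof -
    have "norm (s *\<^sub>R (f + g)) - norm ((s - t) *\<^sub>R g) \<le> norm (s *\<^sub>R (f + g) - (s - t) *\<^sub>R g)"
      by (rule norm_triangle_ineq2)
    also have "s *\<^sub>R (f + g) - (s - t) *\<^sub>R g = s *\<^sub>R f + t *\<^sub>R g" by (simp add: algebra_simps)
    finally have "norm (s *\<^sub>R (f + g)) - norm ((s - t) *\<^sub>R g) \<le> norm (s *\<^sub>R f + t *\<^sub>R g)" .
    moreover have "norm (s *\<^sub>R (f + g)) = s * (norm f + norm g)"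
      "norm ((s - t) *\<^sub>R g) = (s - t) * norm g" using that by simp_all
    ultimately show ?thesis by (simp add: algebra_simps)
  qed
  have "s * norm f + t * norm g \<le> norm (s *\<^sub>R f + t *\<^sub>R g)"
  proof (cases "t \<le> s")
    case True
    then show ?thesis using * assms by blast
  next
    case False
    then show ?thesis using *[of g f s t] assms by (simp add: add.commute)
  qed
  moreover have "norm (s *\<^sub>R f + t *\<^sub>R g) \<le> s * norm f + t * norm g"
    using norm_triangle_ineq[of "s *\<^sub>R f" "t *\<^sub>R g"] assms by simp
  ultimately show ?thesis by simp
qed

lemma orth_norm_add_scaled:
  assumes "orth f g"
  shows "norm (s *\<^sub>R f + t *\<^sub>R g) = \<bar>s\<bar> * norm f + \<bar>t\<bar> * norm g"
proof -
  have *: "norm (s *\<^sub>R f + t *\<^sub>R g) = \<bar>s\<bar> * norm f + \<bar>t\<bar> * norm g" if "s \<ge> 0" for s t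
  proof (cases "t \<ge> 0")
    case True
    then show ?thesis using norm_add_scaled[of f g s t] assms that by (simp add: orth_def)
  next
    case False
    then show ?thesis
      using norm_add_scaled[of f "- g" s "- t"] assms that by (simp add: orth_def)
  qed
  show ?thesis
  proof (cases "s \<ge> 0")
    case False
    have "norm (s *\<^sub>R f + t *\<^sub>R g) = norm ((- s) *\<^sub>R f + (- t) *\<^sub>R g)"
      by (metis norm_minus_cancel minus_add_distrib scaleR_minus_left)
    then show ?thesis using *[of "- s" "- t"] False by simp
  qed (rule *)
qed

lemma orth_norm_add: "orth f g \<Longrightarrow> norm (s *\<^sub>R f + g) = \<bar>s\<bar> * norm f + norm g"
  using orth_norm_add_scaled[of f g s 1] by simp

lemma orth_scale: "orth f g \<Longrightarrow> orth (s *\<^sub>R f) (t *\<^sub>R g)"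
  using orth_norm_add_scaled[of f g s t] orth_norm_add_scaled[of f g s "- t"]
  by (simp add: orth_def)

lemma orth_compl_singleton: "x \<in> orth_compl {e} \<longleftrightarrow> orth x e"
  by (simp add: orth_compl_def)

lemma orth_compl_insert: "orth_compl (insert a A) = orth_compl {a} \<inter> orth_compl A"
  by (auto simp: orth_compl_def)

lemma orth_compl_empty: "orth_compl {} = UNIV"
  by (simp add: orth_compl_def)

section \<open>Neutral projections\<close>

definition neutral_onto :: "('a::real_normed_vector \<Rightarrow> 'a) \<Rightarrow> 'a set \<Rightarrow> bool"
  where "neutral_onto Q V \<longleftrightarrow> neutral_projection Q \<and> range Q = V"

lemma neutral_ontoI:
  assumes "linear Q" "\<And>x. Q x \<in> V" "\<And>x. x \<in> V \<Longrightarrow> Q x = x" "\<And>x. norm (Q x) \<le> norm x"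
    "\<And>x. norm (Q x) = norm x \<Longrightarrow> x \<in> V"
  shows "neutral_onto Q V"
proof -
  have "V \<subseteq> range Q"
  proof
    fix x assume "x \<in> V"
    then have "x = Q x" using assms(3) by simp
    then show "x \<in> range Q" by (rule image_eqI) simp
  qed
  then have "range Q = V" using assms(2) by blast
  then show ?thesis
    using assms by (auto simp: neutral_onto_def neutral_projection_def contractive_projection_def fun_eq_iff)
qed

lemma neutral_ontoD:
  assumes "neutral_onto Q V"
  shows "linear Q" "Q x \<in> V" "x \<in> V \<Longrightarrow> Q x = x" "norm (Q x) \<le> norm x"
    "norm (Q x) = norm x \<Longrightarrow> Q x = x" "subspace V"
proof -
  have "Q (Q x) = Q x" for x
    using assms unfolding neutral_onto_def neutral_projection_def contractive_projection_def
    by (metis comp_apply)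
  then show "x \<in> V \<Longrightarrow> Q x = x" using assms by (auto simp: neutral_onto_def)
  show lin: "linear Q"
    using assms by (simp add: neutral_onto_def neutral_projection_def contractive_projection_def)
  show "subspace V"
    using linear_subspace_image[OF lin subspace_UNIV] assms by (simp add: neutral_onto_def)
qed (use assms in \<open>auto simp: neutral_onto_def neutral_projection_def contractive_projection_def\<close>)

lemma neutral_onto_compose:
  assumes P: "neutral_onto P V" and Q: "neutral_onto Q W" and PW: "\<And>x. x \<in> W \<Longrightarrow> P x \<in> W"
  shows "neutral_onto (P \<circ> Q) (V \<inter> W)"
proof (rule neutral_ontoI)
  note P' = neutral_ontoD[OF P] and Q' = neutral_ontoD[OF Q]
  show "linear (P \<circ> Q)" using P'(1) Q'(1) by (intro linear_compose)
  fix x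
  show "(P \<circ> Q) x \<in> V \<inter> W" using P'(2) PW Q'(2) by simp
  show "norm ((P \<circ> Q) x) \<le> norm x" using order_trans[OF P'(4) Q'(4)] by simp
  show "(P \<circ> Q) x = x" if "x \<in> V \<inter> W" using that P'(3) Q'(3) by simp
  assume eq: "norm ((P \<circ> Q) x) = norm x"
  then have "norm (Q x) = norm x" using P'(4)[of "Q x"] Q'(4)[of x] by simp
  then have Qx: "Q x = x" by (rule Q'(5))
  then have "P x = x" using eq P'(5) by simp
  then show "x \<in> V \<inter> W" using Qx P'(2)[of x] Q'(2)[of x] by simp
qed

section \<open>Exposed points and their Peirce decomposition\<close>

definition exposed :: "'a::real_normed_vector set"
  where "exposed = {e. \<exists>u :: 'a \<Rightarrow>\<^sub>L real. norm u = 1 \<and> face u = {e}}"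

definition symmetry :: "'a::real_normed_vector \<Rightarrow> 'a \<Rightarrow> 'a"
  where "symmetry e = face_symmetry {e}"

definition P0 :: "'a::real_normed_vector \<Rightarrow> 'a \<Rightarrow> 'a"
  where "P0 e = peirce_proj0 {e}"

text \<open>The projection \<open>P\<^sub>2\<close> of the face \<open>{e}\<close> has range \<open>\<real>e\<close>; \<open>phi e x\<close> is the
  coordinate of its value at \<open>x\<close>.\<close>

definition phi :: "'a::real_normed_vector \<Rightarrow> 'a \<Rightarrow> real"
  where "phi e x = (THE c. c *\<^sub>R e = peirce_proj2 {e} x)"

locale neutral_sfs_JP = finite_dimensional_normed B for B :: "'a::real_normed_vector set" +
  assumes neutral: "neutral_space TYPE('a)"
    and SFS: "strongly_facially_symmetric TYPE('a)"
    and JP: "property_JP TYPE('a)"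
begin

lemma face_symmetry:
  assumes "norm_exposed_face (F :: 'a set)"
  shows "is_face_symmetry F (face_symmetry F)"
proof -
  obtain T where "is_face_symmetry F T"
    using SFS assms
    by (auto simp: strongly_facially_symmetric_def weakly_facially_symmetric_def symmetric_face_def)
  then show ?thesis by (simp add: face_symmetry_eq)
qed

lemma face_symmetry_props:
  assumes "norm_exposed_face (F :: 'a set)"
  shows "linear (face_symmetry F)" "norm (face_symmetry F x) = norm x"
    "face_symmetry F (face_symmetry F x) = x" "subspace (orth_compl F)"
    "span F \<inter> orth_compl F = {0}"
    "face_symmetry F x = x \<longleftrightarrow> (\<exists>a\<in>span F. \<exists>b\<in>orth_compl F. x = a + b)"
proof -
  note S = face_symmetry[OF assms, unfolded is_face_symmetry_def closure_span]
  note S1 = S[THEN conjunct1] and S2 = S[THEN conjunct2]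
  show "linear (face_symmetry F)" using S1 by (rule conjunct1)
  show "norm (face_symmetry F x) = norm x" using S1 by simp
  show "face_symmetry F (face_symmetry F x) = x" using S1 by (simp add: pointfree_idE)
  show "subspace (orth_compl F)" using S2 by (rule conjunct1)
  show "span F \<inter> orth_compl F = {0}" using S2 by (elim conjE)
  have eq: "{f. face_symmetry F f = f} = {a + b |a b. a \<in> span F \<and> b \<in> orth_compl F}"
    using S2 by (elim conjE)
  have "face_symmetry F x = x \<longleftrightarrow> x \<in> {f. face_symmetry F f = f}" by simp
  also have "\<dots> \<longleftrightarrow> (\<exists>a\<in>span F. \<exists>b\<in>orth_compl F. x = a + b)" unfolding eq by blast
  finally show "face_symmetry F x = x \<longleftrightarrow> (\<exists>a\<in>span F. \<exists>b\<in>orth_compl F. x = a + b)" .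
qed

lemma face_peirce_unique:
  assumes F: "norm_exposed_face (F :: 'a set)"
    and "a \<in> span F" "b \<in> orth_compl F" "(1 / 2) *\<^sub>R (x + face_symmetry F x) = a + b"
  shows "peirce_proj2 F x = a" "peirce_proj0 F x = b"
proof -
  note S = face_symmetry_props[OF F]
  have uniq: "a = a' \<and> b = b'"
    if "a' \<in> span F" "b' \<in> orth_compl F" "(1 / 2) *\<^sub>R (x + face_symmetry F x) = a' + b'" for a' b'
  proof -
    have "a - a' = b' - b" using that(3) assms(4) by (simp add: algebra_simps)
    moreover have "a - a' \<in> span F" using assms(2) that(1) by (rule span_diff)
    moreover have "b' - b \<in> orth_compl F" using that(2) assms(3) by (rule subspace_diff[OF S(4)])
    ultimately have "a - a' \<in> span F \<inter> orth_compl F" by simp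
    then have "a - a' = 0" unfolding S(5) by simp
    then show ?thesis using \<open>a - a' = b' - b\<close> by simp
  qed
  show "peirce_proj2 F x = a"
    unfolding peirce_proj2_def closure_span
  proof (rule the_equality)
    show "a \<in> span F \<and> (1 / 2) *\<^sub>R (x + face_symmetry F x) - a \<in> orth_compl F" using assms by simp
    show "a' = a" if "a' \<in> span F \<and> (1 / 2) *\<^sub>R (x + face_symmetry F x) - a' \<in> orth_compl F" for a'
      using uniq[of a' "(1 / 2) *\<^sub>R (x + face_symmetry F x) - a'"] that by simp
  qed
  show "peirce_proj0 F x = b"
    unfolding peirce_proj0_def closure_span
  proof (rule the_equality)
    show "b \<in> orth_compl F \<and> (1 / 2) *\<^sub>R (x + face_symmetry F x) - b \<in> span F" using assms by simp
    show "b' = b" if "b' \<in> orth_compl F \<and> (1 / 2) *\<^sub>R (x + face_symmetry F x) - b' \<in> span F" for b'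
      using uniq[of "(1 / 2) *\<^sub>R (x + face_symmetry F x) - b'" b'] that by simp
  qed
qed

lemma face_peirce:
  assumes F: "norm_exposed_face (F :: 'a set)"
  shows "peirce_proj2 F x \<in> span F" "peirce_proj0 F x \<in> orth_compl F"
    "(1 / 2) *\<^sub>R (x + face_symmetry F x) = peirce_proj2 F x + peirce_proj0 F x"
proof -
  note S = face_symmetry_props[OF F]
  let ?y = "(1 / 2) *\<^sub>R (x + face_symmetry F x)"
  have "face_symmetry F ?y = ?y"
    by (simp add: linear_scale[OF S(1)] linear_add[OF S(1)] S(3) add.commute)
  then obtain a b where ab: "a \<in> span F" "b \<in> orth_compl F" "?y = a + b" using S(6) by blast
  with face_peirce_unique[OF F ab]
  show "peirce_proj2 F x \<in> span F" "peirce_proj0 F x \<in> orth_compl F"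
    "?y = peirce_proj2 F x + peirce_proj0 F x" by auto
qed

lemma neutral_onto_span_face:
  assumes F: "norm_exposed_face (F :: 'a set)"
  shows "neutral_onto (peirce_proj2 F) (span F)"
proof -
  have "symmetric_face F" using F face_symmetry[OF F] by (auto simp: symmetric_face_def)
  then have "neutral_projection (peirce_proj2 F)" using neutral by (simp add: neutral_space_def)
  moreover have "range (peirce_proj2 F) = span F"
  proof
    show "range (peirce_proj2 F) \<subseteq> span F" using face_peirce(1)[OF F] by blast
    show "span F \<subseteq> range (peirce_proj2 F)"
    proof
      fix a assume a: "a \<in> span F"
      have 0: "0 \<in> orth_compl F" by (rule subspace_0[OF face_symmetry_props(4)[OF F]])
      then have "face_symmetry F a = a"
        using face_symmetry_props(6)[OF F, of a] a by (metis add.right_neutral)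
      then have "(1 / 2) *\<^sub>R (a + face_symmetry F a) = a + 0" by (simp flip: scaleR_2)
      then show "a \<in> range (peirce_proj2 F)" using face_peirce_unique(1)[OF F a 0] by (metis rangeI)
    qed
  qed
  ultimately show ?thesis by (simp add: neutral_onto_def)
qed

lemma face_symmetry_invariant:
  assumes F: "norm_exposed_face (F :: 'a set)" and y: "linear y" "\<And>x. y x \<le> norm x"
    and 1: "\<And>x. x \<in> F \<Longrightarrow> y x = 1"
  shows "y (face_symmetry F x) = y x"
proof -
  obtain z where z: "z \<in> F" using F by (auto simp: norm_exposed_face_def)
  have F1: "norm x \<le> 1" if "x \<in> F" for x using F that by (auto simp: norm_exposed_face_def face_def)
  obtain Y :: "'a \<Rightarrow>\<^sub>L real" where Y: "norm Y = 1" "\<And>x. Y x = y x"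
    using functional_blinfun[OF y F1[OF z] 1[OF z]] by blast
  have "F \<subseteq> face Y" using 1 F1 by (auto simp: face_def Y(2))
  then have "Y (face_symmetry F x) = Y x"
    using SFS F Y(1) unfolding strongly_facially_symmetric_def by blast
  then show ?thesis by (simp add: Y(2))
qed

subsection \<open>The decomposition at an exposed point\<close>

lemma exposed_norm: "e \<in> exposed \<Longrightarrow> norm e = 1" for e :: 'a
proof -
  assume "e \<in> exposed"
  then obtain u :: "'a \<Rightarrow>\<^sub>L real" where u: "norm u = 1" "face u = {e}" by (auto simp: exposed_def)
  then have "norm e \<le> 1" "u e = 1" by (auto simp: face_def)
  then show ?thesis using norm_blinfun[of u e] u(1) by simp
qed

lemma exposed_nonzero: "e \<in> exposed \<Longrightarrow> e \<noteq> 0" for e :: 'a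
  using exposed_norm by force

lemma exposed_face: "e \<in> exposed \<Longrightarrow> norm_exposed_face {e}" for e :: 'a
  unfolding norm_exposed_face_def exposed_def by force

lemma sym_linear: "e \<in> exposed \<Longrightarrow> linear (symmetry (e::'a))"
  and sym_norm: "e \<in> exposed \<Longrightarrow> norm (symmetry e x) = norm x"
  and sym_sym: "e \<in> exposed \<Longrightarrow> symmetry e (symmetry e x) = x"
  unfolding symmetry_def using face_symmetry_props exposed_face by blast+

lemma subspace_orth: "e \<in> exposed \<Longrightarrow> subspace {x. orth x (e::'a)}"
  using face_symmetry_props(4)[OF exposed_face] by (simp add: orth_compl_def)

lemma sym_fixed_iff: "e \<in> exposed \<Longrightarrow> symmetry e x = x \<longleftrightarrow> (\<exists>c b. orth b (e::'a) \<and> x = c *\<^sub>R e + b)"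
proof -
  assume e: "e \<in> exposed"
  have "symmetry e x = x \<longleftrightarrow> (\<exists>a\<in>span {e}. \<exists>b\<in>orth_compl {e}. x = a + b)"
    unfolding symmetry_def by (rule face_symmetry_props(6)[OF exposed_face[OF e]])
  also have "\<dots> \<longleftrightarrow> (\<exists>c b. orth b e \<and> x = c *\<^sub>R e + b)"
    unfolding span_singleton Bex_def orth_compl_singleton by blast
  finally show ?thesis .
qed

lemma sym_orth: "e \<in> exposed \<Longrightarrow> orth b e \<Longrightarrow> symmetry e b = (b::'a)"
  by (subst sym_fixed_iff) (auto intro!: exI[of _ "0::real"])

lemma sym_self: "e \<in> exposed \<Longrightarrow> symmetry e e = (e::'a)"
  by (subst sym_fixed_iff) (auto intro!: exI[of _ "1::real"] exI[of _ "0::'a"] simp: orth_zero_left)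

lemma proj2_phi:
  assumes "e \<in> exposed"
  shows "peirce_proj2 {e} x = phi (e::'a) x *\<^sub>R e"
proof -
  have "peirce_proj2 {e} x \<in> span {e}" by (rule face_peirce(1)[OF exposed_face[OF assms]])
  then obtain c where c: "c *\<^sub>R e = peirce_proj2 {e} x" unfolding span_singleton by (metis rangeE)
  then have "phi e x = c"
    unfolding phi_def using exposed_nonzero[OF assms] by (intro the_equality) (auto simp flip: c)
  then show ?thesis using c by simp
qed

lemma peirce_eq: "e \<in> exposed \<Longrightarrow> (1 / 2) *\<^sub>R (x + symmetry e x) = phi e x *\<^sub>R e + P0 e (x::'a)"
  using face_peirce(3)[OF exposed_face, of e x] by (simp add: symmetry_def proj2_phi P0_def)

lemma P0_orth: "e \<in> exposed \<Longrightarrow> orth (P0 e x) (e::'a)"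
  using face_peirce(2)[OF exposed_face, of e x] by (simp add: P0_def orth_compl_singleton)

lemma sym_eq:
  assumes "e \<in> exposed"
  shows "symmetry e x = 2 *\<^sub>R (phi e x *\<^sub>R e + P0 e x) - (x::'a)"
  using peirce_eq[OF assms, of x, symmetric] by simp

lemma peirce_unique:
  assumes e: "e \<in> exposed" and "orth b e" "(1 / 2) *\<^sub>R (x + symmetry e x) = c *\<^sub>R e + (b::'a)"
  shows "phi e x = c" "P0 e x = b"
proof -
  have "c *\<^sub>R e \<in> span {e}" by (simp add: span_base span_scale)
  note u = face_peirce_unique[OF exposed_face[OF e] this, of b x]
  show "P0 e x = b" using u(2) assms by (simp add: P0_def symmetry_def orth_compl_singleton)
  have "phi e x *\<^sub>R e = c *\<^sub>R e" using u(1) assms by (simp add: proj2_phi symmetry_def orth_compl_singleton)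
  then show "phi e x = c" using exposed_nonzero[OF e] by simp
qed

lemma phi_orth: "e \<in> exposed \<Longrightarrow> orth b e \<Longrightarrow> phi e b = 0"
  and P0_of_orth: "e \<in> exposed \<Longrightarrow> orth b e \<Longrightarrow> P0 e b = (b::'a)"
  using peirce_unique[of e b b 0] by (simp_all add: sym_orth flip: scaleR_2)

lemma phi_self: "e \<in> exposed \<Longrightarrow> phi e e = 1"
  and P0_self: "e \<in> exposed \<Longrightarrow> P0 e e = (0::'a)"
  using peirce_unique[of e 0 e 1] by (simp_all add: sym_self orth_zero_left flip: scaleR_2)

lemma phi_linear: "linear (phi (e::'a))" and P0_linear: "linear (P0 e)" if e: "e \<in> exposed"
proof -
  note V = subspace_orth[OF e] and S = sym_linear[OF e]
  have "phi e (x + y) = phi e x + phi e y \<and> P0 e (x + y) = P0 e x + P0 e y" for x y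
  proof -
    have "(1 / 2) *\<^sub>R ((x + y) + symmetry e (x + y))
      = (1 / 2) *\<^sub>R (x + symmetry e x) + (1 / 2) *\<^sub>R (y + symmetry e y)"
      by (simp add: linear_add[OF S] algebra_simps)
    also have "\<dots> = (phi e x + phi e y) *\<^sub>R e + (P0 e x + P0 e y)"
      unfolding peirce_eq[OF e] by (simp add: algebra_simps)
    finally have eq: "(1 / 2) *\<^sub>R ((x + y) + symmetry e (x + y))
      = (phi e x + phi e y) *\<^sub>R e + (P0 e x + P0 e y)" .
    have "orth (P0 e x + P0 e y) e"
      using subspace_add[OF V, of "P0 e x" "P0 e y"] P0_orth[OF e] by simp
    from peirce_unique[OF e this eq] show ?thesis ..
  qed
  moreover have "phi e (c *\<^sub>R x) = c * phi e x \<and> P0 e (c *\<^sub>R x) = c *\<^sub>R P0 e x" for c x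
  proof -
    have "(1 / 2) *\<^sub>R (c *\<^sub>R x + symmetry e (c *\<^sub>R x)) = c *\<^sub>R ((1 / 2) *\<^sub>R (x + symmetry e x))"
      by (simp add: linear_scale[OF S] algebra_simps)
    also have "\<dots> = (c * phi e x) *\<^sub>R e + c *\<^sub>R P0 e x"
      unfolding peirce_eq[OF e] by (simp add: algebra_simps)
    finally have eq: "(1 / 2) *\<^sub>R (c *\<^sub>R x + symmetry e (c *\<^sub>R x))
      = (c * phi e x) *\<^sub>R e + c *\<^sub>R P0 e x" .
    have "orth (c *\<^sub>R P0 e x) e" using subspace_scale[OF V, of "P0 e x" c] P0_orth[OF e] by simp
    from peirce_unique[OF e this eq] show ?thesis ..
  qed
  ultimately show "linear (phi e)" "linear (P0 e)" by (auto intro!: linearI)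
qed

lemma phi_P0_bound:
  assumes e: "e \<in> exposed"
  shows "\<bar>phi e x\<bar> + norm (P0 e x) \<le> norm (x::'a)"
proof -
  have "\<bar>phi e x\<bar> + norm (P0 e x) = norm (phi e x *\<^sub>R e + P0 e x)"
    using orth_norm_add[of e "P0 e x" "phi e x"] P0_orth[OF e] exposed_norm[OF e]
    by (simp add: orth_commute)
  also have "\<dots> = norm ((1 / 2) *\<^sub>R (x + symmetry e x))" by (simp add: peirce_eq[OF e])
  also have "\<dots> \<le> norm x"
    using norm_triangle_ineq[of x "symmetry e x"] by (simp add: sym_norm[OF e])
  finally show ?thesis .
qed

lemma abs_phi_le: "e \<in> exposed \<Longrightarrow> \<bar>phi e x\<bar> \<le> norm (x::'a)"
  and phi_le: "e \<in> exposed \<Longrightarrow> phi e x \<le> norm x"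
  and norm_P0_le: "e \<in> exposed \<Longrightarrow> norm (P0 e x) \<le> norm x"
  using phi_P0_bound[of e x] norm_ge_zero[of "P0 e x"] by linarith+

lemma phi_neutral:
  assumes e: "e \<in> exposed" and "\<bar>phi e x\<bar> = norm (x::'a)"
  shows "x = phi e x *\<^sub>R e"
  using neutral_ontoD(5)[OF neutral_onto_span_face[OF exposed_face[OF e]], of x] assms
  by (simp add: proj2_phi exposed_norm)

lemma phi_exposes:
  assumes e: "e \<in> exposed" and "norm x \<le> 1" "phi e x = 1"
  shows "x = (e::'a)"
  using phi_neutral[OF e, of x] abs_phi_le[OF e, of x] assms by simp

text \<open>If \<open>P\<^sub>0\<close> preserves the norm of \<open>x\<close>, then \<open>\<phi> x = 0\<close>, and the norm of
  \<open>e \<plusminus> x\<close> is already attained by its components along \<open>e\<close> and in the complement of \<open>e\<close>.\<close>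

lemma P0_neutral:
  assumes e: "e \<in> exposed" and eq: "norm (P0 e x) = norm (x::'a)"
  shows "orth x e"
proof -
  have 0: "phi e x = 0" using phi_P0_bound[OF e, of x] eq by simp
  have "1 + norm x \<le> norm (s *\<^sub>R e + x)" if "\<bar>s\<bar> = 1" for s
    using phi_P0_bound[OF e, of "s *\<^sub>R e + x"] that eq 0
    by (simp add: linear_add[OF phi_linear[OF e]] linear_scale[OF phi_linear[OF e]]
        linear_add[OF P0_linear[OF e]] linear_scale[OF P0_linear[OF e]] phi_self[OF e] P0_self[OF e])
  from this[of 1] this[of "- 1"] show ?thesis
    using norm_triangle_ineq[of x e] norm_triangle_ineq4[of x e]
    by (simp add: orth_def exposed_norm[OF e] algebra_simps)
qed

lemma neutral_onto_orth:
  assumes e: "e \<in> exposed"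
  shows "neutral_onto (P0 e) (orth_compl {e::'a})"
  by (rule neutral_ontoI)
    (use e P0_linear P0_orth P0_of_orth norm_P0_le P0_neutral in \<open>auto simp: orth_compl_singleton\<close>)

lemma sym_invariant:
  assumes "e \<in> exposed" "linear y" "\<And>x. y x \<le> norm x" "y (e::'a) = 1"
  shows "y (symmetry e x) = y x"
  unfolding symmetry_def using assms by (intro face_symmetry_invariant exposed_face) auto

lemma phi_sym: "e \<in> exposed \<Longrightarrow> phi e (symmetry e x) = phi e (x::'a)"
  by (rule sym_invariant[OF _ phi_linear]) (auto simp: phi_le phi_self)

text \<open>Conjugating the symmetry at \<open>f\<close> by an isometry that fixes \<open>f\<close> gives a symmetry of the
  same face, so the two commute.\<close>

lemma isometry_fixing_commutes:
  assumes f: "f \<in> exposed" and T: "linear T" "\<And>x. norm (T x) = norm x" "\<And>x. T (T x) = x"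
    and Tf: "T f = (f::'a)"
  shows "T (symmetry f x) = symmetry f (T x)" "phi f (T x) = phi f x" "orth x f \<Longrightarrow> orth (T x) f"
proof -
  note S = sym_linear[OF f] and F = face_symmetry_props[OF exposed_face[OF f]]
  have T_orth: "orth (T b) f" if "orth b f" for b
  proof -
    have "T (b + f) = T b + f" "T (b - f) = T b - f"
      by (simp_all add: linear_add[OF T(1)] linear_diff[OF T(1)] Tf)
    then have "norm (T b + f) = norm (b + f)" "norm (T b - f) = norm (b - f)"
      using T(2)[of "b + f"] T(2)[of "b - f"] by simp_all
    then show ?thesis using that by (simp add: orth_def T(2))
  qed
  then show "orth x f \<Longrightarrow> orth (T x) f" .
  have fixed: "symmetry f (T x) = T x" if fx: "symmetry f x = x" for x
  proof -
    obtain c b where "orth b f" "x = c *\<^sub>R f + b"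
      using iffD1[OF sym_fixed_iff[OF f] fx] by (elim exE conjE)
    then have "orth (T b) f \<and> T x = c *\<^sub>R f + T b"
      using T_orth[of b] by (simp add: linear_add[OF T(1)] linear_scale[OF T(1)] Tf)
    then show ?thesis using sym_fixed_iff[OF f, of "T x"] by blast
  qed
  have conj_fixed: "T (symmetry f (T x)) = x \<longleftrightarrow> symmetry f x = x" for x
  proof
    assume "T (symmetry f (T x)) = x"
    then have "symmetry f (T x) = T x" using T(3)[of "symmetry f (T x)"] by simp
    from fixed[OF this] show "symmetry f x = x" by (simp add: T(3))
  qed (simp add: fixed T(3))
  have "is_face_symmetry {f} (T \<circ> symmetry f \<circ> T)"
    unfolding is_face_symmetry_def closure_span
  proof (intro conjI)
    show "linear (T \<circ> symmetry f \<circ> T)" by (intro linear_compose T S)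
    show "\<forall>x. norm ((T \<circ> symmetry f \<circ> T) x) = norm x" by (simp add: T sym_norm[OF f])
    show inv: "(T \<circ> symmetry f \<circ> T) \<circ> (T \<circ> symmetry f \<circ> T) = id" by (simp add: fun_eq_iff T sym_sym[OF f])
    show "surj (T \<circ> symmetry f \<circ> T)" using bij_is_surj[OF o_bij[OF inv inv]] .
    show "subspace (orth_compl {f})" "span {f} \<inter> orth_compl {f} = {0}" using F by auto
    have "(T \<circ> symmetry f \<circ> T) x = x \<longleftrightarrow> (\<exists>a\<in>span {f}. \<exists>b\<in>orth_compl {f}. x = a + b)" for x
      unfolding comp_def conj_fixed using F(6)[of x] unfolding symmetry_def .
    then have "{x. (T \<circ> symmetry f \<circ> T) x = x} = {x. \<exists>a\<in>span {f}. \<exists>b\<in>orth_compl {f}. x = a + b}"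
      by (simp only:)
    also have "\<dots> = {a + b |a b. a \<in> span {f} \<and> b \<in> orth_compl {f}}" by blast
    finally show "{x. (T \<circ> symmetry f \<circ> T) x = x}
      = {a + b |a b. a \<in> span {f} \<and> b \<in> orth_compl {f}}" .
  qed
  from face_symmetry_eq[OF this] have eq: "T \<circ> symmetry f \<circ> T = symmetry f"
    unfolding symmetry_def by (rule HOL.sym)
  show comm: "T (symmetry f x) = symmetry f (T x)" using fun_cong[OF eq, of "T x"] T(3) by simp
  have "(1 / 2) *\<^sub>R (T x + symmetry f (T x)) = T ((1 / 2) *\<^sub>R (x + symmetry f x))"
    by (simp add: linear_add[OF T(1)] linear_scale[OF T(1)] comm)
  also have "\<dots> = phi f x *\<^sub>R f + T (P0 f x)"
    by (simp only: peirce_eq[OF f]) (simp add: linear_add[OF T(1)] linear_scale[OF T(1)] Tf)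
  finally show "phi f (T x) = phi f x"
    by (rule peirce_unique(1)[OF f T_orth[OF P0_orth[OF f]]])
qed

lemma orth_sym_commute:
  assumes "e \<in> exposed" "f \<in> exposed" "orth (e::'a) f"
  shows "symmetry e (symmetry f x) = symmetry f (symmetry e x)" "phi f (symmetry e x) = phi f x"
    "orth x f \<Longrightarrow> orth (symmetry e x) f"
  using isometry_fixing_commutes[of f "symmetry e" x] sym_orth[of e f] assms sym_linear sym_norm sym_sym
  by (auto simp: orth_commute)

lemma phi_P0:
  assumes e: "e \<in> exposed" and f: "f \<in> exposed" and "orth (e::'a) f"
  shows "phi f (P0 e x) = phi f x"
proof -
  note L = phi_linear[OF f]
  have "P0 e x = (1 / 2) *\<^sub>R (x + symmetry e x) - phi e x *\<^sub>R e" by (simp add: peirce_eq[OF e])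
  then show ?thesis
    using orth_sym_commute(2)[OF assms] phi_orth[OF f \<open>orth e f\<close>]
    by (simp add: linear_diff[OF L] linear_add[OF L] linear_scale[OF L])
qed

lemma P0_preserves_orth:
  assumes e: "e \<in> exposed" and f: "f \<in> exposed" and "orth (e::'a) f" "orth x f"
  shows "orth (P0 e x) f"
proof -
  have "P0 e x = (1 / 2) *\<^sub>R (x + symmetry e x) - phi e x *\<^sub>R e" by (simp add: peirce_eq[OF e])
  moreover have "(1 / 2) *\<^sub>R (x + symmetry e x) - phi e x *\<^sub>R e \<in> {x. orth x f}"
    using orth_sym_commute(3)[OF e f] assms
    by (intro subspace_diff subspace_scale subspace_add subspace_orth) auto
  ultimately show ?thesis by simp
qed

lemma exposed_uminus:
  assumes e: "e \<in> exposed"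
  shows "- e \<in> exposed" "symmetry (- e) = symmetry (e::'a)" "phi (- e) x = - phi e x"
proof -
  obtain u :: "'a \<Rightarrow>\<^sub>L real" where u: "norm u = 1" "face u = {e}" using e by (auto simp: exposed_def)
  have "face (- u) = uminus ` face u"
  proof (intro equalityI subsetI)
    fix x assume "x \<in> face (- u)"
    then have "- x \<in> face u" by (simp add: face_def blinfun.minus_left blinfun.minus_right)
    then show "x \<in> uminus ` face u" by (metis image_eqI minus_minus)
  qed (auto simp: face_def blinfun.minus_left blinfun.minus_right)
  then show ne: "- e \<in> exposed" using u by (auto simp: exposed_def intro!: exI[of _ "- u"])
  have sp: "span {- e} = span {e}"
  proof (intro antisym span_minimal subspace_span)
    show "{- e} \<subseteq> span {e}" by (simp add: span_neg span_base)
    show "{e} \<subseteq> span {- e}" using span_neg[OF span_base[of "- e" "{- e}"]] by simp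
  qed
  have oc: "orth_compl {- e} = orth_compl {e}" by (auto simp: orth_compl_def orth_neg_right)
  have "is_face_symmetry {- e} (symmetry e)"
    using face_symmetry[OF exposed_face[OF e]]
    unfolding is_face_symmetry_def symmetry_def closure_span sp oc .
  then show s: "symmetry (- e) = symmetry e" unfolding symmetry_def[of "- e"] by (rule face_symmetry_eq)
  show "phi (- e) x = - phi e x"
    by (rule peirce_unique(1)[OF ne, of "P0 e x"])
      (use P0_orth[OF e, of x] peirce_eq[OF e, of x] in \<open>simp_all add: s orth_neg_right\<close>)
qed

subsection \<open>Enough exposed points\<close>

text \<open>Composing with a neutral projection \<open>Q\<close> turns a functional exposing \<open>f\<close> in the range
  into one exposing \<open>f\<close> in the whole space: where the composition attains its norm, \<open>Q\<close>
  preserves the norm.\<close>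

lemma exposed_norming:
  assumes Q: "neutral_onto Q V" and y: "linear y" and x0: "x0 \<in> V" "norm x0 \<le> 1" "c < y x0"
    and c: "0 \<le> c"
  obtains f where "f \<in> exposed" "f \<in> (V::'a set)" "c < (y f :: real)"
proof -
  note Q' = neutral_ontoD[OF Q]
  obtain f and l :: "'a \<Rightarrow> real" where f: "f \<in> V" "norm f \<le> 1" "c < y f" "linear l"
    "\<And>x. x \<in> V \<Longrightarrow> norm x \<le> 1 \<Longrightarrow> x \<noteq> f \<Longrightarrow> l x < l f"
    using strictly_exposed_point[OF Q'(6) y x0] by blast
  have f0: "f \<noteq> 0" using f(3) c linear_0[OF y] by auto
  have lf: "l f > 0" using f(5)[of 0] f0 subspace_0[OF Q'(6)] linear_0[OF f(4)] by simp
  have nf: "norm f = 1"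
  proof (rule ccontr)
    assume n: "norm f \<noteq> 1"
    define a where "a = 1 / norm f"
    have a: "a > 1" "a * norm f = 1" using n f(2) f0 by (simp_all add: a_def field_simps)
    have "a *\<^sub>R f \<noteq> f" using a(1) f0 by (metis less_irrefl scaleR_cancel_right scaleR_one)
    then have "l (a *\<^sub>R f) < l f"
      using a f(1) by (intro f(5) subspace_scale[OF Q'(6)]) auto
    then show False using a(1) lf by (simp add: linear_scale[OF f(4)])
  qed
  have l_le: "l x \<le> l f" if "x \<in> V" "norm x \<le> 1" for x using f(5)[OF that] by (cases "x = f") auto
  define u where "u x = l (Q x) / l f" for x
  have u: "linear u"
    by (rule linearI) (simp_all add: u_def linear_add[OF Q'(1)] linear_scale[OF Q'(1)]
        linear_add[OF f(4)] linear_scale[OF f(4)] add_divide_distrib)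
  have u_le: "u x \<le> norm x" for x
  proof (cases "x = 0")
    case False
    have "l (Q ((1 / norm x) *\<^sub>R x)) \<le> l f"
      using Q'(4)[of "(1 / norm x) *\<^sub>R x"] False by (intro l_le Q'(2)) simp
    then have "l (Q x) / norm x \<le> l f" by (simp add: linear_scale[OF Q'(1)] linear_scale[OF f(4)])
    then show ?thesis using False lf by (simp add: u_def field_simps)
  qed (simp add: linear_0[OF u])
  have uf: "u f = 1" using lf by (simp add: u_def Q'(3)[OF f(1)])
  obtain U :: "'a \<Rightarrow>\<^sub>L real" where U: "norm U = 1" "\<And>x. U x = u x"
    using functional_blinfun[OF u u_le f(2) uf] by blast
  have unique: "x = f" if "norm x \<le> 1" "u x = 1" for x
  proof -
    have "l (Q x) = l f" using that(2) lf by (simp add: u_def)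
    then have "Q x = f" using f(5)[of "Q x"] Q'(2) Q'(4)[of x] that(1) by force
    then have "Q x = x" using Q'(5)[of x] Q'(4)[of x] nf that(1) by simp
    then show ?thesis using \<open>Q x = f\<close> by simp
  qed
  have "face U = {f}" using uf f(2) unique unfolding face_def U(2) by blast
  then have "f \<in> exposed" using U(1) by (auto simp: exposed_def)
  then show thesis using that f by blast
qed

lemma exposed_in_range:
  assumes Q: "neutral_onto Q (V::'a set)" and V: "V \<noteq> {0}"
  obtains f where "f \<in> exposed" "f \<in> V"
proof -
  have "subspace V" by (rule neutral_ontoD(6)[OF Q])
  then have "0 \<in> V" by (rule subspace_0)
  with V obtain x where x: "x \<in> V" "x \<noteq> 0" by blast
  obtain u where u: "linear u" "\<And>x. u x \<le> norm x" "u x = norm x"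
    using norming_functional[of x] by blast
  have "(1 / norm x) *\<^sub>R x \<in> V" using x(1) \<open>subspace V\<close> by (simp add: subspace_scale)
  moreover have "0 < u ((1 / norm x) *\<^sub>R x)" using x(2) u(3) by (simp add: linear_scale[OF u(1)])
  ultimately obtain f where "f \<in> exposed" "f \<in> V"
    using exposed_norming[OF Q u(1), of "(1 / norm x) *\<^sub>R x" 0] x(2) by auto
  then show thesis by (rule that)
qed

section \<open>Frames\<close>

definition frame :: "'a set \<Rightarrow> bool"
  where "frame M \<longleftrightarrow> M \<subseteq> exposed \<and> pairwise orth M"

lemma frame_subset: "frame M \<Longrightarrow> A \<subseteq> M \<Longrightarrow> frame A"
  unfolding frame_def by (meson pairwise_subset subset_trans)

lemma frame_insert: "frame (insert a A) \<longleftrightarrow> a \<in> exposed \<and> (\<forall>b\<in>A - {a}. orth b a) \<and> frame A"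
  unfolding frame_def by (auto simp: pairwise_insert orth_commute)

lemma frame_finite: "frame M \<Longrightarrow> finite M" and frame_card: "frame M \<Longrightarrow> card M \<le> card B"
proof -
  assume M: "frame M"
  have "independent M"
    unfolding dependent_def
  proof (intro notI, elim bexE)
    fix a assume a: "a \<in> M" "a \<in> span (M - {a})"
    have ae: "a \<in> exposed" using M a by (auto simp: frame_def)
    have "phi a b = 0" if "b \<in> M - {a}" for b
      using M a that by (intro phi_orth[OF ae]) (auto simp: frame_def pairwise_def)
    then have "phi a a = 0" by (rule linear_eq_0_on_span[OF phi_linear[OF ae] _ a(2)])
    then show False using phi_self[OF ae] by simp
  qed
  then show "finite M" "card M \<le> card B" by (rule independent_card_bound)+
qed

lemma frame_sum_bound: "frame A \<Longrightarrow> (\<Sum>a\<in>A. \<bar>phi a x\<bar>) \<le> norm x"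
proof -
  assume "frame A"
  from frame_finite[OF this] this show ?thesis
  proof (induction A arbitrary: x rule: finite_induct)
    case (insert a A)
    then have a: "a \<in> exposed" and A: "frame A" and ab: "\<forall>b\<in>A. orth b a"
      by (auto simp: frame_insert)
    have "(\<Sum>b\<in>A. \<bar>phi b x\<bar>) = (\<Sum>b\<in>A. \<bar>phi b (P0 a x)\<bar>)"
      using a A ab by (intro sum.cong) (auto simp: phi_P0 orth_commute frame_def subset_iff)
    also have "\<dots> \<le> norm (P0 a x)" by (rule insert.IH[OF A])
    finally show ?case using insert.hyps phi_P0_bound[OF a, of x] by simp
  qed simp
qed

text \<open>The projections \<open>P\<^sub>0\<close> at the elements of a frame preserve each other's ranges, so their
  composition projects onto the intersection.\<close>

lemma frame_projection:
  assumes "frame A"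
  obtains Q where "neutral_onto Q (orth_compl A)"
proof -
  from frame_finite[OF assms] assms have "\<exists>Q. neutral_onto Q (orth_compl A)"
  proof (induction A rule: finite_induct)
    case empty
    have "neutral_onto (\<lambda>x::'a. x) UNIV" by (rule neutral_ontoI) (auto simp: linear_ident)
    then show ?case by (auto simp: orth_compl_empty)
  next
    case (insert a A)
    then have a: "a \<in> exposed" and A: "frame A" and ab: "\<forall>b\<in>A. orth b a"
      by (auto simp: frame_insert)
    obtain Q where Q: "neutral_onto Q (orth_compl A)" using insert.IH[OF A] by blast
    have "P0 a x \<in> orth_compl A" if "x \<in> orth_compl A" for x
      using that P0_preserves_orth[OF a] A ab by (auto simp: orth_compl_def frame_def orth_commute)
    from neutral_onto_compose[OF neutral_onto_orth[OF a] Q this]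
    show ?case unfolding orth_compl_insert[of a A] by blast
  qed
  then show thesis using that by blast
qed

text \<open>Maximality refers to the cardinality, not to inclusion, so that it survives the exchange of one
  element for another.\<close>

definition max_frame :: "'a set \<Rightarrow> bool"
  where "max_frame M \<longleftrightarrow> frame M \<and> (\<forall>N. frame N \<longrightarrow> card N \<le> card M)"

lemma max_frame_exists: obtains M where "max_frame M"
proof -
  have "frame {}" by (simp add: frame_def)
  moreover have "\<forall>N. frame N \<longrightarrow> card N < card B + 1" using frame_card by (simp add: less_Suc_eq_le)
  ultimately obtain M where "frame M" "\<And>N. frame N \<Longrightarrow> card N \<le> card M"
    using ex_has_greatest_nat[of frame "{}" card "card B + 1"] by blast
  then show thesis using that by (auto simp: max_frame_def)
qed

lemma max_frame_orth_compl:
  assumes M: "max_frame M"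
  shows "orth_compl M = {0}"
proof (rule ccontr)
  assume ne: "orth_compl M \<noteq> {0}"
  have fM: "frame M" using M by (simp add: max_frame_def)
  obtain Q where "neutral_onto Q (orth_compl M)" using frame_projection[OF fM] by blast
  then obtain f where f: "f \<in> exposed" "f \<in> orth_compl M" using exposed_in_range ne by blast
  have "f \<notin> M" using f orth_self[of f] exposed_nonzero[of f] by (auto simp: orth_compl_def)
  moreover have "frame (insert f M)"
    using f fM by (auto simp: frame_insert orth_compl_def orth_commute)
  then have "card (insert f M) \<le> card M" using M by (simp add: max_frame_def)
  ultimately show False using frame_finite[OF fM] by simp
qed

section \<open>The tripotents of exposed points\<close>

definition unit :: "'a \<Rightarrow> ('a \<Rightarrow>\<^sub>L real)"
  where "unit e = Blinfun (phi e)"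

lemma unit_apply: "e \<in> exposed \<Longrightarrow> blinfun_apply (unit e) x = phi e x"
  unfolding unit_def using linear_imp_bounded[OF phi_linear] by (simp add: bounded_linear_Blinfun_apply)

lemma norm_blinfun_eq_1:
  fixes U :: "'a \<Rightarrow>\<^sub>L real"
  assumes "\<And>x. \<bar>U x\<bar> \<le> norm x" "norm z = 1" "U z = 1"
  shows "norm U = 1"
proof (rule antisym)
  show "norm U \<le> 1" using assms(1) by (intro norm_blinfun_bound) auto
  show "1 \<le> norm U" using norm_blinfun[of U z] assms by simp
qed

lemma norm_unit: "e \<in> exposed \<Longrightarrow> norm (unit e) = 1"
  by (rule norm_blinfun_eq_1[of _ e]) (auto simp: unit_apply abs_phi_le exposed_norm phi_self)

lemma face_unit: "e \<in> exposed \<Longrightarrow> face (unit e) = {e}"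
proof (intro equalityI subsetI)
  assume e: "e \<in> exposed"
  show "x \<in> {e}" if "x \<in> face (unit e)" for x
    using that phi_exposes[OF e, of x] by (simp add: face_def unit_apply[OF e])
  show "x \<in> face (unit e)" if "x \<in> {e}" for x
    using that e by (simp add: face_def unit_apply exposed_norm phi_self)
qed

lemma geometric_tripotent_unit:
  assumes e: "e \<in> exposed"
  shows "geometric_tripotent (unit e)"
  using e exposed_face[OF e] face_symmetry[OF exposed_face[OF e]] phi_sym[OF e]
  by (auto simp: geometric_tripotent_def projective_unit_def norm_unit face_unit unit_apply
      orth_compl_singleton phi_orth symmetric_face_def symmetry_def)

lemma tripotent_orth_unit:
  assumes "e \<in> exposed" "f \<in> exposed" "orth e f"
  shows "tripotent_orth (unit e) (unit f)"
  unfolding tripotent_orth_def dual_peirce0_def using assms phi_P0[of f e]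
  by (auto simp: face_unit unit_apply P0_def[symmetric] orth_commute intro!: exI[of _ "unit e"])

lemma JP_exposed:
  assumes e: "e \<in> exposed" and f: "f \<in> exposed" and ef: "orth e f"
  shows "norm (unit e + unit f) = 1" "norm_exposed_face (face (unit e + unit f))"
    "e \<in> face (unit e + unit f)" "f \<in> face (unit e + unit f)"
    "face_symmetry (face (unit e + unit f)) = symmetry e \<circ> symmetry f"
proof -
  have z: "phi e f = 0" "phi f e = 0" using phi_orth e f ef by (simp_all add: orth_commute)
  have "e \<noteq> f" using ef orth_self exposed_nonzero[OF e] by blast
  then have "\<bar>phi e x + phi f x\<bar> \<le> norm x" for x
  proof -
    have "frame {e, f}" using e f ef by (simp add: frame_def pairwise_insert orth_commute)
    from frame_sum_bound[OF this, of x] show ?thesis using \<open>e \<noteq> f\<close> by simp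
  qed
  then show n: "norm (unit e + unit f) = 1"
    using z e f by (intro norm_blinfun_eq_1[of _ e])
      (simp_all add: blinfun.add_left unit_apply exposed_norm phi_self)
  show mem: "e \<in> face (unit e + unit f)" "f \<in> face (unit e + unit f)"
    using z e f by (auto simp: face_def blinfun.add_left unit_apply exposed_norm phi_self)
  show "norm_exposed_face (face (unit e + unit f))"
    unfolding norm_exposed_face_def using n mem by blast
  show "face_symmetry (face (unit e + unit f)) = symmetry e \<circ> symmetry f"
    using JP[unfolded property_JP_def, rule_format,
        OF geometric_tripotent_unit[OF e] geometric_tripotent_unit[OF f] tripotent_orth_unit[OF assms]]
    by (simp add: symmetry_def face_unit e f)
qed

section \<open>No joint Peirce-one part\<close>

lemma span_face_fixed:
  assumes F: "norm_exposed_face (F :: 'a set)" and "x \<in> span F"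
  shows "face_symmetry F x = x"
  using face_symmetry_props(6)[OF F, of x] assms(2) subspace_0[OF face_symmetry_props(4)[OF F]]
  by (metis add.right_neutral)

lemma pair_sym_invariant_face:
  assumes e: "e \<in> exposed" and g: "g \<in> exposed" and eg: "orth e g"
    and x: "x \<in> span (face (unit e + unit g))"
  shows "symmetry e x \<in> span (face (unit e + unit g))"
proof -
  have "symmetry e f \<in> face (unit e + unit g)" if "f \<in> face (unit e + unit g)" for f
    using that e g eg
    by (simp add: face_def blinfun.add_left unit_apply sym_norm phi_sym orth_sym_commute(2))
  then have "symmetry e ` span (face (unit e + unit g)) \<subseteq> span (face (unit e + unit g))"
    unfolding linear_span_image[OF sym_linear[OF e], symmetric] by (intro span_mono) blast
  then show ?thesis using x by blast
qed

text \<open>By joint Peirce decomposition the symmetry of the face of \<open>\<phi>\<^sub>e + \<phi>\<^sub>g\<close> is the product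
  of the symmetries at \<open>e\<close> and \<open>g\<close>, which fixes \<open>x\<close>. The component of \<open>x\<close> in the
  complement of the face is orthogonal to \<open>e\<close>, so it cannot change sign.\<close>

lemma joint_peirce1_in_span_face:
  assumes e: "e \<in> exposed" and g: "g \<in> exposed" and eg: "orth e g"
    and x: "symmetry e x = - x" "symmetry g x = - x"
  shows "x \<in> span (face (unit e + unit g))"
proof -
  let ?F = "face (unit e + unit g)"
  note J = JP_exposed[OF e g eg]
  have "face_symmetry ?F x = x" using x by (simp add: J(5) linear_neg[OF sym_linear[OF e]])
  then obtain a b where ab: "a \<in> span ?F" "b \<in> orth_compl ?F" "x = a + b"
    using face_symmetry_props(6)[OF J(2), of x] by blast
  have "orth b e" using ab(2) J(3) by (auto simp: orth_compl_def)
  then have "symmetry e b = b" by (rule sym_orth[OF e])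
  then have "symmetry e a + b = - (a + b)" using x(1) ab(3) by (simp add: linear_add[OF sym_linear[OF e]])
  moreover have "2 *\<^sub>R b + (symmetry e a + a) = (symmetry e a + b) + (a + b)" by (simp add: scaleR_2)
  ultimately have "2 *\<^sub>R b + (symmetry e a + a) = 0" by simp
  then have "2 *\<^sub>R b = - (symmetry e a + a)" by (simp only: eq_neg_iff_add_eq_0)
  then have "(1 / 2) *\<^sub>R (2 *\<^sub>R b) = (1 / 2) *\<^sub>R (- (symmetry e a + a))" by (rule arg_cong)
  then have "b = (1 / 2) *\<^sub>R (- (symmetry e a + a))" by (simp only: scaleR_scaleR) simp
  also have "\<dots> \<in> span ?F"
    using pair_sym_invariant_face[OF e g eg ab(1)] ab(1) by (intro span_scale span_neg span_add)
  finally have "b \<in> span ?F \<inter> orth_compl ?F" using ab(2) by simp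
  then have "b = 0" using face_symmetry_props(5)[OF J(2)] by simp
  then show ?thesis using ab by simp
qed

text \<open>A vector \<open>x\<close> fixed by the product of the two symmetries is the sum of a vector fixed by both
  and one on which both act as \<open>-1\<close>. By maximality of the frame the former is a combination of
  \<open>e\<close> and \<open>g\<close>. The right-hand side does not change if \<open>g\<close> is replaced by \<open>- g\<close>, so the faces of
  \<open>\<phi>\<^sub>e + \<phi>\<^sub>g\<close> and \<open>\<phi>\<^sub>e - \<phi>\<^sub>g\<close> have the same span.\<close>

lemma pair_face_span:
  assumes M: "max_frame M" and e: "e \<in> M" and g: "g \<in> M" and "e \<noteq> g"
  shows "span (face (unit e + unit g))
    = {x \<in> orth_compl (M - {e, g}). symmetry e (symmetry g x) = x}" (is "span ?F = ?R")
proof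
  have fM: "frame M" using M by (simp add: max_frame_def)
  have ex: "c \<in> exposed" if "c \<in> M" for c using fM that by (auto simp: frame_def)
  have orthM: "orth c d" if "c \<in> M" "d \<in> M" "c \<noteq> d" for c d
    using fM that by (auto simp: frame_def pairwise_def)
  note ee = ex[OF e] and ge = ex[OF g] and eg = orthM[OF e g \<open>e \<noteq> g\<close>]
  note J = JP_exposed[OF ee ge eg]
  have "orth f c" if f: "f \<in> ?F" and c: "c \<in> M - {e, g}" for f c
  proof -
    have ce: "c \<in> exposed" using ex c by blast
    have three: "\<bar>phi e x\<bar> + \<bar>phi g x\<bar> + \<bar>phi c x\<bar> \<le> norm x" for x
    proof -
      have "frame {e, g, c}" by (rule frame_subset[OF fM]) (use e g c in auto)
      from frame_sum_bound[OF this, of x] show ?thesis using c \<open>e \<noteq> g\<close> by auto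
    qed
    have f1: "norm f \<le> 1" "phi e f + phi g f = 1"
      using f by (auto simp: face_def blinfun.add_left unit_apply ee ge)
    have c0: "phi c f = 0" using three[of f] f1 by linarith
    have n: "norm f = 1" using three[of f] f1 by linarith
    have "phi e c = 0" "phi g c = 0"
      using phi_orth[OF ee orthM[of c e]] phi_orth[OF ge orthM[of c g]] c e g by auto
    then have "2 \<le> norm (f + s *\<^sub>R c)" if "\<bar>s\<bar> = 1" for s
      using three[of "f + s *\<^sub>R c"] f1 c0 that
      by (simp add: linear_add[OF phi_linear] linear_scale[OF phi_linear] ee ge ce phi_self)
    from this[of 1] this[of "- 1"] show ?thesis
      using norm_triangle_ineq[of f c] norm_triangle_ineq4[of f c]
      by (simp add: orth_def n exposed_norm[OF ce])
  qed
  then have "?F \<subseteq> orth_compl (M - {e, g})" by (auto simp: orth_compl_def)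
  moreover have "subspace (orth_compl (M - {e, g}))"
    using frame_projection[OF frame_subset[OF fM]] neutral_ontoD(6) by (metis Diff_subset)
  ultimately have "span ?F \<subseteq> orth_compl (M - {e, g})" by (rule span_minimal)
  then show "span ?F \<subseteq> ?R" using span_face_fixed[OF J(2)] by (auto simp: J(5))
  show "?R \<subseteq> span ?F"
  proof
    fix x assume "x \<in> ?R"
    then have xA: "x \<in> orth_compl (M - {e, g})" and fx: "symmetry e (symmetry g x) = x" by auto
    have eq: "symmetry g x = symmetry e x" using fx sym_sym[OF ee, of "symmetry g x"] by simp
    have ge_x: "symmetry g (symmetry e x) = x"
      using orth_sym_commute(1)[OF ee ge eg, of x] fx by simp
    note Le = sym_linear[OF ee] and Lg = sym_linear[OF ge]
    define b where "b = P0 e x"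
    have b_orth: "orth b e" unfolding b_def by (rule P0_orth[OF ee])
    have x1: "(1 / 2) *\<^sub>R (x + symmetry e x) = phi e x *\<^sub>R e + b" unfolding b_def by (rule peirce_eq[OF ee])
    have ge_e: "symmetry g e = e" by (rule sym_orth[OF ge eg])
    have "symmetry g ((1 / 2) *\<^sub>R (x + symmetry e x)) = (1 / 2) *\<^sub>R (x + symmetry e x)"
      by (simp add: linear_scale[OF Lg] linear_add[OF Lg] eq ge_x add.commute)
    then have "symmetry g b = b"
      unfolding x1 by (simp add: linear_scale[OF Lg] linear_add[OF Lg] ge_e)
    then have b: "b = phi g b *\<^sub>R g + P0 g b" using peirce_eq[OF ge, of b] by (simp flip: scaleR_2)
    have "P0 g b \<in> orth_compl M"
      unfolding orth_compl_def
    proof safe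
      fix c assume c: "c \<in> M"
      consider "c = g" | "c = e" | "c \<in> M - {e, g}" using c by blast
      then show "orth (P0 g b) c"
      proof cases
        case 1
        then show ?thesis using P0_orth[OF ge] by simp
      next
        case 2
        then show ?thesis using P0_preserves_orth[OF ge ee _ b_orth] eg by (simp add: orth_commute)
      next
        case 3
        then have "orth x c" "c \<in> exposed" "orth e c" "orth g c"
          using xA ex orthM e g by (auto simp: orth_compl_def)
        then show ?thesis unfolding b_def using P0_preserves_orth ee ge by blast
      qed
    qed
    then have "P0 g b = 0" using max_frame_orth_compl[OF M] by simp
    then have "(1 / 2) *\<^sub>R (x + symmetry e x) = phi e x *\<^sub>R e + phi g b *\<^sub>R g" using x1 b by simp
    also have "\<dots> \<in> span ?F" using J(3,4) by (intro span_add span_scale span_base)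
    finally have 1: "(1 / 2) *\<^sub>R (x + symmetry e x) \<in> span ?F" .
    have 2: "(1 / 2) *\<^sub>R (x - symmetry e x) \<in> span ?F"
      by (rule joint_peirce1_in_span_face[OF ee ge eg])
        (simp_all add: linear_scale[OF Le] linear_diff[OF Le] linear_scale[OF Lg] linear_diff[OF Lg]
          sym_sym[OF ee] eq ge_x algebra_simps)
    have "x = (1 / 2) *\<^sub>R (x + symmetry e x) + (1 / 2) *\<^sub>R (x - symmetry e x)"
      by (simp add: scaleR_add_right[symmetric] flip: scaleR_2)
    also have "\<dots> \<in> span ?F" using 1 2 by (rule span_add)
    finally show "x \<in> span ?F" .
  qed
qed

text \<open>If the symmetry at \<open>f\<close> fixes \<open>e\<close>, then \<open>e\<close> is the sum of a multiple of \<open>f\<close> and a vector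
  orthogonal to \<open>f\<close>, whose norms add up. As an extreme point, \<open>e\<close> is then \<open>\<plusminus> f\<close> or
  orthogonal to \<open>f\<close>.\<close>

lemma fixed_exposed_isolated:
  assumes e: "e \<in> exposed" and f: "f \<in> exposed" and fx: "symmetry f e = (e::'a)"
    and near: "norm (f - e) < 2"
  shows "f = e"
proof -
  define a b where "a = phi f e" and "b = P0 f e"
  have eab: "e = a *\<^sub>R f + b"
    using peirce_eq[OF f, of e] fx by (simp add: a_def b_def flip: scaleR_2)
  have "orth f b" using P0_orth[OF f, of e] by (simp add: b_def orth_commute)
  then have n: "1 = \<bar>a\<bar> + norm b"
    using orth_norm_add[of f b a] eab exposed_norm[OF e] exposed_norm[OF f] by simp
  have "1 = phi e (a *\<^sub>R f + b)" using eab phi_self[OF e] by simp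
  then have 1: "1 = a * phi e f + phi e b"
    by (simp add: linear_add[OF phi_linear[OF e]] linear_scale[OF phi_linear[OF e]])
  have "a \<noteq> 0"
  proof
    assume "a = 0"
    then have "orth f e" using \<open>orth f b\<close> eab by simp
    then show False using near by (simp add: orth_def exposed_norm[OF e] exposed_norm[OF f])
  qed
  have "\<bar>a\<bar> \<le> \<bar>a\<bar> * \<bar>phi e f\<bar>"
    using n 1 phi_le[OF e, of b] abs_ge_self[of "a * phi e f"] by (simp add: abs_mult)
  then have "\<bar>phi e f\<bar> = norm f"
    using \<open>a \<noteq> 0\<close> abs_phi_le[OF e, of f] exposed_norm[OF f] by simp
  then have f_eq: "f = phi e f *\<^sub>R e" "\<bar>phi e f\<bar> = 1"
    using phi_neutral[OF e] exposed_norm[OF f] by auto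
  have "phi e f \<noteq> - 1"
  proof
    assume "phi e f = - 1"
    then have "f = - e" using f_eq(1) by simp
    then have "f - e = - (2 *\<^sub>R e)" by (simp add: scaleR_2)
    then show False using near exposed_norm[OF e] by simp
  qed
  then show ?thesis using f_eq by (cases "phi e f \<ge> 0") auto
qed

lemma max_frame_flip:
  assumes M: "max_frame M" and g: "g \<in> M"
  shows "max_frame (insert (- g) (M - {g}))" "- g \<notin> M - {g}"
proof -
  have fM: "frame M" using M by (simp add: max_frame_def)
  then have ge: "g \<in> exposed" and orthg: "\<And>c. c \<in> M - {g} \<Longrightarrow> orth c g"
    using g by (auto simp: frame_def pairwise_def)
  show notin: "- g \<notin> M - {g}"
  proof
    assume "- g \<in> M - {g}"
    then have "orth g g" using orthg[of "- g"] by (simp add: orth_commute[of "- g"] orth_neg_right)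
    then show False using orth_self exposed_nonzero[OF ge] by blast
  qed
  have "frame (insert (- g) (M - {g}))"
    using orthg exposed_uminus(1)[OF ge] frame_subset[OF fM, of "M - {g}"]
    by (auto simp: frame_insert orth_neg_right)
  moreover have "card (insert (- g) (M - {g})) = card M"
    using card_insert_disjoint[OF _ notin] card_Suc_Diff1[OF _ g] frame_finite[OF fM] by simp
  ultimately show "max_frame (insert (- g) (M - {g}))" using M by (simp add: max_frame_def)
qed

text \<open>Suppose that \<open>w \<noteq> 0\<close> is a common \<open>-1\<close>-eigenvector of the symmetries at \<open>e\<close> and
  \<open>g\<close>. The faces of \<open>\<phi>\<^sub>e \<plusminus> \<phi>\<^sub>g\<close> span the same space \<open>V\<close>, so both are facets of
  its unit ball. They meet at \<open>e\<close>. Strong facial symmetry prevents a functional of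
  norm one supporting the ball of \<open>V\<close> at \<open>e\<close> from being nonzero at \<open>w\<close>; therefore \<open>e\<close> is a
  limit of exposed points \<open>f \<noteq> e\<close> of \<open>V\<close>. Along a sequence of such \<open>f\<close> tending to \<open>e\<close> the
  symmetries take each of the two facets to a fixed facet, which contains \<open>e\<close>. So they map \<open>e\<close>
  into the intersection \<open>{e}\<close> of the two facets, which is impossible for \<open>f\<close> close to \<open>e\<close>.\<close>

lemma joint_peirce1_trivial:
  assumes M: "max_frame M" and eM: "e \<in> M" and gM: "g \<in> M" and "e \<noteq> g"
    and w: "symmetry e w = - w" "symmetry g w = - w"
  shows "w = 0"
proof (rule ccontr)
  assume "w \<noteq> 0"
  have fM: "frame M" using M by (simp add: max_frame_def)
  have ex: "c \<in> exposed" if "c \<in> M" for c using fM that by (auto simp: frame_def)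
  note e = ex[OF eM] and g = ex[OF gM]
  have eg: "orth e g" using fM eM gM \<open>e \<noteq> g\<close> by (auto simp: frame_def pairwise_def)
  then have eg': "orth e (- g)" by (simp add: orth_neg_right)
  note g' = exposed_uminus(1)[OF g]
  note J = JP_exposed[OF e g eg] and J' = JP_exposed[OF e g' eg']
  define V where "V = span (face (unit e + unit g))"
  define A where "A = M - {e, g}"
  have V_eq: "V = {x \<in> orth_compl A. symmetry e (symmetry g x) = x}"
    unfolding V_def A_def by (rule pair_face_span[OF M eM gM \<open>e \<noteq> g\<close>])
  have V_eq': "V = span (face (unit e + unit (- g)))"
  proof -
    note flip = max_frame_flip[OF M gM]
    have "e \<noteq> - g" using eg orth_self[of g] exposed_nonzero[OF g]
      by (metis minus_minus orth_commute orth_neg_right)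
    moreover have "insert (- g) (M - {g}) - {e, - g} = A" using flip(2) by (auto simp: A_def)
    moreover have "e \<in> insert (- g) (M - {g})" using eM \<open>e \<noteq> g\<close> by blast
    ultimately show ?thesis
      using pair_face_span[OF flip(1), of e "- g"] by (simp add: V_eq exposed_uminus(2)[OF g])
  qed
  have V: "subspace V" unfolding V_def by (rule subspace_span)
  have eV: "e \<in> V" unfolding V_def by (rule span_base[OF J(3)])
  have wV: "w \<in> V" unfolding V_def by (rule joint_peirce1_in_span_face[OF e g eg w])
  note Q = neutral_onto_span_face[OF J(2), folded V_def]
  note Q' = neutral_ontoD[OF Q]

  \<comment> \<open>A functional vanishing at \<open>e\<close> but not at \<open>w\<close>.\<close>
  obtain u0 where u0: "linear u0" "\<And>x. u0 x \<le> norm x" "u0 w = norm w"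
    using norming_functional[of w] by blast
  define h where "h x = u0 ((1 / 2) *\<^sub>R (x - symmetry e x))" for x
  have h: "linear h"
    by (rule linearI) (simp_all add: h_def linear_add[OF sym_linear[OF e]]
        linear_scale[OF sym_linear[OF e]] linear_diff[OF u0(1)] linear_add[OF u0(1)]
        linear_scale[OF u0(1)] algebra_simps)
  have he: "h e = 0" by (simp add: h_def sym_self[OF e] linear_0[OF u0(1)])
  have hw: "h w = norm w" using u0(3) by (simp add: h_def w(1) flip: scaleR_2)
  have h_le: "h x \<le> norm x" for x
  proof -
    have "h x \<le> norm ((1 / 2) *\<^sub>R (x - symmetry e x))" unfolding h_def by (rule u0(2))
    also have "\<dots> \<le> norm x" using norm_triangle_ineq4[of x "symmetry e x"] by (simp add: sym_norm[OF e])
    finally show ?thesis .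
  qed
  define y where "y n x = phi e x + (1 / real (Suc n)) * h x" for n x
  have y: "linear (y n)" for n
    by (rule linearI) (simp_all add: y_def linear_add[OF h] linear_scale[OF h]
        linear_add[OF phi_linear[OF e]] linear_scale[OF phi_linear[OF e]] add_divide_distrib distrib_left)
  have ye: "y n e = 1" for n by (simp add: y_def phi_self[OF e] he)
  have "\<exists>x\<in>V. norm x \<le> 1 \<and> 1 < y n x" for n
  proof (rule ccontr)
    let ?Q = "peirce_proj2 (face (unit e + unit g))"
    assume "\<not> (\<exists>x\<in>V. norm x \<le> 1 \<and> 1 < y n x)"
    then have le: "y n x \<le> 1" if "x \<in> V" "norm x \<le> 1" for x using that by force
    define Y where "Y x = y n (?Q x)" for x
    have Y: "linear Y" using linear_compose[OF Q'(1) y[of n]] unfolding Y_def comp_def .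
    have "Y x \<le> norm x" for x
    proof (cases "x = 0")
      case False
      have "y n (?Q ((1 / norm x) *\<^sub>R x)) \<le> 1"
        using Q'(2) Q'(4)[of "(1 / norm x) *\<^sub>R x"] False by (intro le) auto
      then have "(1 / norm x) * Y x \<le> 1" by (simp add: Y_def linear_scale[OF Q'(1)] linear_scale[OF y])
      then show ?thesis using False by (simp add: field_simps)
    qed (simp add: linear_0[OF Y])
    moreover have "Y e = 1" by (simp add: Y_def Q'(3)[OF eV] ye)
    ultimately have "Y (symmetry e w) = Y w" by (rule sym_invariant[OF e Y])
    then have "Y w = 0" by (simp add: w(1) linear_neg[OF Y])
    moreover have "phi e w = 0"
      using phi_sym[OF e, of w] by (simp add: w(1) linear_neg[OF phi_linear[OF e]])
    ultimately show False using \<open>w \<noteq> 0\<close> by (simp add: Y_def Q'(3)[OF wV] y_def hw)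
  qed
  then have "\<exists>f. f \<in> exposed \<and> f \<in> V \<and> 1 < y n f" for n
    using exposed_norming[OF Q y[of n], of _ 1] by (metis zero_le_one)
  then obtain f where f: "\<And>n. f n \<in> exposed" "\<And>n. f n \<in> V" "\<And>n. 1 < y n (f n)" by metis
  have f_ne: "f n \<noteq> e" for n using f(3)[of n] ye[of n] by auto

  \<comment> \<open>At a limit point of the sequence \<open>\<phi>\<^sub>e\<close> has the value \<open>1\<close>, so it is \<open>e\<close>.\<close>
  obtain l s0 where s0: "strict_mono s0" "(f \<circ> s0) \<longlonglongrightarrow> l" "norm l \<le> 1"
    using bounded_sequence_converges[of f 1] exposed_norm[OF f(1)] by (metis order_refl)
  have "1 \<le> phi e l"
  proof (rule LIMSEQ_le)
    show "(\<lambda>n. 1 - 1 / real (Suc n)) \<longlonglongrightarrow> 1"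
      using tendsto_diff[OF tendsto_const LIMSEQ_Suc[OF lim_inverse_n'], of 1] by simp
    show "(\<lambda>n. phi e ((f \<circ> s0) n)) \<longlonglongrightarrow> phi e l" by (rule linear_tendsto[OF phi_linear[OF e] s0(2)])
    have "1 - 1 / real (Suc n) \<le> phi e ((f \<circ> s0) n)" for n
    proof -
      have "1 < phi e (f (s0 n)) + (1 / real (Suc (s0 n))) * h (f (s0 n))"
        using f(3)[of "s0 n"] by (simp add: y_def)
      also have "\<dots> \<le> phi e (f (s0 n)) + (1 / real (Suc (s0 n))) * 1"
        using h_le[of "f (s0 n)"] exposed_norm[OF f(1)] by (intro add_left_mono mult_left_mono) auto
      also have "\<dots> \<le> phi e (f (s0 n)) + 1 / real (Suc n)"
        using seq_suble[OF s0(1), of n] by (simp add: frac_le)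
      finally show ?thesis by simp
    qed
    then show "\<exists>N. \<forall>n\<ge>N. 1 - 1 / real (Suc n) \<le> phi e ((f \<circ> s0) n)" by blast
  qed
  then have "phi e l = 1" using phi_le[OF e, of l] s0(3) by linarith
  then have "l = e" by (rule phi_exposes[OF e s0(3)])

  have sym_V: "symmetry (f n) x \<in> V" if x: "x \<in> V" for n x
  proof -
    define T where "T = symmetry e \<circ> symmetry g"
    have T: "linear T" "\<And>x. norm (T x) = norm x" "\<And>x. T (T x) = x"
      unfolding T_def using linear_compose[OF sym_linear[OF g] sym_linear[OF e]]
      by (simp_all add: sym_norm e g orth_sym_commute(1)[OF e g eg] sym_sym)
    have Tf: "T (f n) = f n" and Tx: "T x = x" using f(2)[of n] x by (simp_all add: V_eq T_def)
    have "T (symmetry (f n) x) = symmetry (f n) x"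
      using isometry_fixing_commutes(1)[OF f(1) T Tf, of x] Tx by simp
    moreover have "symmetry (f n) x \<in> orth_compl A"
      unfolding orth_compl_def
    proof safe
      fix c assume c: "c \<in> A"
      have "orth (f n) c" "orth x c" using f(2)[of n] x c by (auto simp: V_eq orth_compl_def)
      moreover have "c \<in> exposed" using c ex by (auto simp: A_def)
      ultimately show "orth (symmetry (f n) x) c" by (intro orth_sym_commute(3) f(1))
    qed
    ultimately show ?thesis by (simp add: V_eq T_def)
  qed

  \<comment> \<open>Along a subsequence both facets have constant images.\<close>
  have ne: "face (unit e + unit g) \<noteq> {}" "face (unit e + unit (- g)) \<noteq> {}"
    using J(3) J'(3) by blast+
  obtain p r where p: "p \<in> face (unit e + unit g)" "r > 0"
    "\<forall>x\<in>V. norm (x - p) < r \<longrightarrow> norm x = (unit e + unit g) x"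
    by (rule face_relative_interior[OF J(1) ne(1), folded V_def])
  obtain p' r' where p': "p' \<in> face (unit e + unit (- g))" "r' > 0"
    "\<forall>x\<in>V. norm (x - p') < r' \<longrightarrow> norm x = (unit e + unit (- g)) x"
    by (rule face_relative_interior[OF J'(1) ne(2), folded V_eq'])
  have pV: "p \<in> V" unfolding V_def by (rule span_base[OF p(1)])
  have p'V: "p' \<in> V" unfolding V_eq' by (rule span_base[OF p'(1)])
  have lin: "linear (blinfun_apply u)" for u :: "'a \<Rightarrow>\<^sub>L real"
    by (simp add: blinfun.bounded_linear_right bounded_linear.linear)
  have subsequence: "\<exists>s :: nat \<Rightarrow> nat. strict_mono s \<and>
      (\<forall>m n. \<forall>x\<in>V. u (symmetry (f (j (s m))) x) = u (symmetry (f (j (s n))) x))"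
    if facet: "q \<in> V" "\<rho> > 0" "\<forall>x\<in>V. norm (x - q) < \<rho> \<longrightarrow> norm x = u x"
    for u :: "'a \<Rightarrow>\<^sub>L real" and q \<rho> and j :: "nat \<Rightarrow> nat"
  proof (rule facet_images_subsequence[OF V lin facet(1,2), where T = "\<lambda>n. symmetry (f (j n))"])
    show "norm x = u x" if "x \<in> V" "norm (x - q) < \<rho>" for x using facet(3) that by blast
    show "linear (symmetry (f (j n)))" "norm (symmetry (f (j n)) x) = norm x"
      "symmetry (f (j n)) (symmetry (f (j n)) x) = x" for n x
      by (rule sym_linear[OF f(1)] sym_norm[OF f(1)] sym_sym[OF f(1)])+
    show "symmetry (f (j n)) x \<in> V" if "x \<in> V" for n x using that by (rule sym_V)
    fix s :: "nat \<Rightarrow> nat"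
    assume s: "strict_mono s"
      "\<And>m n x. x \<in> V \<Longrightarrow> u (symmetry (f (j (s m))) x) = u (symmetry (f (j (s n))) x)"
    show ?thesis by (intro exI[of _ s] conjI allI ballI s)
  qed
  obtain s1 :: "nat \<Rightarrow> nat" where s1: "strict_mono s1" "\<forall>m n. \<forall>x\<in>V.
      (unit e + unit g) (symmetry (f (s0 (s1 m))) x) = (unit e + unit g) (symmetry (f (s0 (s1 n))) x)"
    using subsequence[OF pV p(2,3), of s0] by blast
  obtain s2 :: "nat \<Rightarrow> nat" where s2: "strict_mono s2" "\<forall>m n. \<forall>x\<in>V.
      (unit e + unit (- g)) (symmetry (f (s0 (s1 (s2 m)))) x)
      = (unit e + unit (- g)) (symmetry (f (s0 (s1 (s2 n)))) x)"
    using subsequence[OF p'V p'(2,3), of "\<lambda>n. s0 (s1 n)"] by blast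
  define k where "k n = f (s0 (s1 (s2 n)))" for n
  have k: "k n \<in> exposed" "k n \<in> V" "k n \<noteq> e" for n by (simp_all add: k_def f f_ne)
  have "strict_mono (s1 \<circ> s2)" using s1(1) s2(1) by (rule strict_mono_o)
  from LIMSEQ_subseq_LIMSEQ[OF s0(2) this] have k_lim: "k \<longlonglongrightarrow> e"
    by (simp add: k_def[abs_def] comp_def \<open>l = e\<close>)
  \<comment> \<open>The common image of a facet under the symmetries contains all \<open>k n\<close>, hence their limit \<open>e\<close>.\<close>
  have "u (symmetry (k m) e) = u e"
    if u: "\<And>m n x. x \<in> V \<Longrightarrow> u (symmetry (k m) x) = u (symmetry (k n) x)" for u :: "'a \<Rightarrow>\<^sub>L real" and m
  proof (rule LIMSEQ_unique)
    show "(\<lambda>n. u (symmetry (k m) (k n))) \<longlonglongrightarrow> u (symmetry (k m) e)"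
      by (rule linear_tendsto[OF lin linear_tendsto[OF sym_linear[OF k(1)] k_lim]])
    have "u (symmetry (k m) (k n)) = u (k n)" for n
      using u[OF k(2), of m n n] by (simp add: sym_self[OF k(1)])
    then show "(\<lambda>n. u (symmetry (k m) (k n))) \<longlonglongrightarrow> u e"
      using linear_tendsto[OF lin k_lim, of u] by simp
  qed
  then have "(unit e + unit g) (symmetry (k m) e) = (unit e + unit g) e"
    "(unit e + unit (- g)) (symmetry (k m) e) = (unit e + unit (- g)) e" for m
    using s1(2) s2(2) unfolding k_def by blast+
  then have sum_diff: "phi e (symmetry (k m) e) + phi g (symmetry (k m) e) = 1"
    "phi e (symmetry (k m) e) - phi g (symmetry (k m) e) = 1" for m
    using J(3) J'(3) by (simp_all add: face_def blinfun.add_left unit_apply e g g' exposed_uminus(3)[OF g])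
  have "phi e (symmetry (k m) e) = 1" for m using sum_diff[of m] by linarith
  then have fixed: "symmetry (k m) e = e" for m
    by (intro phi_exposes[OF e]) (simp_all add: sym_norm[OF k(1)] exposed_norm[OF e])
  obtain m where "norm (k m - e) < 2"
    using LIMSEQ_D[OF k_lim, of 2] by auto
  then show False using fixed_exposed_isolated[OF e k(1) fixed] k(3) by blast
qed

section \<open>The summand of an exposed point\<close>

definition summand :: "'a \<Rightarrow> 'a set"
  where "summand e = {x. P0 e x = 0}"

definition component :: "'a \<Rightarrow> 'a \<Rightarrow> 'a"
  where "component e x = x - P0 e x"

lemma max_frameD:
  assumes "max_frame M"
  shows "frame M" "finite M" "e \<in> M \<Longrightarrow> e \<in> exposed"
    "e \<in> M \<Longrightarrow> g \<in> M \<Longrightarrow> e \<noteq> g \<Longrightarrow> orth e g"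
  using assms frame_finite by (auto simp: max_frame_def frame_def pairwise_def)

lemma summand_self: "e \<in> exposed \<Longrightarrow> e \<in> summand e"
  by (simp add: summand_def P0_self)

lemma subspace_summand: "e \<in> exposed \<Longrightarrow> subspace (summand e)"
  unfolding summand_def by (rule linear_subspace_kernel[OF P0_linear])

lemma component_linear: "e \<in> exposed \<Longrightarrow> linear (component e)"
  unfolding component_def by (intro linear_compose_sub linear_ident P0_linear)

lemma component_in_summand: "e \<in> exposed \<Longrightarrow> component e x \<in> summand e"
  by (simp add: summand_def component_def linear_diff[OF P0_linear] P0_of_orth P0_orth)

lemma component_of_summand: "x \<in> summand e \<Longrightarrow> component e x = x"
  by (simp add: summand_def component_def)

lemma component_of_orth: "e \<in> exposed \<Longrightarrow> orth x e \<Longrightarrow> component e x = 0"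
  by (simp add: component_def P0_of_orth)

text \<open>On the \<open>-1\<close>-eigenspace at \<open>e\<close> the symmetry at \<open>g\<close> has no eigenvalue \<open>-1\<close>, so it is the
  identity there, and \<open>\<phi>\<^sub>g\<close>, which is invariant under the symmetry at \<open>e\<close>, vanishes.\<close>

lemma peirce1_orth:
  assumes M: "max_frame M" and e: "e \<in> M" and g: "g \<in> M" and "e \<noteq> g"
    and x: "symmetry e x = - x"
  shows "orth x g"
proof -
  note ee = max_frameD(3)[OF M e] and ge = max_frameD(3)[OF M g]
  have eg: "orth e g" using max_frameD(4)[OF M e g \<open>e \<noteq> g\<close>] .
  have "symmetry e (x - symmetry g x) = - (x - symmetry g x)"
    by (simp add: linear_diff[OF sym_linear[OF ee]] orth_sym_commute(1)[OF ee ge eg] x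
        linear_neg[OF sym_linear[OF ge]])
  moreover have "symmetry g (x - symmetry g x) = - (x - symmetry g x)"
    by (simp add: linear_diff[OF sym_linear[OF ge]] sym_sym[OF ge])
  ultimately have "x - symmetry g x = 0" by (rule joint_peirce1_trivial[OF M e g \<open>e \<noteq> g\<close>])
  then have "symmetry g x = x" by simp
  then have "x = phi g x *\<^sub>R g + P0 g x" using peirce_eq[OF ge, of x] by (simp flip: scaleR_2)
  moreover have "phi g x = 0"
    using orth_sym_commute(2)[OF ee ge eg, of x] by (simp add: x linear_neg[OF phi_linear[OF ge]])
  ultimately have "x = P0 g x" by simp
  then show ?thesis using P0_orth[OF ge, of x] by simp
qed

lemma summand_eq:
  assumes M: "max_frame M" and e: "e \<in> M"
  shows "summand e = orth_compl (M - {e})"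
proof (intro equalityI subsetI)
  note ee = max_frameD(3)[OF M e]
  fix x
  show "x \<in> orth_compl (M - {e})" if "x \<in> summand e"
    unfolding orth_compl_def
  proof (intro CollectI ballI)
    fix g assume "g \<in> M - {e}"
    then have g: "g \<in> M" "g \<noteq> e" by auto
    have ge: "g \<in> exposed" and eg: "orth e g" using max_frameD(3,4)[OF M] e g by auto
    define z where "z = (1 / 2) *\<^sub>R (x - symmetry e x)"
    have "symmetry e z = - z"
      by (simp add: z_def linear_scale[OF sym_linear[OF ee]] linear_diff[OF sym_linear[OF ee]]
          sym_sym[OF ee] scaleR_diff_right)
    then have "orth z g" using peirce1_orth[OF M e g(1)] g(2) by simp
    moreover have "x = (1 / 2) *\<^sub>R (x + symmetry e x) + z"
      by (simp add: z_def scaleR_add_right[symmetric] flip: scaleR_2)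
    then have "x = phi e x *\<^sub>R e + z" using peirce_eq[OF ee, of x] that by (simp add: summand_def)
    moreover have "phi e x *\<^sub>R e + z \<in> {x. orth x g}"
      using eg \<open>orth z g\<close> by (intro subspace_add subspace_scale subspace_orth[OF ge]) auto
    ultimately show "orth x g" by simp
  qed
  show "x \<in> summand e" if x: "x \<in> orth_compl (M - {e})"
  proof -
    have "P0 e x \<in> orth_compl M"
      unfolding orth_compl_def
    proof safe
      fix c assume c: "c \<in> M"
      show "orth (P0 e x) c"
      proof (cases "c = e")
        case False
        then have "c \<in> exposed" "orth e c" "orth x c"
          using max_frameD(3,4)[OF M] c e x by (auto simp: orth_compl_def)
        then show ?thesis by (rule P0_preserves_orth[OF ee])
      qed (simp add: P0_orth[OF ee])
    qed
    then show ?thesis using max_frame_orth_compl[OF M] by (simp add: summand_def)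
  qed
qed

lemma max_frame_exchange:
  assumes M: "max_frame M" and e: "e \<in> M" and f: "f \<in> exposed" "f \<in> summand e"
  shows "max_frame (insert f (M - {e}))" "f \<notin> M - {e}"
proof -
  have f_orth: "orth f c" if "c \<in> M - {e}" for c
    using f(2) that unfolding summand_eq[OF M e] by (simp add: orth_compl_def)
  then show notin: "f \<notin> M - {e}" using orth_self exposed_nonzero[OF f(1)] by blast
  have "frame (insert f (M - {e}))"
    using f(1) f_orth frame_subset[OF max_frameD(1)[OF M], of "M - {e}"]
    by (auto simp: frame_insert orth_commute)
  moreover have "card (insert f (M - {e})) = card M"
    using card_insert_disjoint[OF _ notin] card_Suc_Diff1[OF _ e] max_frameD(2)[OF M] by simp
  ultimately show "max_frame (insert f (M - {e}))" using M by (simp add: max_frame_def)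
qed

lemma summand_exchange:
  assumes M: "max_frame M" and e: "e \<in> M" and f: "f \<in> exposed" "f \<in> summand e"
  shows "summand f = summand e"
proof -
  note x = max_frame_exchange[OF assms]
  have "insert f (M - {e}) - {f} = M - {e}" using x(2) by blast
  then show ?thesis using summand_eq[OF x(1), of f] summand_eq[OF M e] by simp
qed

lemma summand_orth:
  assumes M: "max_frame M" and e: "e \<in> M" and g: "g \<in> M" and "e \<noteq> g"
    and f: "f \<in> exposed" "f \<in> summand e" and y: "y \<in> summand g"
  shows "orth y f"
proof -
  note x = max_frame_exchange[OF M e f]
  have gM: "g \<in> insert f (M - {e})" "g \<noteq> f" using g \<open>e \<noteq> g\<close> x(2) by auto
  then show ?thesis using y unfolding summand_eq[OF x(1) gM(1)] by (simp add: orth_compl_def)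
qed

lemma summand_symmetry: "f \<in> exposed \<Longrightarrow> x \<in> summand f \<Longrightarrow> symmetry f x = (2 * phi f x) *\<^sub>R f - x"
  by (simp add: sym_eq summand_def)

text \<open>On its summand, the norm is smooth at an exposed point \<open>f\<close>: a supporting functional is
  invariant under the symmetry at \<open>f\<close>, which is \<open>-1\<close> on a complement of \<open>f\<close> in the summand.\<close>

lemma summand_support_unique:
  assumes f: "f \<in> exposed" and u: "linear u" "\<And>x. u x \<le> norm x" "u f = (1::real)"
    and x: "x \<in> summand f"
  shows "u x = phi f x"
proof -
  have "u (symmetry f x) = u x" by (rule sym_invariant[OF f u])
  then show ?thesis
    using u(3) by (simp add: summand_symmetry[OF f x] linear_diff[OF u(1)] linear_scale[OF u(1)])
qed

text \<open>A functional supporting the ball of the summand at \<open>z\<close> has an exposed point on its face: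
  exposed points \<open>f\<close> almost maximising it have symmetries \<open>x \<mapsto> 2 \<phi>\<^sub>f(x) f - x\<close>, which take the
  face, a facet of the ball of its span, to one and the same facet along a subsequence. This
  determines \<open>\<phi>\<^sub>f\<close>, so the subsequence is constant. By smoothness the functional is \<open>\<phi>\<^sub>f\<close>,
  and its face is \<open>{f}\<close>.\<close>

lemma unit_vector_exposed:
  assumes M: "max_frame M" and e: "e \<in> M" and z: "z \<in> summand e" "norm z = 1"
  shows "z \<in> exposed"
proof -
  note ee = max_frameD(3)[OF M e]
  obtain Q where "neutral_onto Q (orth_compl (M - {e}))"
    using frame_projection[OF frame_subset[OF max_frameD(1)[OF M]]] by (metis Diff_subset)
  then have Q: "neutral_onto Q (summand e)" by (simp add: summand_eq[OF M e])
  note Q' = neutral_ontoD[OF Q]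
  obtain u where u: "linear u" "\<And>x. u x \<le> norm x" "u z = norm z"
    using norming_functional[of z] by blast
  have "linear (\<lambda>x. u (Q x))" using linear_compose[OF Q'(1) u(1)] by (simp add: Fun.comp_def)
  moreover have "u (Q x) \<le> norm x" for x using order_trans[OF u(2) Q'(4)] .
  moreover have "u (Q z) = 1" using Q'(3)[OF z(1)] u(3) z(2) by simp
  ultimately obtain U :: "'a \<Rightarrow>\<^sub>L real" where U: "norm U = 1" "\<And>x. U x = u (Q x)"
    using functional_blinfun[of "\<lambda>x. u (Q x)" z] z(2) by (metis order_refl)
  have Uz: "U z = 1" by (simp add: U(2) Q'(3)[OF z(1)] u(3) z(2))
  have U_le: "U x \<le> norm x" for x using norm_blinfun[of U x] U(1) by simp
  have U_lin: "linear (blinfun_apply U)" by (simp add: blinfun.bounded_linear_right bounded_linear.linear)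
  define F where "F = face U"
  define V where "V = span F"
  have zF: "z \<in> F" using z(2) Uz by (simp add: F_def face_def)
  then have F: "norm_exposed_face F" using U(1) by (auto simp: norm_exposed_face_def F_def)
  have "x \<in> summand e" if "x \<in> F" for x
  proof -
    have "norm x \<le> 1" "u (Q x) = 1" using that by (auto simp: F_def face_def U(2))
    then have "norm (Q x) = norm x" using u(2)[of "Q x"] Q'(4)[of x] by linarith
    then show ?thesis using Q'(5)[of x] Q'(2)[of x] by simp
  qed
  then have V_sub: "V \<subseteq> summand e"
    unfolding V_def by (intro span_minimal subspace_summand[OF ee]) blast
  have V: "subspace V" unfolding V_def by (rule subspace_span)
  have zV: "z \<in> V" unfolding V_def by (rule span_base[OF zF])
  note P = neutral_onto_span_face[OF F, folded V_def]
  have "F \<noteq> {}" using zF by blast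
  obtain p r where p: "p \<in> F" "r > 0" "\<forall>x\<in>V. norm (x - p) < r \<longrightarrow> norm x = U x"
    by (rule face_relative_interior[OF U(1), folded F_def V_def, OF \<open>F \<noteq> {}\<close>])
  have pV: "p \<in> V" unfolding V_def by (rule span_base[OF p(1)])
  have "\<exists>f. f \<in> exposed \<and> f \<in> V \<and> 1 - 1 / real (Suc n) < U f" for n
    using exposed_norming[OF P U_lin zV, of "1 - 1 / real (Suc n)"] z(2) Uz by auto
  then obtain f where f: "\<And>n. f n \<in> exposed" "\<And>n. f n \<in> V" "\<And>n. 1 - 1 / real (Suc n) < U (f n)"
    by metis
  have summand_f: "summand (f n) = summand e" for n
    using summand_exchange[OF M e f(1)] f(2) V_sub by blast
  have sym_f: "symmetry (f n) x = (2 * phi (f n) x) *\<^sub>R f n - x" if "x \<in> V" for n x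
    using summand_symmetry[OF f(1)] that V_sub summand_f by blast
  have sym_V: "symmetry (f n) x \<in> V" if "x \<in> V" for n x
    unfolding sym_f[OF that] using that f(2) by (intro subspace_diff subspace_scale V)
  obtain s :: "nat \<Rightarrow> nat" where s: "strict_mono s"
    "\<And>m n x. x \<in> V \<Longrightarrow> U (symmetry (f (s m)) x) = U (symmetry (f (s n)) x)"
  proof (rule facet_images_subsequence[OF V U_lin pV p(2), where T = "\<lambda>n. symmetry (f n)"])
    show "norm x = U x" if "x \<in> V" "norm (x - p) < r" for x using p(3) that by blast
    show "linear (symmetry (f n))" "norm (symmetry (f n) x) = norm x"
      "symmetry (f n) (symmetry (f n) x) = x" for n x
      by (rule sym_linear[OF f(1)] sym_norm[OF f(1)] sym_sym[OF f(1)])+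
    show "symmetry (f n) x \<in> V" if "x \<in> V" for n x using that by (rule sym_V)
  qed blast
  have pos: "0 < U (f n)" for n
  proof -
    have "0 \<le> 1 - 1 / real (Suc n)" by simp
    then show ?thesis using f(3)[of n] by linarith
  qed
  have proportional: "phi (f (s m)) x * U (f (s m)) = phi (f (s n)) x * U (f (s n))" if "x \<in> V" for m n x
    using s(2)[OF that, of m n]
    by (simp add: sym_f[OF that] linear_diff[OF U_lin] linear_scale[OF U_lin])
  have value_le: "U (f (s n)) \<le> U (f (s m))" for m n
  proof -
    have "U (f (s n)) = phi (f (s m)) (f (s n)) * U (f (s m))"
      using proportional[OF f(2), of m "s n" n] by (simp add: phi_self[OF f(1)])
    also have "\<dots> \<le> 1 * U (f (s m))"
      using phi_le[OF f(1), of "s m" "f (s n)"] pos[of "s m"]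
      by (intro mult_right_mono) (auto simp: exposed_norm[OF f(1)])
    finally show ?thesis by simp
  qed
  have same: "f (s n) = f (s 0)" for n
  proof (rule phi_exposes[OF f(1)])
    show "norm (f (s n)) \<le> 1" by (simp add: exposed_norm[OF f(1)])
    have "U (f (s n)) = U (f (s 0))" using value_le by (rule antisym) (rule value_le)
    then show "phi (f (s 0)) (f (s n)) = 1"
      using proportional[OF f(2), of 0 "s n" n] pos[of "s n"] by (simp add: phi_self[OF f(1)])
  qed
  have "1 \<le> U (f (s 0))"
  proof (rule LIMSEQ_le_const2)
    show "(\<lambda>n. 1 - 1 / real (Suc n)) \<longlonglongrightarrow> 1"
      using tendsto_diff[OF tendsto_const LIMSEQ_Suc[OF lim_inverse_n'], of 1] by simp
    have "1 - 1 / real (Suc n) \<le> U (f (s 0))" for n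
    proof -
      have "1 / real (Suc (s n)) \<le> 1 / real (Suc n)" using seq_suble[OF s(1), of n] by (simp add: frac_le)
      then show ?thesis using f(3)[of "s n"] arg_cong[OF same[of n], of U] by linarith
    qed
    then show "\<exists>N. \<forall>n\<ge>N. 1 - 1 / real (Suc n) \<le> U (f (s 0))" by blast
  qed
  then have "U (f (s 0)) = 1" using U_le[of "f (s 0)"] exposed_norm[OF f(1)[of "s 0"]] by simp
  then have "phi (f (s 0)) z = 1"
    using summand_support_unique[OF f(1) U_lin U_le, of "s 0" z] Uz z(1) summand_f by simp
  then have "z = f (s 0)" using phi_exposes[OF f(1)] z(2) by simp
  then show ?thesis using f(1) by simp
qed

section \<open>The inner product\<close>

lemma exposed_not_between:
  assumes a: "a \<in> exposed" and "norm (a + s *\<^sub>R d) \<le> 1" "norm (a - t *\<^sub>R d) \<le> 1" "s > 0" "t > 0"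
  shows "d = (0::'a)"
proof -
  note L = phi_linear[OF a]
  have "1 + s * phi a d \<le> 1" "1 - t * phi a d \<le> 1"
    using order_trans[OF phi_le[OF a] assms(2)] order_trans[OF phi_le[OF a] assms(3)]
    by (simp_all add: linear_add[OF L] linear_diff[OF L] linear_scale[OF L] phi_self[OF a])
  then have "phi a d = 0" using assms(4,5) by (auto simp: mult_le_0_iff zero_le_mult_iff)
  then have "a + s *\<^sub>R d = a"
    by (intro phi_exposes[OF a assms(2)]) (simp add: linear_add[OF L] linear_scale[OF L] phi_self[OF a])
  then show ?thesis using assms(4) by simp
qed

lemma line_norm_minimum:
  fixes x h :: 'a
  assumes "h \<noteq> 0"
  obtains t0 where "\<And>t. norm (x - t0 *\<^sub>R h) \<le> norm (x - t *\<^sub>R h)"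
proof -
  define K where "K = 2 * norm x / norm h"
  have K: "K \<ge> 0" by (simp add: K_def)
  have "continuous_on {- K..K} (\<lambda>t. norm (x - t *\<^sub>R h))" by (intro continuous_intros)
  then obtain t0 where t0: "t0 \<in> {- K..K}" "\<And>t. t \<in> {- K..K} \<Longrightarrow> norm (x - t0 *\<^sub>R h) \<le> norm (x - t *\<^sub>R h)"
    using continuous_attains_inf[of "{- K..K}" "\<lambda>t. norm (x - t *\<^sub>R h)"] K by auto
  have "norm (x - t0 *\<^sub>R h) \<le> norm (x - t *\<^sub>R h)" if "t \<notin> {- K..K}" for t
  proof -
    have "norm (x - t0 *\<^sub>R h) \<le> norm x" using t0(2)[of 0] K by simp
    moreover have "K * norm h \<le> \<bar>t\<bar> * norm h" using that by (intro mult_right_mono) auto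
    then have "2 * norm x \<le> norm (t *\<^sub>R h)" using assms by (simp add: K_def)
    moreover have "norm (t *\<^sub>R h) - norm x \<le> norm (x - t *\<^sub>R h)"
      using norm_triangle_ineq2[of "t *\<^sub>R h" x] by (simp add: norm_minus_commute)
    ultimately show ?thesis by linarith
  qed
  then show thesis using that t0(2) by blast
qed

text \<open>Any two independent unit vectors \<open>x\<close>, \<open>y\<close> of a summand are exchanged by a symmetry. Let
  \<open>m\<close> be the point of least norm on the line through \<open>x\<close> and \<open>y\<close>. The supporting functional at
  \<open>m\<close> is constant on this line, so the symmetry at the direction of \<open>m\<close> reflects the line in \<open>m\<close>.
  It takes \<open>x\<close> to a unit vector on the line, which can only be \<open>y\<close> since the norm is strictly
  convex. Uniqueness of the supporting functionals turns the exchange into \<open>\<phi>\<^sub>x(y) = \<phi>\<^sub>y(x)\<close>.\<close>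

lemma phi_symmetric:
  assumes M: "max_frame M" and e: "e \<in> M" and x: "x \<in> summand e" "norm x = 1"
    and y: "y \<in> summand e" "norm y = 1"
  shows "phi x y = phi y x"
proof -
  note ee = max_frameD(3)[OF M e]
  note H = subspace_summand[OF ee]
  have unit: "z \<in> exposed" "summand z = summand e" if "z \<in> summand e" "norm z = 1" for z
    using unit_vector_exposed[OF M e that] summand_exchange[OF M e _ that(1)] by auto
  note xe = unit[OF x] and ye = unit[OF y]
  consider "y = x" | "y = - x" | "y \<noteq> x" "y \<noteq> - x" by blast
  then show ?thesis
  proof cases
    case 2
    then show ?thesis using xe(1)
      by (simp add: exposed_uminus(3) linear_neg[OF phi_linear] phi_self)
  next
    case 3
    define h where "h = x - y"
    have h: "h \<noteq> 0" "h \<in> summand e" using 3 subspace_diff[OF H x(1) y(1)] by (simp_all add: h_def)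
    obtain t0 where t0: "\<And>t. norm (x - t0 *\<^sub>R h) \<le> norm (x - t *\<^sub>R h)"
      using line_norm_minimum[OF h(1)] by blast
    define m0 where "m0 = x - t0 *\<^sub>R h"
    have m0H: "m0 \<in> summand e" unfolding m0_def using x(1) h(2) by (intro subspace_diff subspace_scale H)
    have m0: "m0 \<noteq> 0"
    proof
      assume "m0 = 0"
      then have eq: "(1 - t0) *\<^sub>R x = - (t0 *\<^sub>R y)" by (simp add: m0_def h_def algebra_simps)
      have "\<bar>1 - t0\<bar> = \<bar>t0\<bar>" using arg_cong[OF eq, of norm] x(2) y(2) by simp
      then have "t0 = 1 / 2" by linarith
      then have "(1 / 2) *\<^sub>R x = (1 / 2) *\<^sub>R (- y)" using eq by (simp only:) simp
      then have "x = - y" by (simp only: scaleR_cancel_left) simp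
      then show False using 3(2) by simp
    qed
    define m where "m = (1 / norm m0) *\<^sub>R m0"
    have mH: "m \<in> summand e" unfolding m_def by (rule subspace_scale[OF H m0H])
    have "norm m = 1" using m0 by (simp add: m_def)
    note me = unit[OF mH this]
    have "norm m0 \<le> norm (m0 + t *\<^sub>R h)" for t
      using t0[of "t0 - t"] by (simp add: m0_def algebra_simps)
    then obtain u where u: "linear u" "\<And>x. u x \<le> norm x" "u m0 = norm m0" "u h = 0"
      using norming_functional_annihilating[of m0 h] by blast
    have "u m = 1" using u(3) m0 by (simp add: m_def linear_scale[OF u(1)])
    then have "phi m h = 0"
      using summand_support_unique[OF me(1) u(1,2), of h] u(4) h(2) me(2) by simp
    then have Sh: "symmetry m h = - h" using summand_symmetry[OF me(1), of h] h(2) me(2) by simp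
    have "m0 = norm m0 *\<^sub>R m" using m0 by (simp add: m_def)
    then have Sm0: "symmetry m m0 = m0"
      by (metis linear_scale[OF sym_linear[OF me(1)]] sym_self[OF me(1)])
    have "symmetry m x = symmetry m (m0 + t0 *\<^sub>R h)" by (simp add: m0_def)
    also have "\<dots> = m0 - t0 *\<^sub>R h"
      by (simp add: linear_add[OF sym_linear[OF me(1)]] linear_scale[OF sym_linear[OF me(1)]] Sh Sm0)
    finally have Sx: "symmetry m x = x - (2 * t0) *\<^sub>R h"
      by (simp add: m0_def scaleR_add_left[of t0 t0, folded mult_2])
    define z where "z = symmetry m x"
    have z: "z \<in> summand e" "norm z = 1"
      using subspace_diff[OF H x(1) subspace_scale[OF H h(2)]] x(2)
      by (simp_all add: z_def sym_norm[OF me(1)]) (simp add: Sx)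
    note ze = unit[OF z]
    have "2 * t0 = 1"
    \<comment> \<open>Otherwise \<open>x\<close>, \<open>y\<close> and \<open>z\<close> are three distinct unit vectors on a line.\<close>
    proof (rule ccontr)
      assume ne: "2 * t0 \<noteq> 1"
      have "t0 \<noteq> 0"
      proof
        assume "t0 = 0"
        then have "m = x" using x(2) by (simp add: m_def m0_def)
        then have "phi x y = 1"
          using \<open>phi m h = 0\<close> by (simp add: h_def linear_diff[OF phi_linear[OF xe(1)]] phi_self[OF xe(1)])
        then show False using phi_exposes[OF xe(1)] y(2) 3(1) by simp
      qed
      with ne consider "2 * t0 < 0" | "0 < 2 * t0" "2 * t0 < 1" | "2 * t0 > 1" by linarith
      then have "h = 0"
      proof cases
        case 1
        then show ?thesis
          using x(2) y(2) z(2) Sx by (intro exposed_not_between[OF xe(1), of "- (2 * t0)" h 1])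
            (auto simp: z_def h_def)
      next
        case 2
        have "x = z + (2 * t0) *\<^sub>R h" "y = z - (1 - 2 * t0) *\<^sub>R h"
          using Sx by (simp_all add: z_def h_def algebra_simps)
        with 2 x(2) y(2) show ?thesis
          by (intro exposed_not_between[OF ze(1), of "2 * t0" h "1 - 2 * t0"]) auto
      next
        case 3
        have "x = y + 1 *\<^sub>R h" "z = y - (2 * t0 - 1) *\<^sub>R h"
          using Sx by (simp_all add: z_def h_def algebra_simps)
        with 3 x(2) z(2) show ?thesis
          by (intro exposed_not_between[OF ye(1), of 1 h "2 * t0 - 1"]) auto
      qed
      then show False using h(1) by simp
    qed
    then have Sxy: "symmetry m x = y" using Sx by (simp add: h_def)
    then have Syx: "symmetry m y = x" using sym_sym[OF me(1), of x] by simp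
    have "linear (\<lambda>w. phi y (symmetry m w))"
      using linear_compose[OF sym_linear[OF me(1)] phi_linear[OF ye(1)]] by (simp add: Fun.comp_def)
    moreover have "phi y (symmetry m w) \<le> norm w" for w
      using phi_le[OF ye(1), of "symmetry m w"] by (simp add: sym_norm[OF me(1)])
    moreover have "phi y (symmetry m x) = 1" by (simp add: Sxy phi_self[OF ye(1)])
    ultimately have "phi y (symmetry m y) = phi x y"
      using summand_support_unique[OF xe(1), of "\<lambda>w. phi y (symmetry m w)" y] y(1) xe(2) by blast
    then show ?thesis by (simp add: Syx)
  qed simp
qed

definition ip :: "'a \<Rightarrow> 'a \<Rightarrow> real"
  where "ip x y = norm x * phi (sgn x) y"

lemma sgn_in_summand: "e \<in> exposed \<Longrightarrow> x \<in> summand e \<Longrightarrow> sgn x \<in> summand e"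
  by (simp add: sgn_div_norm subspace_scale[OF subspace_summand])

lemma sgn_exposed:
  assumes "max_frame M" "e \<in> M" "x \<in> summand e" "x \<noteq> 0"
  shows "sgn x \<in> exposed"
  using assms by (intro unit_vector_exposed[OF assms(1,2)] sgn_in_summand max_frameD(3)[OF assms(1)])
    (auto simp: norm_sgn)

lemma ip_linear:
  assumes "max_frame M" "e \<in> M" "x \<in> summand e"
  shows "linear (ip x)"
proof (cases "x = 0")
  case True
  then show ?thesis by (simp add: ip_def[abs_def] module_hom_zero)
next
  case False
  show ?thesis unfolding ip_def[abs_def]
    using linear_compose_scale_right[OF phi_linear[OF sgn_exposed[OF assms False]], of "norm x"] by simp
qed

lemma phi_sgn: "e \<in> exposed \<Longrightarrow> phi e x = norm x * phi e (sgn x)" for x :: 'a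
proof -
  assume e: "e \<in> exposed"
  have "x = norm x *\<^sub>R sgn x" by (cases "x = 0") (simp_all add: sgn_div_norm)
  then have "phi e x = phi e (norm x *\<^sub>R sgn x)" by (rule arg_cong)
  then show ?thesis by (simp add: linear_scale[OF phi_linear[OF e]])
qed

lemma ip_self:
  assumes "max_frame M" "e \<in> M" "x \<in> summand e"
  shows "ip x x = (norm x)\<^sup>2"
proof (cases "x = 0")
  case False
  note s = sgn_exposed[OF assms False]
  then show ?thesis by (simp add: ip_def phi_sgn[OF s, of x] phi_self[OF s] power2_eq_square)
qed (simp add: ip_def)

lemma ip_commute:
  assumes M: "max_frame M" and e: "e \<in> M" and x: "x \<in> summand e" and y: "y \<in> summand e"
  shows "ip x y = ip y x"
proof (cases "x = 0 \<or> y = 0")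
  case True
  then show ?thesis
    using linear_0[OF ip_linear[OF M e x]] linear_0[OF ip_linear[OF M e y]] by (auto simp: ip_def)
next
  case False
  note ee = max_frameD(3)[OF M e]
  have sx: "sgn x \<in> exposed" and sy: "sgn y \<in> exposed" using sgn_exposed[OF M e] x y False by auto
  have "phi (sgn x) (sgn y) = phi (sgn y) (sgn x)"
    using False by (intro phi_symmetric[OF M e] sgn_in_summand[OF ee] x y) (auto simp: norm_sgn)
  then show ?thesis by (simp add: ip_def phi_sgn[OF sx, of y] phi_sgn[OF sy, of x])
qed

lemma ip_norm_eq_norm:
  assumes "max_frame M" "e \<in> M" "x \<in> summand e"
  shows "ip_norm ip x = norm x"
  by (simp add: ip_norm_def ip_self[OF assms])

lemma real_hilbert_space_on_summand:
  assumes M: "max_frame M" and e: "e \<in> M"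
  shows "real_hilbert_space_on (summand e) ip"
proof -
  note ee = max_frameD(3)[OF M e]
  note H = subspace_summand[OF ee]
  have "\<exists>l\<in>summand e. (\<lambda>n. ip_norm ip (X n - l)) \<longlonglongrightarrow> 0"
    if X: "\<forall>n. X n \<in> summand e"
      and Cau: "\<forall>\<epsilon>>0. \<exists>N. \<forall>m\<ge>N. \<forall>n\<ge>N. ip_norm ip (X m - X n) < \<epsilon>" for X :: "nat \<Rightarrow> 'a"
  proof -
    have "ip_norm ip (X m - X n) = norm (X m - X n)" for m n
      using X by (intro ip_norm_eq_norm[OF M e] subspace_diff[OF H]) auto
    then have C: "Cauchy X" using Cau by (simp add: Cauchy_iff)
    obtain R where "\<And>n. norm (X n) \<le> R"
      by (rule BseqE[OF Cauchy_Bseq[OF C]]) blast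
    then obtain l s where s: "strict_mono s" "(X \<circ> s) \<longlonglongrightarrow> l"
      using bounded_sequence_converges by blast
    have lim: "X \<longlonglongrightarrow> l"
    proof (rule LIMSEQ_I)
      fix r :: real assume r: "0 < r"
      obtain N1 where N1: "\<forall>m\<ge>N1. \<forall>n\<ge>N1. norm (X m - X n) < r / 2"
        using C r unfolding Cauchy_iff by (meson half_gt_zero)
      obtain N2 where N2: "\<forall>n\<ge>N2. norm ((X \<circ> s) n - l) < r / 2"
        using LIMSEQ_D[OF s(2), of "r / 2"] r by auto
      have "norm (X n - l) < r" if "n \<ge> N1" for n
      proof -
        define k where "k = max N1 N2"
        have "s k \<ge> N1" using seq_suble[OF s(1), of k] by (simp add: k_def)
        then have "norm (X n - X (s k)) < r / 2" using N1 that by blast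
        moreover have "norm (X (s k) - l) < r / 2" using N2 by (simp add: k_def)
        ultimately show ?thesis using norm_triangle_ineq[of "X n - X (s k)" "X (s k) - l"] by simp
      qed
      then show "\<exists>N. \<forall>n\<ge>N. norm (X n - l) < r" by blast
    qed
    have l: "l \<in> summand e" by (rule closed_sequentially[OF subspace_closed[OF H] _ lim]) (use X in blast)
    have "ip_norm ip (X n - l) = norm (X n - l)" for n
      using X l by (intro ip_norm_eq_norm[OF M e] subspace_diff[OF H]) auto
    then have "(\<lambda>n. ip_norm ip (X n - l)) \<longlonglongrightarrow> 0"
      using lim by (simp add: LIM_zero_iff tendsto_norm_zero_iff)
    then show ?thesis using l by blast
  qed
  moreover have "ip (x + y) z = ip x z + ip y z"
    if "x \<in> summand e" "y \<in> summand e" "z \<in> summand e" for x y z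
    using that linear_add[OF ip_linear[OF M e that(3)], of x y]
    by (simp add: ip_commute[OF M e _ that(3)] subspace_add[OF H])
  moreover have "ip (c *\<^sub>R x) y = c * ip x y" if "x \<in> summand e" "y \<in> summand e" for c x y
    using that linear_scale[OF ip_linear[OF M e that(2)], of c x]
    by (simp add: ip_commute[OF M e _ that(2)] subspace_scale[OF H])
  moreover have "0 < ip x x" if "x \<in> summand e" "x \<noteq> 0" for x
    using that by (simp add: ip_self[OF M e])
  ultimately show ?thesis
    unfolding real_hilbert_space_on_def using H ip_commute[OF M e] by blast
qed

section \<open>The decomposition\<close>

lemma component_summand_other:
  assumes M: "max_frame M" and "e \<in> M" "g \<in> M" "e \<noteq> g" "x \<in> summand e"
  shows "component g x = 0"
  using assms max_frameD(3)[OF M] unfolding summand_eq[OF M \<open>e \<in> M\<close>]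
  by (intro component_of_orth) (auto simp: orth_compl_def)

lemma component_sum:
  assumes M: "max_frame M" and h: "\<And>e. e \<in> M \<Longrightarrow> h e \<in> summand e" and g: "g \<in> M"
  shows "component g (\<Sum>e\<in>M. h e) = h g"
proof -
  have "component g (\<Sum>e\<in>M. h e) = (\<Sum>e\<in>M. component g (h e))"
    by (rule linear_sum[OF component_linear[OF max_frameD(3)[OF M g]]])
  also have "\<dots> = (\<Sum>e\<in>M. if e = g then h g else 0)"
    using component_summand_other[OF M _ g] h by (intro sum.cong) (auto simp: component_of_summand)
  also have "\<dots> = h g" using g max_frameD(2)[OF M] by simp
  finally show ?thesis .
qed

lemma sum_component:
  assumes M: "max_frame M"
  shows "(\<Sum>e\<in>M. component e x) = x"
proof -
  define y where "y = x - (\<Sum>e\<in>M. component e x)"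
  have "orth y g" if g: "g \<in> M" for g
  proof -
    note ge = max_frameD(3)[OF M g]
    have "component g y = component g x - component g (\<Sum>e\<in>M. component e x)"
      unfolding y_def by (rule linear_diff[OF component_linear[OF ge]])
    also have "\<dots> = 0"
      using component_sum[OF M _ g, of "\<lambda>e. component e x"] component_in_summand[OF max_frameD(3)[OF M]] by simp
    finally show ?thesis using P0_orth[OF ge, of y] by (simp add: component_def)
  qed
  then have "y \<in> orth_compl M" by (simp add: orth_compl_def)
  then show ?thesis using max_frame_orth_compl[OF M] by (simp add: y_def)
qed

text \<open>The directions of the components form a frame, and the functionals of a frame bound the
  norm from below.\<close>

lemma norm_sum_summands:
  assumes M: "max_frame M" and h: "\<And>e. e \<in> M \<Longrightarrow> h e \<in> summand e"
  shows "norm (\<Sum>e\<in>M. h e) = (\<Sum>e\<in>M. norm (h e))"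
proof (rule antisym)
  define f where "f e = (if h e = 0 then e else sgn (h e))" for e
  have f: "f e \<in> exposed" "f e \<in> summand e" if "e \<in> M" for e
    using max_frameD(3)[OF M that] h[OF that]
    by (auto simp: f_def summand_self sgn_exposed[OF M that] sgn_in_summand)
  have ff: "orth (f e) (f g)" if "e \<in> M" "g \<in> M" "e \<noteq> g" for e g
    using summand_orth[OF M that(2,1)] that f by auto
  have inj: "inj_on f M"
    using ff orth_self exposed_nonzero f(1) unfolding inj_on_def by metis
  have "frame (f ` M)" using f(1) ff by (auto simp: frame_def pairwise_def)
  from frame_sum_bound[OF this, of "\<Sum>e\<in>M. h e"]
  have "(\<Sum>e\<in>M. \<bar>phi (f e) (\<Sum>g\<in>M. h g)\<bar>) \<le> norm (\<Sum>e\<in>M. h e)"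
    by (simp add: sum.reindex[OF inj])
  moreover have "phi (f e) (\<Sum>g\<in>M. h g) = norm (h e)" if e: "e \<in> M" for e
  proof -
    note L = phi_linear[OF f(1)[OF e]]
    have "phi (f e) (h g) = 0" if "g \<in> M" "g \<noteq> e" for g
      using phi_orth[OF f(1)[OF e] summand_orth[OF M e that(1) _ f(1)[OF e] f(2)[OF e] h[OF that(1)]]]
        that(2) by simp
    moreover have "phi (f e) (h e) = norm (h e)"
    proof (cases "h e = 0")
      case False
      then have "h e = norm (h e) *\<^sub>R f e" by (simp add: f_def sgn_div_norm)
      then have "phi (f e) (h e) = phi (f e) (norm (h e) *\<^sub>R f e)" by (rule arg_cong)
      then show ?thesis by (simp only: linear_scale[OF L] phi_self[OF f(1)[OF e]]) simp
    qed (simp add: linear_0[OF L])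
    ultimately have "(\<Sum>g\<in>M. phi (f e) (h g)) = (\<Sum>g\<in>M. if g = e then norm (h e) else 0)"
      by (intro sum.cong) auto
    then show ?thesis using e max_frameD(2)[OF M] by (simp add: linear_sum[OF L])
  qed
  ultimately show "(\<Sum>e\<in>M. norm (h e)) \<le> norm (\<Sum>e\<in>M. h e)" by simp
qed (rule norm_sum)

lemma norm_eq_sum_component:
  assumes M: "max_frame M"
  shows "norm x = (\<Sum>e\<in>M. norm (component e x))"
  using norm_sum_summands[OF M, of "\<lambda>e. component e x"] component_in_summand[OF max_frameD(3)[OF M]]
  by (simp add: sum_component[OF M])

section \<open>The rank\<close>

text \<open>If \<open>p\<close> is relatively interior to the face and \<open>s > 0\<close> is small, then \<open>p + s a\<close> is a
  nonnegative multiple of an element of the face, so its norm and that of \<open>s b\<close> add up. Comparing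
  with \<open>\<parallel>p\<parallel> + s \<parallel>a + b\<parallel>\<close> bounds \<open>v a + \<parallel>b\<parallel>\<close>; the sign of \<open>v a\<close> is removed by passing to
  \<open>- a\<close> and \<open>- b\<close>.\<close>

lemma span_face_compl_bound:
  fixes v :: "'a \<Rightarrow>\<^sub>L real"
  assumes v: "norm v = 1" and ne: "face v \<noteq> {}" and a: "a \<in> span (face v)"
    and b: "b \<in> orth_compl (face v)"
  shows "\<bar>v a\<bar> + norm b \<le> norm (a + b)"
proof -
  obtain p r where p: "p \<in> face v" "r > 0" "\<forall>x\<in>span (face v). norm (x - p) < r \<longrightarrow> norm x = v x"
    by (rule face_relative_interior[OF v ne])
  have vp: "v p = 1" "norm p \<le> 1" using p(1) by (auto simp: face_def)
  have *: "v a + norm b \<le> norm (a + b)" if a: "a \<in> span (face v)" and b: "\<And>q. q \<in> face v \<Longrightarrow> orth q b" for a b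
  proof -
    define s where "s = r / (norm a + 1) / 2"
    have na: "norm a + 1 > 0" using norm_ge_zero[of a] by linarith
    have s: "s > 0" using p(2) na by (simp add: s_def)
    have "s * norm a < r"
    proof -
      have "s * norm a = (r / 2) * (norm a / (norm a + 1))" by (simp add: s_def)
      also have "\<dots> \<le> (r / 2) * 1" using p(2) na by (intro mult_left_mono) auto
      finally show ?thesis using p(2) by linarith
    qed
    define q where "q = p + s *\<^sub>R a"
    have "q \<in> span (face v)" unfolding q_def by (intro span_add[OF span_base[OF p(1)] span_scale[OF a]])
    then have nq: "norm q = v q" using p(3) \<open>s * norm a < r\<close> s by (simp add: q_def)
    have vq: "v q = 1 + s * v a" by (simp add: q_def blinfun.add_right blinfun.scaleR_right vp)
    have "norm (q + s *\<^sub>R b) = norm q + s * norm b"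
    proof (cases "q = 0")
      case False
      have "(1 / norm q) *\<^sub>R q \<in> face v"
        using False by (simp add: face_def blinfun.scaleR_right nq[symmetric])
      from orth_norm_add_scaled[OF b[OF this], of "norm q" s] show ?thesis using False s by simp
    qed (use s in simp)
    moreover have "q + s *\<^sub>R b = p + s *\<^sub>R (a + b)" by (simp add: q_def scaleR_add_right)
    then have "norm (q + s *\<^sub>R b) \<le> norm p + s * norm (a + b)"
      using norm_triangle_ineq[of p "s *\<^sub>R (a + b)"] s by simp
    ultimately have "s * (v a + norm b) \<le> s * norm (a + b)"
      using nq vq vp(2) by (simp add: distrib_left)
    then show ?thesis using s by simp
  qed
  have 1: "orth q b" "orth q (- b)" if "q \<in> face v" for q
    using b that by (auto simp: orth_compl_def orth_commute orth_neg_right)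
  have "norm (- a + - b) = norm (a + b)" by (metis minus_add_distrib norm_minus_cancel)
  then have "v (- a) + norm (- b) \<le> norm (a + b)" using *[OF span_neg[OF a] 1(2)] by simp
  then show ?thesis using *[OF a 1(1)] by (simp add: blinfun.minus_right abs_le_iff)
qed

text \<open>The tripotent \<open>u\<close> factors through the projection \<open>P\<^sub>0\<close> of \<open>v\<close>, which therefore preserves
  the norm of each element of the face of \<open>u\<close>. As for exposed points, this forces
  orthogonality to the face of \<open>v\<close>.\<close>

lemma orthogonal_tripotent_faces:
  assumes u: "geometric_tripotent u" and v: "geometric_tripotent v" and uv: "tripotent_orth u v"
    and f: "f \<in> face (u :: 'a \<Rightarrow>\<^sub>L real)" and g: "g \<in> face v"
  shows "orth f g"
proof -
  have nu: "norm u = 1" and nv: "norm v = 1" and F: "norm_exposed_face (face v)"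
    using u v by (auto simp: geometric_tripotent_def projective_unit_def symmetric_face_def)
  have ne: "face v \<noteq> {}" using g by blast
  note S = face_symmetry_props[OF F]
  obtain x :: "'a \<Rightarrow>\<^sub>L real" where x: "\<And>f. u f = x (peirce_proj0 (face v) f)"
    using uv by (auto simp: tripotent_orth_def dual_peirce0_def)
  define a b where "a = peirce_proj2 (face v) f" and "b = peirce_proj0 (face v) f"
  have a: "a \<in> span (face v)" and b: "b \<in> orth_compl (face v)"
    and ab: "(1 / 2) *\<^sub>R (f + face_symmetry (face v) f) = a + b"
    using face_peirce[OF F, of f] by (auto simp: a_def b_def)
  have Sb: "face_symmetry (face v) b = b" using S(6)[of b] b span_zero by force
  have "peirce_proj0 (face v) b = b"
    by (rule face_peirce_unique(2)[OF F span_zero b]) (simp add: Sb flip: scaleR_2)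
  then have "u b = u f" by (simp add: x b_def)
  then have ub: "u b = 1" using f by (simp add: face_def)
  have nb: "1 \<le> norm b" using norm_blinfun[of u b] nu ub by simp
  have nf: "norm f = 1" using f norm_blinfun[of u f] nu by (simp add: face_def)
  have ng: "norm g = 1" and vg: "v g = 1" using g norm_blinfun[of v g] nv by (auto simp: face_def)
  have half: "norm ((1 / 2) *\<^sub>R (y + face_symmetry (face v) y)) \<le> norm y" for y
    using norm_triangle_ineq[of y "face_symmetry (face v) y"] by (simp add: S(2))
  have va: "v a = 0"
    using span_face_compl_bound[OF nv ne a b] half[of f] nf nb by (simp add: ab)
  have "2 \<le> norm (f + s *\<^sub>R g)" if s: "\<bar>s\<bar> = 1" for s
  proof -
    have Sg: "face_symmetry (face v) g = g" by (rule span_face_fixed[OF F span_base[OF g]])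
    have "(1 / 2) *\<^sub>R ((f + s *\<^sub>R g) + face_symmetry (face v) (f + s *\<^sub>R g))
      = (1 / 2) *\<^sub>R (f + face_symmetry (face v) f) + s *\<^sub>R g"
      by (simp add: linear_add[OF S(1)] linear_scale[OF S(1)] Sg algebra_simps flip: scaleR_2)
    also have "\<dots> = (a + s *\<^sub>R g) + b" using ab by simp
    finally have "norm ((a + s *\<^sub>R g) + b) \<le> norm (f + s *\<^sub>R g)" using half[of "f + s *\<^sub>R g"] by simp
    moreover have "a + s *\<^sub>R g \<in> span (face v)" by (intro span_add[OF a span_scale[OF span_base[OF g]]])
    note span_face_compl_bound[OF nv ne this b]
    moreover have "v (a + s *\<^sub>R g) = s" by (simp add: blinfun.add_right blinfun.scaleR_right va vg)
    ultimately show ?thesis using nb s by simp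
  qed
  from this[of 1] this[of "- 1"] show ?thesis
    using norm_triangle_ineq[of f g] norm_triangle_ineq4[of f g] by (simp add: orth_def nf ng)
qed

lemma orth_component:
  assumes M: "max_frame M" and fg: "orth f g" and e: "e \<in> M"
  shows "orth (component e f) (component e g)"
proof -
  have *: "norm (component e f + component e g) = norm (component e f) + norm (component e g)"
    if "norm (f + g) = norm f + norm g" for g
  proof -
    have "(\<Sum>e\<in>M. norm (component e f + component e g)) = (\<Sum>e\<in>M. norm (component e (f + g)))"
      by (intro sum.cong refl) (simp add: linear_add[OF component_linear[OF max_frameD(3)[OF M]]])
    also have "\<dots> = norm (f + g)" by (rule norm_eq_sum_component[OF M, symmetric])
    also have "\<dots> = norm f + norm g" by (rule that)
    also have "\<dots> = (\<Sum>e\<in>M. norm (component e f) + norm (component e g))"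
      unfolding sum.distrib by (intro arg_cong2[of _ _ _ _ "(+)"] norm_eq_sum_component[OF M])
    finally have "(\<Sum>e\<in>M. norm (component e f + component e g))
      = (\<Sum>e\<in>M. norm (component e f) + norm (component e g))" .
    from sum_mono_inv[OF this norm_triangle_ineq e max_frameD(2)[OF M]] show ?thesis .
  qed
  have neg: "component e (- g) = - component e g" by (rule linear_neg[OF component_linear[OF max_frameD(3)[OF M e]]])
  show ?thesis using *[of g] *[of "- g"] fg by (simp add: orth_def neg)
qed

lemma summand_orth_imp_zero:
  assumes M: "max_frame M" and e: "e \<in> M" and x: "x \<in> summand e" and y: "y \<in> summand e"
    and xy: "orth x y"
  shows "x = 0 \<or> y = 0"
proof (rule ccontr)
  assume "\<not> (x = 0 \<or> y = 0)"
  then have x0: "x \<noteq> 0" and y0: "y \<noteq> 0" by auto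
  note sx = sgn_exposed[OF M e x x0]
  have "summand (sgn x) = summand e"
    using summand_exchange[OF M e sx] sgn_in_summand[OF max_frameD(3)[OF M e] x] by blast
  with y have "y \<in> summand (sgn x)" by (simp only:)
  then have "P0 (sgn x) y = 0" by (simp add: summand_def)
  moreover have "orth y (sgn x)"
    using orth_scale[of y x 1 "inverse (norm x)"] xy by (simp add: sgn_div_norm orth_commute)
  ultimately show False using P0_of_orth[OF sx] y0 by simp
qed

text \<open>Elements of the faces of orthogonal tripotents have no common nonzero component, because nonzero
  vectors of one summand are never orthogonal.\<close>

lemma has_rank_card_max_frame:
  assumes M: "max_frame M"
  shows "has_rank TYPE('a) (card M)"
  unfolding has_rank_def
proof (intro conjI allI impI)
  show "\<exists>A :: ('a \<Rightarrow>\<^sub>L real) set. orthogonal_tripotents A \<and> finite A \<and> card A = card M"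
  proof (intro exI[of _ "unit ` M"] conjI)
    have "inj_on unit M" by (metis face_unit inj_onI max_frameD(3)[OF M] singleton_inject)
    then show "card (unit ` M) = card M" by (rule card_image)
    show "finite (unit ` M)" using max_frameD(2)[OF M] by simp
    show "orthogonal_tripotents (unit ` M)"
      using max_frameD(3,4)[OF M]
      by (auto simp: orthogonal_tripotents_def pairwise_def geometric_tripotent_unit
          intro!: tripotent_orth_unit)
  qed
  fix A :: "('a \<Rightarrow>\<^sub>L real) set"
  assume A: "orthogonal_tripotents A"
  have "\<exists>f. f \<in> face u" if "u \<in> A" for u
    using A that by (auto simp: orthogonal_tripotents_def geometric_tripotent_def symmetric_face_def
        norm_exposed_face_def)
  then obtain f where f: "\<And>u. u \<in> A \<Longrightarrow> f u \<in> face u" by metis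
  have "\<exists>e\<in>M. component e (f u) \<noteq> 0" if u: "u \<in> A" for u
  proof (rule ccontr)
    assume "\<not> (\<exists>e\<in>M. component e (f u) \<noteq> 0)"
    then have "f u = 0" using sum_component[OF M, of "f u"] by simp
    then show False using f[OF u] by (simp add: face_def blinfun.zero_right)
  qed
  then obtain i where i: "\<And>u. u \<in> A \<Longrightarrow> i u \<in> M" "\<And>u. u \<in> A \<Longrightarrow> component (i u) (f u) \<noteq> 0" by metis
  have inj: "inj_on i A"
  proof (rule inj_onI, rule ccontr)
    fix u v assume uv: "u \<in> A" "v \<in> A" "i u = i v" "u \<noteq> v"
    have "orth (f u) (f v)"
      using A uv f by (intro orthogonal_tripotent_faces[of u v])
        (auto simp: orthogonal_tripotents_def pairwise_def)
    then have "orth (component (i u) (f u)) (component (i u) (f v))" by (rule orth_component[OF M _ i(1)[OF uv(1)]])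
    then have "component (i u) (f u) = 0 \<or> component (i u) (f v) = 0"
      using i(1)[OF uv(1)] max_frameD(3)[OF M]
      by (intro summand_orth_imp_zero[OF M i(1)[OF uv(1)]] component_in_summand) auto
    then show False using i(2) uv by metis
  qed
  have sub: "i ` A \<subseteq> M" using i(1) by blast
  show "finite A" using inj sub max_frameD(2)[OF M] by (rule inj_on_finite)
  show "card A \<le> card M" using inj sub max_frameD(2)[OF M] by (rule card_inj_on_le)
qed

lemma facial_rank_eq:
  assumes M: "max_frame M"
  shows "facial_rank TYPE('a) = card M"
  unfolding facial_rank_def
proof (rule the_equality[where P = "has_rank TYPE('a)"])
  show "has_rank TYPE('a) (card M)" by (rule has_rank_card_max_frame[OF M])
  fix n assume "has_rank TYPE('a) n"
  with has_rank_card_max_frame[OF M] show "n = card M"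
    unfolding has_rank_def by (metis antisym)
qed

lemma isometry_onto_summands:
  assumes M: "max_frame M" and e: "bij_betw e I M"
  shows "isometry_onto_l1_sum I (\<lambda>i. summand (e i)) (\<lambda>_. ip)
    (\<lambda>f. \<lambda>i\<in>I. component (e i) f)"
proof -
  have eM: "e i \<in> M" if "i \<in> I" for i using e that by (rule bij_betw_apply)
  note ex = max_frameD(3)[OF M eM]
  have total: "(\<Sum>i\<in>I. component (e i) f) = f" for f
    using sum.reindex_bij_betw[OF e, of "\<lambda>e. component e f"] sum_component[OF M, of f] by simp
  have "bij_betw (\<lambda>f. \<lambda>i\<in>I. component (e i) f) UNIV (\<Pi>\<^sub>E i\<in>I. summand (e i))"
  proof (rule bij_betwI[where g = "\<lambda>h. \<Sum>i\<in>I. h i"])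
    show "(\<lambda>f. \<lambda>i\<in>I. component (e i) f) \<in> UNIV \<rightarrow> (\<Pi>\<^sub>E i\<in>I. summand (e i))"
      using component_in_summand[OF ex] by auto
    show "(\<Sum>i\<in>I. (\<lambda>i\<in>I. component (e i) f) i) = f" for f
      by (rule trans[OF sum.cong[OF refl] total]) simp
    fix h assume h: "h \<in> (\<Pi>\<^sub>E i\<in>I. summand (e i))"
    have inv: "the_inv_into I e (e i) = i" if "i \<in> I" for i
      using e that by (simp add: bij_betw_def the_inv_into_f_f)
    have inv_mem: "the_inv_into I e c \<in> I" "e (the_inv_into I e c) = c" if "c \<in> M" for c
      using e that by (auto simp: bij_betw_def the_inv_into_into f_the_inv_into_f)
    define k where "k c = h (the_inv_into I e c)" for c
    have k: "k c \<in> summand c" if "c \<in> M" for c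
      using h inv_mem[OF that] unfolding k_def by (metis PiE_mem)
    have "(\<Sum>c\<in>M. k c) = (\<Sum>i\<in>I. k (e i))" by (rule sum.reindex_bij_betw[OF e, symmetric])
    also have "\<dots> = (\<Sum>i\<in>I. h i)" by (intro sum.cong refl) (simp add: k_def inv)
    finally have sum_eq: "(\<Sum>i\<in>I. h i) = (\<Sum>c\<in>M. k c)" ..
    have h_i: "component (e i) (\<Sum>i\<in>I. h i) = h i" if "i \<in> I" for i
    proof -
      have "component (e i) (\<Sum>i\<in>I. h i) = k (e i)"
        unfolding sum_eq by (rule component_sum[OF M k eM[OF that]])
      then show ?thesis by (simp add: k_def inv that)
    qed
    show "(\<lambda>i\<in>I. component (e i) (\<Sum>i\<in>I. h i)) = h"
      by (rule ext)
        (metis PiE_arb[OF h] h_i restrict_apply)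
  qed simp
  moreover have "norm f = (\<Sum>i\<in>I. ip_norm ip ((\<lambda>i\<in>I. component (e i) f) i))" for f
  proof -
    have "norm f = (\<Sum>c\<in>M. norm (component c f))" by (rule norm_eq_sum_component[OF M])
    also have "\<dots> = (\<Sum>i\<in>I. norm (component (e i) f))"
      by (rule sum.reindex_bij_betw[OF e, symmetric])
    also have "\<dots> = (\<Sum>i\<in>I. ip_norm ip ((\<lambda>i\<in>I. component (e i) f) i))"
      by (intro sum.cong refl) (simp add: ip_norm_eq_norm[OF M eM component_in_summand[OF ex]])
    finally show ?thesis .
  qed
  moreover have "linear (\<lambda>f. (\<lambda>i\<in>I. component (e i) f) i)" if "i \<in> I" for i
    using component_linear[OF ex[OF that]] that by simp
  ultimately show ?thesis unfolding isometry_onto_l1_sum_def by blast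
qed

end

theorem theorem3p1:
  fixes k :: nat
  assumes finite_dim: "\<exists>B :: 'a::real_normed_vector set. finite B \<and> span B = UNIV"
    and neutral: "neutral_space TYPE('a)"
    and SFS: "strongly_facially_symmetric TYPE('a)"
    and JP: "property_JP TYPE('a)"
    and rank: "k = facial_rank TYPE('a)"
  shows "\<exists>(H :: nat \<Rightarrow> 'a set) (ip :: nat \<Rightarrow> 'a \<Rightarrow> 'a \<Rightarrow> real) (T :: 'a \<Rightarrow> nat \<Rightarrow> 'a).
    (\<forall>i\<in>{1..k}. real_hilbert_space_on (H i) (ip i)) \<and> isometry_onto_l1_sum {1..k} H ip T"
proof -
  obtain B0 :: "'a set" where B0: "finite B0" "span B0 = UNIV" using finite_dim by blast
  obtain B where B: "B \<subseteq> B0" "independent B" "B0 \<subseteq> span B"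
    by (rule maximal_independent_subset) blast
  interpret neutral_sfs_JP B
  proof unfold_locales
    show "finite B" using B(1) B0(1) by (rule finite_subset)
    show "span B = UNIV" using span_mono[OF B(3)] B0(2) unfolding span_span by blast
  qed (fact B(2) neutral SFS JP)+
  obtain M where M: "max_frame M" by (rule max_frame_exists)
  have "k = card M" using rank facial_rank_eq[OF M] by simp
  then obtain e where e: "bij_betw e {1..k} M"
    using ex_bij_betw_nat_finite_1[OF max_frameD(2)[OF M]] by auto
  show ?thesis
  proof (intro exI conjI ballI)
    show "isometry_onto_l1_sum {1..k} (\<lambda>i. summand (e i)) (\<lambda>_. ip) (\<lambda>f. \<lambda>i\<in>{1..k}. component (e i) f)"
      by (rule isometry_onto_summands[OF M e])
    show "real_hilbert_space_on (summand (e i)) ip" if "i \<in> {1..k}" for i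
      by (rule real_hilbert_space_on_summand[OF M bij_betw_apply[OF e that]])
  qed
qed

end
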